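(* Let $G$ be a non-elementary, minimal, finitely generated convergence group on a compact metrizable space $M$, and let $\mu$ be a probability measure generating $G$ (i.e. the support of $\mu$ generates $G$) with finite entropy and finite logarithmic moment with respect to the word metric. Then $(M,\nu)$ is the Poisson boundary of $(G,\mu)$, where $\nu$ is the $\mu$-stationary Borel probability measure on $M$.
   Context: A convergence group on $M$ is a countable discrete group $G$ acting (by homeomorphisms) on the compact metrizable space $M$ such that for every infinite sequence $(g_n)\subset G$ of distinct elements there exist a subsequence $(g_{n_k})$ and points $a,b\in M$ such that $g_{n_k}|_{M\setminus\{a\}}$ converges to $b$ locally uniformly, that is, for every compact $K\subset M\setminus\{a\}$ and every open neighbourhood $U$ of $b$ there is $N$ such that $g_{n_k}(K)\subset U$ whenever $n_k>N$. The action is non-elementary if there is no invariant subset of $M$ consisting of 1 or 2 points, and minimal if $M$ has no proper (nonempty) closed invariant subset. Finite entropy means $-\sum_{g\in G}\mu(g)\log\mu(g)<\infty$. Finite logarithmic moment with respect to the word metric $d_w$ of a finite generating set means $\sum_{g\in G}\mu(g)\,|\log d_w(e,g)|<\infty$, where the term $g=e$ is omitted. A measure $\nu$ on a $G$-space $B$ is $\mu$-stationary if $\nu(A)=\sum_{g\in G}\mu(g)\,g\nu(A)$ for all measurable $A\subset B$, where $g\nu(A)=\nu(g^{-1}A)$. The existence and uniqueness of the $\mu$-stationary Borel probability measure $\nu$ on $M$ is a result of Gekhtman, Gerasimov, Potyagailo and Yang. The random walk is $w_n=g_1\cdots g_n$ with the $g_i$ independent of law $\mu$. A measurable $G$-space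 $(B,\nu)$ is a $\mu$-boundary of $(G,\mu)$ if $\nu$ is a $\mu$-stationary probability measure and, for almost every sample path $(w_n)$, the measures $w_n\nu$ converge weakly to a point mass. Regarding $\mu$-boundaries as measure spaces, set $(B_1,\nu_1)\ge (B_2,\nu_2)$ if there is a $G$-equivariant map $f:B_1\to B_2$ with $(B_2,\nu_2)=(f(B_1),f_*\nu_1)$. The Poisson boundary of $(G,\mu)$ is the unique (up to the equivalence given by this order) maximal $\mu$-boundary.
   Formalization: G is assumed infinite (for finite G, e.g. Z/3 acting on three points, the claim fails), and "the support of μ generates G" is read as generation as a semigroup, since generation only as a group does not suffice for maximality. *)

theory Defs
  imports "HOL-Algebra.Algebra" "HOL-Probability.Probability"
begin

subsection \<open>Words, the word metric, finite logarithmic moment, entropy\<close>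

definition word_prod :: "('g, 'x) monoid_scheme \<Rightarrow> 'g list \<Rightarrow> 'g" where
  "word_prod G xs = foldr (\<lambda>x y. x \<otimes>\<^bsub>G\<^esub> y) xs \<one>\<^bsub>G\<^esub>"

text \<open>The least element is only meaningful for \<open>g, h\<close> in the carrier and a generating set \<open>S\<close>.\<close>

definition word_metric :: "('g, 'x) monoid_scheme \<Rightarrow> 'g set \<Rightarrow> 'g \<Rightarrow> 'g \<Rightarrow> nat" where
  "word_metric G S g h =
     (LEAST n. \<exists>xs. length xs = n \<and> set xs \<subseteq> S \<union> (\<lambda>s. inv\<^bsub>G\<^esub> s) ` S
                    \<and> word_prod G xs = inv\<^bsub>G\<^esub> g \<otimes>\<^bsub>G\<^esub> h)"

text \<open>
  A probability measure \<open>\<mu>\<close> on the countable group \<open>G\<close> is a pmf whose support lies in the carrier.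
  The generation condition is the one usual for random walks: the semigroup generated by the
  support is all of \<open>G\<close>.  (Generation as a group only is not enough for maximality below: it does
  not make stationary measures quasi-invariant under all of \<open>G\<close>.)
\<close>

definition generating_measure :: "('g, 'x) monoid_scheme \<Rightarrow> 'g pmf \<Rightarrow> bool" where
  "generating_measure G \<mu> \<longleftrightarrow>
     set_pmf \<mu> \<subseteq> carrier G \<and>
     carrier G = {word_prod G xs | xs. xs \<noteq> [] \<and> set xs \<subseteq> set_pmf \<mu>}"

text \<open>All summands have constant sign, so unconditional summability is finiteness of the sum;
  \<open>ln 0 = 0\<close> gives the usual convention \<open>0 log 0 = 0\<close>.\<close>

definition finite_entropy :: "('g, 'x) monoid_scheme \<Rightarrow> 'g pmf \<Rightarrow> bool" where
  "finite_entropy G \<mu> \<longleftrightarrow> (\<lambda>g. - (pmf \<mu> g * ln (pmf \<mu> g))) summable_on carrier G"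

definition finite_log_moment :: "('g, 'x) monoid_scheme \<Rightarrow> 'g set \<Rightarrow> 'g pmf \<Rightarrow> bool" where
  "finite_log_moment G S \<mu> \<longleftrightarrow>
     (\<lambda>g. pmf \<mu> g * \<bar>ln (real (word_metric G S \<one>\<^bsub>G\<^esub> g))\<bar>) summable_on (carrier G - {\<one>\<^bsub>G\<^esub>})"


subsection \<open>Convergence groups\<close>

text \<open>The space \<open>M\<close> is the whole type \<open>'m\<close>; only the topology of the metric is used.\<close>

definition convergence_group ::
    "('g, 'x) monoid_scheme \<Rightarrow> ('g \<Rightarrow> 'm::metric_space \<Rightarrow> 'm) \<Rightarrow> bool" where
  "convergence_group G \<phi> \<longleftrightarrow>
     countable (carrier G) \<and> group_action G UNIV \<phi> \<and>
     (\<forall>g\<in>carrier G. homeomorphism UNIV UNIV (\<phi> g) (\<phi> (inv\<^bsub>G\<^esub> g))) \<and>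
     (\<forall>s::nat \<Rightarrow> 'g. inj s \<and> range s \<subseteq> carrier G \<longrightarrow>
        (\<exists>r a b. strict_mono (r::nat \<Rightarrow> nat) \<and>
           (\<forall>K U. compact K \<and> K \<subseteq> UNIV - {a} \<and> open U \<and> b \<in> U \<longrightarrow>
              (\<exists>N. \<forall>k. r k > N \<longrightarrow> \<phi> (s (r k)) ` K \<subseteq> U))))"

definition invariant_set :: "('g, 'x) monoid_scheme \<Rightarrow> ('g \<Rightarrow> 'm \<Rightarrow> 'm) \<Rightarrow> 'm set \<Rightarrow> bool" where
  "invariant_set G \<phi> F \<longleftrightarrow> (\<forall>g\<in>carrier G. \<phi> g ` F \<subseteq> F)"

definition non_elementary :: "('g, 'x) monoid_scheme \<Rightarrow> ('g \<Rightarrow> 'm \<Rightarrow> 'm) \<Rightarrow> bool" where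
  "non_elementary G \<phi> \<longleftrightarrow> \<not> (\<exists>F. (card F = 1 \<or> card F = 2) \<and> invariant_set G \<phi> F)"

definition minimal_action ::
    "('g, 'x) monoid_scheme \<Rightarrow> ('g \<Rightarrow> 'm::topological_space \<Rightarrow> 'm) \<Rightarrow> bool" where
  "minimal_action G \<phi> \<longleftrightarrow>
     (\<forall>C. closed C \<and> C \<noteq> {} \<and> invariant_set G \<phi> C \<longrightarrow> C = UNIV)"


subsection \<open>Stationary measures, boundaries and the Poisson boundary\<close>

text \<open>The translate \<open>g\<nu>\<close>, i.e. \<open>A \<mapsto> \<nu> (g\<inverse> A)\<close>: the set \<open>g\<inverse> A\<close> is the preimage of \<open>A\<close> under
  the action of \<open>g\<close>.\<close>

definition translate ::
    "('g \<Rightarrow> 'b::topological_space \<Rightarrow> 'b) \<Rightarrow> 'g \<Rightarrow> 'b measure \<Rightarrow> 'b measure" where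
  "translate \<phi> g \<nu> = distr \<nu> borel (\<phi> g)"

definition stationary_prob :: "('g, 'x) monoid_scheme \<Rightarrow> 'g pmf \<Rightarrow>
    ('g \<Rightarrow> 'b::topological_space \<Rightarrow> 'b) \<Rightarrow> 'b measure \<Rightarrow> bool" where
  "stationary_prob G \<mu> \<phi> \<nu> \<longleftrightarrow>
     prob_space \<nu> \<and> sets \<nu> = sets borel \<and>
     (\<forall>A\<in>sets borel. measure \<nu> A =
        (\<Sum>\<^sub>\<infinity>g\<in>carrier G. pmf \<mu> g * measure (translate \<phi> g \<nu>) A))"

text \<open>\<open>random_walk G \<omega> n\<close> is \<open>w_n = g_1 \<cdots> g_n\<close>, where \<open>g_i = \<omega> (i - 1)\<close>; the increments
  are independent of law \<open>\<mu>\<close> under \<open>increments \<mu>\<close>.\<close>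

primrec random_walk :: "('g, 'x) monoid_scheme \<Rightarrow> (nat \<Rightarrow> 'g) \<Rightarrow> nat \<Rightarrow> 'g" where
  "random_walk G \<omega> 0 = \<one>\<^bsub>G\<^esub>"
| "random_walk G \<omega> (Suc n) = random_walk G \<omega> n \<otimes>\<^bsub>G\<^esub> \<omega> n"

definition increments :: "'g pmf \<Rightarrow> (nat \<Rightarrow> 'g) measure" where
  "increments \<mu> = Pi\<^sub>M (UNIV :: nat set) (\<lambda>_. measure_pmf \<mu>)"

definition weakly_converges :: "(nat \<Rightarrow> 'b::topological_space measure) \<Rightarrow> 'b measure \<Rightarrow> bool" where
  "weakly_converges N L \<longleftrightarrow>
     (\<forall>f::'b \<Rightarrow> real. continuous_on UNIV f \<and> bounded (range f) \<longrightarrow>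
        (\<lambda>n. integral\<^sup>L (N n) f) \<longlonglongrightarrow> integral\<^sup>L L f)"

text \<open>Weak convergence needs a topology, so a measurable \<open>G\<close>-space is a topological space with a
  Borel (not necessarily continuous) action.\<close>

definition mu_boundary :: "('g, 'x) monoid_scheme \<Rightarrow> 'g pmf \<Rightarrow>
    ('g \<Rightarrow> 'b::topological_space \<Rightarrow> 'b) \<Rightarrow> 'b measure \<Rightarrow> bool" where
  "mu_boundary G \<mu> \<phi> \<nu> \<longleftrightarrow>
     group_action G UNIV \<phi> \<and> (\<forall>g\<in>carrier G. \<phi> g \<in> borel \<rightarrow>\<^sub>M borel) \<and>
     stationary_prob G \<mu> \<phi> \<nu> \<and>
     (AE \<omega> in increments \<mu>.
        \<exists>b. weakly_converges (\<lambda>n. translate \<phi> (random_walk G \<omega> n) \<nu>) (return borel b))"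

text \<open>\<open>(B_1, \<nu>_1) \<ge> (B_2, \<nu>_2)\<close> as measure spaces, hence equivariance up to null sets; that the
  image of \<open>f\<close> is all of \<open>B_2\<close> up to null sets is implied by the pushforward equation.\<close>

definition boundary_ge :: "('g, 'x) monoid_scheme \<Rightarrow>
    ('g \<Rightarrow> 'a::topological_space \<Rightarrow> 'a) \<Rightarrow> 'a measure \<Rightarrow>
    ('g \<Rightarrow> 'b::topological_space \<Rightarrow> 'b) \<Rightarrow> 'b measure \<Rightarrow> bool" where
  "boundary_ge G \<phi>\<^sub>1 \<nu>\<^sub>1 \<phi>\<^sub>2 \<nu>\<^sub>2 \<longleftrightarrow>
     (\<exists>f. f \<in> borel \<rightarrow>\<^sub>M borel \<and>
          (\<forall>g\<in>carrier G. AE x in \<nu>\<^sub>1. f (\<phi>\<^sub>1 g x) = \<phi>\<^sub>2 g (f x)) \<and>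
          distr \<nu>\<^sub>1 borel f = \<nu>\<^sub>2)"

text \<open>
  The Poisson boundary is the largest \<open>\<mu>\<close>-boundary, where boundaries range over Polish spaces
  (standard Borel measure spaces).  As HOL cannot quantify over types inside a formula, the type of
  the competing boundaries is a parameter, to be left as a type variable in statements.
\<close>

definition is_Poisson_boundary :: "'b::polish_space itself \<Rightarrow> ('g, 'x) monoid_scheme \<Rightarrow> 'g pmf \<Rightarrow>
    ('g \<Rightarrow> 'm::topological_space \<Rightarrow> 'm) \<Rightarrow> 'm measure \<Rightarrow> bool" where
  "is_Poisson_boundary _ G \<mu> \<phi> \<nu> \<longleftrightarrow>
     mu_boundary G \<mu> \<phi> \<nu> \<and>
     (\<forall>(\<psi> :: 'g \<Rightarrow> 'b \<Rightarrow> 'b) \<eta>. mu_boundary G \<mu> \<psi> \<eta> \<longrightarrow> boundary_ge G \<phi> \<nu> \<psi> \<eta>)"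

end

theory Submission
  imports Defs "HOL-Real_Asymp.Real_Asymp"
begin

text \<open>
  Let \<open>B\<close> be a competing boundary and let \<open>\<lambda>\<close> be the joint law of the limits of the walk in \<open>M\<close> and
  in \<open>B\<close>. If \<open>d(g\<lambda>)/d\<lambda>\<close> is the lift of \<open>d(g\<nu>)/d\<nu>\<close> for all \<open>g\<close>, then \<open>g\<eta>(A) = \<integral>q\<^sub>A d(g\<nu>)\<close>, where \<open>q\<^sub>A\<close>
  is the conditional probability of \<open>A\<close> given the coordinate in \<open>M\<close>; letting \<open>g\<close> run along the walk
  shows that the limit in \<open>B\<close> is a function of the limit in \<open>M\<close>. The densities agree as soon as the
  Furstenberg entropies of \<open>\<lambda>\<close> and \<open>\<nu>\<close> do. These are additive in the number of steps, and the entropy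
  of \<open>\<lambda>\<close> for \<open>n\<close> steps is at most that of the \<open>n\<close>-step law of the walk. So, by Gibbs' inequality, \<open>n\<close> times the difference
  of the two entropies is at most the mean code length of \<open>w\<^sub>n\<close> for any code that may use the limit \<open>x \<in> M\<close> of the walk.

  The code lists the strip \<open>{g. d(g\<inverse>o, g\<inverse>x) \<ge> \<delta>}\<close> between a fixed point \<open>o\<close> and \<open>x\<close>, inside a word ball
  of radius \<open>n exp(\<epsilon>n)\<close>, which contains \<open>w\<^sub>n\<close> with probability close to 1 by the logarithmic moment condition.
  By the convergence property strips grow linearly, so this costs \<open>O(\<epsilon>n)\<close>. As \<open>w\<^sub>n\<inverse>x\<close> is independent of \<open>w\<^sub>n\<close> with
  the nonatomic law \<open>\<nu>\<close>, the walk leaves the strip with small probability, and then \<open>w\<^sub>n\<close> is coded by its increments at a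
  cost that is controlled by the entropy of \<open>\<mu>\<close>.
\<close>

subsection \<open>The random walk and its path space\<close>

text \<open>Only the logarithm of the word length is integrable, so \<open>w_n\<close> is caught by
  a ball whose radius is exponential in \<epsilon>n. Listing such a ball may cost far more than n,
  but a strip has only linearly many elements in it, and the logarithm of that number is of order
  \<epsilon>n. This is how linear strip growth fits a logarithmic moment. Strips are usually drawn
  between the limits of the past and of the future of a two-sided walk. Here one end is a fixed
  arbitrary point: \<open>w_n\<close> is in the strip once the inverse of \<open>w_n\<close>
  separates the two ends by \<delta>, and it moves the limit x to a point of law \<nu> that misses
  every small ball with high probability, wherever it moves o. The code length of \<open>w_n\<close>
  and its escape from the strip are dependent, and the former is unbounded. Truncating the code
  lengths of the increments at a level T separates the two: the bounded part is multiplied by a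
  small probability, the excess has a small mean. That the walk has a limit in M is itself proved
  below: integrals of distance functions against the translates of \<nu> are bounded martingales,
  and the convergence property identifies the possible limits as point masses.\<close>

lemma word_prod_Nil [simp]: "word_prod G [] = \<one>\<^bsub>G\<^esub>"
  by (simp add: word_prod_def)

lemma word_prod_Cons [simp]: "word_prod G (x # xs) = x \<otimes>\<^bsub>G\<^esub> word_prod G xs"
  by (simp add: word_prod_def)

context group
begin

lemma word_prod_closed: "set xs \<subseteq> carrier G \<Longrightarrow> word_prod G xs \<in> carrier G"
  by (induction xs) auto

lemma word_prod_append:
  "set xs \<subseteq> carrier G \<Longrightarrow> set ys \<subseteq> carrier G \<Longrightarrow>
     word_prod G (xs @ ys) = word_prod G xs \<otimes> word_prod G ys"
  by (induction xs) (auto simp: m_assoc word_prod_closed)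

end

locale walk = group G for G :: "('g, 'x) monoid_scheme" (structure) +
  fixes \<mu> :: "'g pmf"
  assumes countable_carrier: "countable (carrier G)"
    and generating: "generating_measure G \<mu>"
begin

lemma set_mu: "set_pmf \<mu> \<subseteq> carrier G"
  using generating unfolding generating_measure_def by blast

text \<open>The law of the walk at time n, the n-fold convolution power of \<mu>. Building it from
  lists keeps the increments at hand for the code in \<open>entropy_tail_le\<close>.\<close>

definition step :: "nat \<Rightarrow> 'g pmf" where
  "step n = map_pmf (word_prod G) (replicate_pmf n \<mu>)"

lemma set_step: "set_pmf (step n) \<subseteq> carrier G"
  unfolding step_def using set_mu by (auto simp: set_replicate_pmf intro!: word_prod_closed)

lemma step_0 [simp]: "step 0 = return_pmf \<one>"
  by (simp add: step_def)

lemma step_Suc: "step (Suc n) = map_pmf (\<lambda>(g, h). g \<otimes> h) (pair_pmf \<mu> (step n))"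
  by (simp add: step_def map_bind_pmf pair_pmf_def bind_map_pmf)

lemma step_1: "step (Suc 0) = \<mu>"
proof -
  have "step (Suc 0) = map_pmf (\<lambda>g. g \<otimes> \<one>) \<mu>"
    by (simp add: step_Suc pair_return_pmf2 map_pmf_comp)
  also have "\<dots> = map_pmf id \<mu>"
    using set_mu by (intro map_pmf_cong) auto
  finally show ?thesis by simp
qed

lemma nn_integral_step_Suc:
  "(\<integral>\<^sup>+g. f g \<partial>step (Suc n)) = (\<integral>\<^sup>+g. \<integral>\<^sup>+h. f (g \<otimes> h) \<partial>step n \<partial>\<mu>)"
  by (simp add: step_Suc nn_integral_pair_pmf')

text \<open>Generation as a semigroup enters here: every element has positive mass at some time n,
  and stationarity at that time controls its action.\<close>

lemma carrier_step: assumes "g \<in> carrier G" obtains n where "n > 0" "g \<in> set_pmf (step n)"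
proof -
  obtain xs where xs: "g = word_prod G xs" "xs \<noteq> []" "set xs \<subseteq> set_pmf \<mu>"
    using assms generating unfolding generating_measure_def by blast
  then have "g \<in> set_pmf (step (length xs))"
    by (auto simp: step_def set_replicate_pmf)
  with xs that show thesis by blast
qed

text \<open>The factorization \<open>(g, h)\<close> is only one of the contributions to the
  convolution at \<open>g \<otimes> h\<close>.\<close>

lemma pmf_step_Suc: "pmf \<mu> g * pmf (step n) h \<le> pmf (step (Suc n)) (g \<otimes> h)"
proof -
  have "pmf \<mu> g * pmf (step n) h = pmf (pair_pmf \<mu> (step n)) (g, h)"
    by (simp add: pmf_pair)
  also have "\<dots> \<le> pmf (step (Suc n)) (g \<otimes> h)"
    unfolding step_Suc by (subst pmf_map, subst measure_pmf_single[symmetric])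
      (rule measure_pmf.finite_measure_mono, auto)
  finally show ?thesis .
qed

abbreviation "P \<equiv> increments \<mu>"

definition trunc :: "'g \<Rightarrow> 'g" where
  "trunc g = (if g \<in> carrier G then g else \<one>)"

text \<open>Truncating the increments to the carrier changes the walk only on a null set, but makes it
  measurable, which the junk values of the multiplication outside of the carrier could destroy.\<close>

definition W :: "nat \<Rightarrow> (nat \<Rightarrow> 'g) \<Rightarrow> 'g" where
  "W n \<omega> = random_walk G (\<lambda>i. trunc (\<omega> i)) n"

lemma trunc_closed [simp]: "trunc g \<in> carrier G" and trunc_id [simp]: "g \<in> carrier G \<Longrightarrow> trunc g = g"
  by (auto simp: trunc_def)

lemma W_closed [simp]: "W n \<omega> \<in> carrier G"
  unfolding W_def by (induction n) auto

lemma W_0 [simp]: "W 0 \<omega> = \<one>" by (simp add: W_def)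

lemma W_Suc: "W (Suc n) \<omega> = W n \<omega> \<otimes> trunc (\<omega> n)" by (simp add: W_def)

lemma W_comb_seq_le: "k \<le> n \<Longrightarrow> W k (comb_seq n \<omega> \<omega>') = W k \<omega>"
  by (induction k) (auto simp: W_Suc comb_seq_less)

lemma W_comb_seq: "W (n + m) (comb_seq n \<omega> \<omega>') = W n \<omega> \<otimes> W m \<omega>'"
proof (induction m)
  case 0
  show ?case by (simp add: W_comb_seq_le)
next
  case (Suc m)
  have "comb_seq n \<omega> \<omega>' (n + m) = \<omega>' m" by (simp add: comb_seq_def)
  then show ?case using Suc by (simp add: W_Suc m_assoc)
qed

lemma W_case_nat: "W (Suc n) (case_nat g \<omega>) = trunc g \<otimes> W n \<omega>"
proof -
  have "W (Suc n) (case_nat g \<omega>) = W (1 + n) (comb_seq 1 (\<lambda>_. g) \<omega>)"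
    by simp
  also have "\<dots> = W 1 (\<lambda>_. g) \<otimes> W n \<omega>"
    by (rule W_comb_seq)
  also have "W 1 (\<lambda>_. g) = trunc g" by (simp add: W_Suc)
  finally show ?thesis .
qed

sublocale seq: sequence_space "measure_pmf \<mu>" by standard

lemma seq_S: "seq.S = P" by (simp add: increments_def)

sublocale P: prob_space P
  unfolding increments_def by (rule prob_space_PiM) (rule measure_pmf.prob_space_axioms)

lemma space_P [simp]: "space P = UNIV"
  by (simp add: increments_def space_PiM)

lemma measurable_coord: "(\<lambda>\<omega>. \<omega> i) \<in> P \<rightarrow>\<^sub>M count_space UNIV"
proof -
  have "(\<lambda>\<omega>. \<omega> i) \<in> P \<rightarrow>\<^sub>M measure_pmf \<mu>"
    unfolding increments_def by measurable
  moreover have "P \<rightarrow>\<^sub>M measure_pmf \<mu> = P \<rightarrow>\<^sub>M count_space UNIV"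
    by (rule measurable_cong_sets) simp_all
  ultimately show ?thesis by simp
qed

lemma measurable_trunc_coord: "(\<lambda>\<omega>. trunc (\<omega> i)) \<in> P \<rightarrow>\<^sub>M count_space (carrier G)"
  by (rule measurable_compose[OF measurable_coord]) auto

lemma measurable_W: "W n \<in> P \<rightarrow>\<^sub>M count_space (carrier G)"
proof (induction n)
  case (Suc n)
  have "(\<lambda>\<omega>. (\<lambda>g. W n \<omega> \<otimes> g) (trunc (\<omega> n))) \<in> P \<rightarrow>\<^sub>M count_space (carrier G)"
  proof (rule measurable_compose_countable'[OF _ measurable_trunc_coord countable_carrier])
    fix g assume "g \<in> carrier G"
    then show "(\<lambda>\<omega>. W n \<omega> \<otimes> g) \<in> P \<rightarrow>\<^sub>M count_space (carrier G)"
      by (intro measurable_compose[OF Suc]) auto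
  qed
  then show ?case by (simp add: W_Suc[abs_def])
next
  case 0
  have "W 0 = (\<lambda>_. \<one>)" by auto
  then show ?case by simp
qed

lemma measurable_W_comp:
  "f \<in> carrier G \<rightarrow> space N \<Longrightarrow> (\<lambda>\<omega>. f (W n \<omega>)) \<in> P \<rightarrow>\<^sub>M N"
  by (rule measurable_compose[OF measurable_W]) auto

lemma borel_measurable_W: "(\<lambda>\<omega>. f (W n \<omega>) :: 'b :: topological_space) \<in> borel_measurable P"
  by (rule measurable_W_comp) auto

lemma AE_W: "AE \<omega> in P. \<forall>n. random_walk G \<omega> n = W n \<omega>"
proof -
  have "AE \<omega> in P. \<forall>i. \<omega> i \<in> carrier G"
  proof (subst AE_all_countable, rule allI)
    fix i
    show "AE \<omega> in P. \<omega> i \<in> carrier G"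
      unfolding increments_def
      by (rule AE_PiM_component) (use set_mu in \<open>auto simp: measure_pmf.prob_space_axioms AE_measure_pmf_iff\<close>)
  qed
  then show ?thesis
  proof eventually_elim
    case (elim \<omega>)
    then have "(\<lambda>i. trunc (\<omega> i)) = \<omega>" by auto
    then show ?case by (simp add: W_def)
  qed
qed

lemma nn_integral_P_iter:
  assumes [measurable]: "F \<in> borel_measurable P"
  shows "(\<integral>\<^sup>+\<omega>. F \<omega> \<partial>P) = (\<integral>\<^sup>+g. \<integral>\<^sup>+\<omega>. F (case_nat g \<omega>) \<partial>P \<partial>\<mu>)"
proof -
  note [measurable] = assms[folded seq_S]
  have m: "(\<lambda>x. case_nat (fst x) (snd x)) \<in> measure_pmf \<mu> \<Otimes>\<^sub>M seq.S \<rightarrow>\<^sub>M seq.S"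
    by measurable
  have "(\<integral>\<^sup>+\<omega>. F \<omega> \<partial>P) = (\<integral>\<^sup>+\<omega>. F \<omega> \<partial>distr (measure_pmf \<mu> \<Otimes>\<^sub>M seq.S) seq.S (\<lambda>(s, \<omega>). case_nat s \<omega>))"
    by (simp only: seq.PiM_iter) (simp add: seq_S)
  also have "\<dots> = (\<integral>\<^sup>+x. F (case_nat (fst x) (snd x)) \<partial>(measure_pmf \<mu> \<Otimes>\<^sub>M seq.S))"
    by (subst nn_integral_distr) (use m in \<open>auto simp: split_beta'\<close>)
  also have "\<dots> = (\<integral>\<^sup>+g. \<integral>\<^sup>+\<omega>. F (case_nat g \<omega>) \<partial>seq.S \<partial>\<mu>)"
    using measurable_compose[OF m assms[folded seq_S]]
    by (subst seq.P.nn_integral_fst[symmetric]) auto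
  finally show ?thesis by (simp add: seq_S)
qed

text \<open>Two independent copies of the path, spliced at time n, have law \<open>P\<close> again.
  This is the Markov property in the form used below.\<close>

lemma nn_integral_P_comb_seq:
  assumes "F \<in> borel_measurable P"
  shows "(\<integral>\<^sup>+\<omega>. F \<omega> \<partial>P) = (\<integral>\<^sup>+\<omega>. \<integral>\<^sup>+\<omega>'. F (comb_seq n \<omega> \<omega>') \<partial>P \<partial>P)"
proof -
  have m: "(\<lambda>x. comb_seq n (fst x) (snd x)) \<in> seq.S \<Otimes>\<^sub>M seq.S \<rightarrow>\<^sub>M seq.S"
    by measurable
  have "(\<integral>\<^sup>+\<omega>. F \<omega> \<partial>P) = (\<integral>\<^sup>+\<omega>. F \<omega> \<partial>distr (seq.S \<Otimes>\<^sub>M seq.S) seq.S (\<lambda>(\<omega>, \<omega>'). comb_seq n \<omega> \<omega>'))"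
    by (simp only: seq.PiM_comb_seq) (simp add: seq_S)
  also have "\<dots> = (\<integral>\<^sup>+x. F (comb_seq n (fst x) (snd x)) \<partial>(seq.S \<Otimes>\<^sub>M seq.S))"
    using assms[folded seq_S]
    by (subst nn_integral_distr) (use m in \<open>auto simp: split_beta'\<close>)
  also have "\<dots> = (\<integral>\<^sup>+\<omega>. \<integral>\<^sup>+\<omega>'. F (comb_seq n \<omega> \<omega>') \<partial>seq.S \<partial>seq.S)"
    using measurable_compose[OF m assms[folded seq_S]]
    by (subst seq.P.nn_integral_fst[symmetric]) auto
  finally show ?thesis by (simp add: seq_S)
qed

text \<open>\<open>step\<close> grows on the left and \<open>W\<close> on the right; conditioning on
  the first increment, by \<open>W_case_nat\<close>, reconciles the two orders. Any f is measurable
  along the walk because the carrier is discrete.\<close>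

lemma nn_integral_W: "(\<integral>\<^sup>+\<omega>. f (W n \<omega>) \<partial>P) = (\<integral>\<^sup>+g. f g \<partial>step n)"
proof (induction n arbitrary: f)
  case 0
  then show ?case using P.emeasure_space_1 by simp
next
  case (Suc n)
  have "(\<integral>\<^sup>+\<omega>. f (W (Suc n) \<omega>) \<partial>P) = (\<integral>\<^sup>+g. \<integral>\<^sup>+\<omega>. f (trunc g \<otimes> W n \<omega>) \<partial>P \<partial>\<mu>)"
    by (subst nn_integral_P_iter) (auto simp: W_case_nat intro: borel_measurable_W)
  also have "\<dots> = (\<integral>\<^sup>+g. \<integral>\<^sup>+h. f (trunc g \<otimes> h) \<partial>step n \<partial>\<mu>)"
    by (intro nn_integral_cong Suc)
  also have "\<dots> = (\<integral>\<^sup>+g. \<integral>\<^sup>+h. f (g \<otimes> h) \<partial>step n \<partial>\<mu>)"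
    using set_mu by (intro nn_integral_cong_AE) (auto simp: AE_measure_pmf_iff)
  finally show ?case by (simp add: nn_integral_step_Suc)
qed

lemma nn_integral_W_Suc:
  "(\<integral>\<^sup>+\<omega>. f (W (Suc n) \<omega>) \<partial>P) = (\<integral>\<^sup>+g. \<integral>\<^sup>+\<omega>. f (g \<otimes> W n \<omega>) \<partial>P \<partial>\<mu>)"
  unfolding nn_integral_W[of f "Suc n"] nn_integral_step_Suc
  by (intro nn_integral_cong nn_integral_W[symmetric])

end

subsection \<open>Bounded harmonic functions along the walk\<close>

context walk begin

lemma integral_P_comb_seq:
  fixes F :: "(nat \<Rightarrow> 'g) \<Rightarrow> real"
  assumes "integrable P F"
  shows "(\<integral>\<omega>. F \<omega> \<partial>P) = (\<integral>\<omega>. \<integral>\<omega>'. F (comb_seq n \<omega> \<omega>') \<partial>P \<partial>P)"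
proof -
  have m: "(\<lambda>(\<omega>, \<omega>'). comb_seq n \<omega> \<omega>') \<in> seq.S \<Otimes>\<^sub>M seq.S \<rightarrow>\<^sub>M seq.S"
    by measurable
  interpret PP: pair_prob_space seq.S seq.S ..
  have int: "integrable (distr (seq.S \<Otimes>\<^sub>M seq.S) seq.S (\<lambda>(\<omega>, \<omega>'). comb_seq n \<omega> \<omega>')) F"
    by (simp only: seq.PiM_comb_seq) (use assms in \<open>simp add: seq_S\<close>)
  have "(\<integral>\<omega>. F \<omega> \<partial>P) = (\<integral>\<omega>. F \<omega> \<partial>distr (seq.S \<Otimes>\<^sub>M seq.S) seq.S (\<lambda>(\<omega>, \<omega>'). comb_seq n \<omega> \<omega>'))"
    by (simp only: seq.PiM_comb_seq) (simp add: seq_S)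
  also have "\<dots> = (\<integral>x. F (comb_seq n (fst x) (snd x)) \<partial>(seq.S \<Otimes>\<^sub>M seq.S))"
    using assms by (subst integral_distr[OF m]) (auto simp: split_beta' seq_S)
  also have "\<dots> = (\<integral>\<omega>. \<integral>\<omega>'. F (comb_seq n \<omega> \<omega>') \<partial>seq.S \<partial>seq.S)"
    using integrable_distr[OF m int]
    by (subst PP.integral_fst'[symmetric]) (auto simp: split_beta')
  finally show ?thesis by (simp add: seq_S)
qed

text \<open>The mean value property under right multiplication, the direction in which the walk
  moves, so that \<open>u (W n \<omega>)\<close> is a martingale. Stating it in
  \<open>ennreal\<close> avoids summability conditions; it is used for nonnegative u.\<close>

definition harmonic :: "('g \<Rightarrow> real) \<Rightarrow> bool" where
  "harmonic u \<longleftrightarrow> (\<forall>g\<in>carrier G. ennreal (u g) = (\<integral>\<^sup>+h. ennreal (u (g \<otimes> h)) \<partial>\<mu>))"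

lemma harmonic_step:
  assumes "harmonic u" "g \<in> carrier G"
  shows "(\<integral>\<^sup>+h. ennreal (u (g \<otimes> h)) \<partial>step n) = ennreal (u g)"
  using assms(2)
proof (induction n arbitrary: g)
  case (Suc n)
  have "(\<integral>\<^sup>+h. ennreal (u (g \<otimes> h)) \<partial>step (Suc n)) = (\<integral>\<^sup>+s. \<integral>\<^sup>+h. ennreal (u (g \<otimes> (s \<otimes> h))) \<partial>step n \<partial>\<mu>)"
    by (rule nn_integral_step_Suc)
  also have "\<dots> = (\<integral>\<^sup>+s. \<integral>\<^sup>+h. ennreal (u ((g \<otimes> s) \<otimes> h)) \<partial>step n \<partial>\<mu>)"
    using set_mu set_step Suc.prems
    by (intro nn_integral_cong_AE) (auto simp: AE_measure_pmf_iff m_assoc subset_eq intro!: nn_integral_cong_AE)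
  also have "\<dots> = (\<integral>\<^sup>+s. ennreal (u (g \<otimes> s)) \<partial>\<mu>)"
    using set_mu Suc by (intro nn_integral_cong_AE) (auto simp: AE_measure_pmf_iff)
  also have "\<dots> = ennreal (u g)"
    using assms(1) Suc.prems by (simp add: harmonic_def)
  finally show ?case .
qed (use set_mu in simp)

text \<open>The martingale property, tested against \<Phi>. That \<Phi> depends only on the first n
  increments is expressed by its invariance under replacing the rest of the path, in place of a
  filtration.\<close>

lemma harmonic_orthogonal:
  fixes \<Phi> :: "(nat \<Rightarrow> 'g) \<Rightarrow> real"
  assumes harm: "harmonic u" and u: "\<And>g. 0 \<le> u g" "\<And>g. u g \<le> K"
    and [measurable]: "\<Phi> \<in> borel_measurable P" and \<Phi>: "\<And>\<omega>. \<bar>\<Phi> \<omega>\<bar> \<le> L"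
    and adapted: "\<And>\<omega> \<omega>'. \<Phi> (comb_seq n \<omega> \<omega>') = \<Phi> \<omega>"
  shows "(\<integral>\<omega>. u (W (n + m) \<omega>) * \<Phi> \<omega> \<partial>P) = (\<integral>\<omega>. u (W n \<omega>) * \<Phi> \<omega> \<partial>P)"
proof -
  have L: "L \<ge> 0" using \<Phi>[of undefined] by simp
  have inner: "(\<integral>\<omega>'. u (g \<otimes> W m \<omega>') \<partial>P) = u g" if "g \<in> carrier G" for g
  proof -
    have "(\<integral>\<omega>'. u (g \<otimes> W m \<omega>') \<partial>P) = enn2real (\<integral>\<^sup>+\<omega>'. ennreal (u (g \<otimes> W m \<omega>')) \<partial>P)"
      using u by (intro integral_eq_nn_integral borel_measurable_W) auto
    also have "(\<integral>\<^sup>+\<omega>'. ennreal (u (g \<otimes> W m \<omega>')) \<partial>P) = ennreal (u g)"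
      by (subst nn_integral_W) (rule harmonic_step[OF harm that])
    finally show ?thesis using u by simp
  qed
  have int: "integrable P (\<lambda>\<omega>. u (W (n + m) \<omega>) * \<Phi> \<omega>)"
  proof (rule P.integrable_const_bound[where B = "K * L"])
    show "(\<lambda>\<omega>. u (W (n + m) \<omega>) * \<Phi> \<omega>) \<in> borel_measurable P"
      using borel_measurable_W[of u "n + m"] by measurable
  qed (use u \<Phi> L in \<open>auto simp: abs_mult intro!: mult_mono order_trans[OF u(1) u(2)]\<close>)
  have "(\<integral>\<omega>. u (W (n + m) \<omega>) * \<Phi> \<omega> \<partial>P) = (\<integral>\<omega>. \<integral>\<omega>'. u (W n \<omega> \<otimes> W m \<omega>') * \<Phi> \<omega> \<partial>P \<partial>P)"
    by (subst integral_P_comb_seq[OF int, of n]) (simp add: W_comb_seq adapted)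
  also have "\<dots> = (\<integral>\<omega>. u (W n \<omega>) * \<Phi> \<omega> \<partial>P)"
    by (simp add: inner)
  finally show ?thesis .
qed

text \<open>Kolmogorov's maximal inequality for the martingale restarted at time N. The event is
  split by the first time j of exceedance (the sets \<open>A j\<close>), since later increments are
  orthogonal to everything known at that time. Orthogonality also turns the second moment of the
  total increment into a difference of second moments.\<close>

lemma harmonic_maximal:
  assumes harm: "harmonic u" and u: "\<And>g. 0 \<le> u g" "\<And>g. u g \<le> K" and e: "e > 0"
  shows "e\<^sup>2 * P.prob {\<omega>. \<exists>j\<le>m. e \<le> \<bar>u (W (N + j) \<omega>) - u (W N \<omega>)\<bar>}
    \<le> (\<integral>\<omega>. (u (W (N + m) \<omega>))\<^sup>2 \<partial>P) - (\<integral>\<omega>. (u (W N \<omega>))\<^sup>2 \<partial>P)"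
proof -
  note [measurable] = borel_measurable_W[of u]
  define Z where "Z n \<omega> = u (W n \<omega>)" for n \<omega>
  have [measurable]: "Z n \<in> borel_measurable P" for n by (simp add: Z_def[abs_def])
  define Y where "Y j \<omega> = Z (N + j) \<omega> - Z N \<omega>" for j \<omega>
  have [measurable]: "Y n \<in> borel_measurable P" for n by (simp add: Y_def[abs_def])
  define A where "A j = {\<omega>. e \<le> \<bar>Y j \<omega>\<bar> \<and> (\<forall>i<j. \<not> e \<le> \<bar>Y i \<omega>\<bar>)}" for j
  have K: "K \<ge> 0" using u order_trans by blast
  have Zb: "\<bar>Z n \<omega>\<bar> \<le> K" for n \<omega> using u by (simp add: Z_def)
  have Yb: "\<bar>Y n \<omega>\<bar> \<le> 2 * K" for n \<omega>
    using Zb[of "N + n" \<omega>] Zb[of N \<omega>] by (simp add: Y_def)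
  have A[measurable]: "A j \<in> sets P" for j
  proof -
    have "{\<omega> \<in> space P. e \<le> \<bar>Y j \<omega>\<bar> \<and> (\<forall>i<j. \<not> e \<le> \<bar>Y i \<omega>\<bar>)} \<in> sets P" by measurable
    then show ?thesis by (simp add: A_def)
  qed
  have Za: "Z k (comb_seq n \<omega> \<omega>') = Z k \<omega>" if "k \<le> n" for k n \<omega> \<omega>'
    using that by (simp add: Z_def W_comb_seq_le)
  have int: "integrable P f" if "f \<in> borel_measurable P" "\<And>\<omega>. \<bar>f \<omega>\<bar> \<le> c" for f :: "_ \<Rightarrow> real" and c
    by (rule P.integrable_const_bound[where B = c]) (use that in auto)
  have YA: "(\<integral>\<omega>. (Y j \<omega>)\<^sup>2 * indicator (A j) \<omega> \<partial>P) \<le> (\<integral>\<omega>. (Y m \<omega>)\<^sup>2 * indicator (A j) \<omega> \<partial>P)"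
    if "j \<le> m" for j
  proof -
    define \<Phi> where "\<Phi> \<omega> = Y j \<omega> * indicator (A j) \<omega>" for \<omega>
    have [measurable]: "\<Phi> \<in> borel_measurable P" by (simp add: \<Phi>_def[abs_def])
    have \<Phi>b: "\<bar>\<Phi> \<omega>\<bar> \<le> 2 * K" for \<omega>
      using Yb[of j \<omega>] K by (auto simp: \<Phi>_def indicator_def)
    have ad: "\<Phi> (comb_seq (N + j) \<omega> \<omega>') = \<Phi> \<omega>" for \<omega> \<omega>'
      by (auto simp: \<Phi>_def Y_def A_def indicator_def Za)
    have "(\<integral>\<omega>. Z (N + j + (m - j)) \<omega> * \<Phi> \<omega> \<partial>P) = (\<integral>\<omega>. Z (N + j) \<omega> * \<Phi> \<omega> \<partial>P)"
      unfolding Z_def by (rule harmonic_orthogonal[OF harm u _ \<Phi>b ad]) measurable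
    then have *: "(\<integral>\<omega>. Z (N + m) \<omega> * \<Phi> \<omega> \<partial>P) = (\<integral>\<omega>. Z (N + j) \<omega> * \<Phi> \<omega> \<partial>P)"
      using that by simp
    have i1: "integrable P (\<lambda>\<omega>. Z k \<omega> * \<Phi> \<omega>)" for k
      by (rule int[of _ "K * (2 * K)"]) (use Zb \<Phi>b K in \<open>auto simp: abs_mult intro!: mult_mono\<close>)
    have i2: "integrable P (\<lambda>\<omega>. (Y k \<omega>)\<^sup>2 * indicator (A j) \<omega>)" for k
    proof (rule int[of _ "(2 * K)\<^sup>2"])
      fix \<omega> 
      have "(Y k \<omega>)\<^sup>2 \<le> (2 * K)\<^sup>2"
        using power_mono[OF Yb[of k \<omega>], of 2] by simp
      then show "\<bar>(Y k \<omega>)\<^sup>2 * indicator (A j) \<omega>\<bar> \<le> (2 * K)\<^sup>2"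
        by (auto simp: indicator_def)
    qed measurable
    \<comment> \<open>The added cross term has integral 0 by \<open>*\<close>. It completes the
      square of \<open>Y m\<close> on \<open>A j\<close>, up to the square of the increment after
      time j.\<close>
    have "(\<integral>\<omega>. (Y j \<omega>)\<^sup>2 * indicator (A j) \<omega> \<partial>P) =
        (\<integral>\<omega>. (Y j \<omega>)\<^sup>2 * indicator (A j) \<omega> + 2 * (Z (N + m) \<omega> * \<Phi> \<omega> - Z (N + j) \<omega> * \<Phi> \<omega>) \<partial>P)"
      using i1 i2 by (simp add: *)
    also have "\<dots> \<le> (\<integral>\<omega>. (Y m \<omega>)\<^sup>2 * indicator (A j) \<omega> \<partial>P)"
    proof (rule integral_mono)
      fix \<omega>
      have "(Y j \<omega>)\<^sup>2 + 2 * (Z (N + m) \<omega> * Y j \<omega> - Z (N + j) \<omega> * Y j \<omega>) + (Z (N + m) \<omega> - Z (N + j) \<omega>)\<^sup>2 = (Y m \<omega>)\<^sup>2"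
        by (simp add: Y_def power2_eq_square algebra_simps)
      then have "(Y j \<omega>)\<^sup>2 + 2 * (Z (N + m) \<omega> * Y j \<omega> - Z (N + j) \<omega> * Y j \<omega>) \<le> (Y m \<omega>)\<^sup>2"
        using zero_le_power2[of "Z (N + m) \<omega> - Z (N + j) \<omega>"] by linarith
      then show "(Y j \<omega>)\<^sup>2 * indicator (A j) \<omega> + 2 * (Z (N + m) \<omega> * \<Phi> \<omega> - Z (N + j) \<omega> * \<Phi> \<omega>)
          \<le> (Y m \<omega>)\<^sup>2 * indicator (A j) \<omega>"
        by (auto simp: \<Phi>_def indicator_def)
    qed (use i1 i2 in auto)
    finally show ?thesis .
  qed
  have disj: "disjoint_family_on A {..m}"
    unfolding disjoint_family_on_def A_def by (auto, metis linorder_neqE_nat)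
  have un: "{\<omega>. \<exists>j\<le>m. e \<le> \<bar>Y j \<omega>\<bar>} = (\<Union>j\<in>{..m}. A j)"
  proof (intro Set.set_eqI iffI)
    fix \<omega> assume "\<omega> \<in> {\<omega>. \<exists>j\<le>m. e \<le> \<bar>Y j \<omega>\<bar>}"
    then obtain j where j: "j \<le> m" "e \<le> \<bar>Y j \<omega>\<bar>" by auto
    define i where "i = (LEAST i. e \<le> \<bar>Y i \<omega>\<bar>)"
    have "e \<le> \<bar>Y i \<omega>\<bar>" "i \<le> j" "\<forall>l<i. \<not> e \<le> \<bar>Y l \<omega>\<bar>"
      unfolding i_def using j not_less_Least by (auto intro: LeastI Least_le)
    then show "\<omega> \<in> (\<Union>j\<in>{..m}. A j)" using j by (auto simp: A_def)
  qed (auto simp: A_def)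
  have iY: "integrable P (\<lambda>\<omega>. (Y k \<omega>)\<^sup>2)" for k
  proof (rule int[of _ "(2 * K)\<^sup>2"])
    show "\<bar>(Y k \<omega>)\<^sup>2\<bar> \<le> (2 * K)\<^sup>2" for \<omega>
      using power_mono[OF Yb[of k \<omega>], of 2] by simp
  qed measurable
  have iYA: "integrable P (\<lambda>\<omega>. (Y k \<omega>)\<^sup>2 * indicator (A j) \<omega>)" for k j
    using integrable_mult_indicator[OF A iY] by (simp add: mult.commute)
  have "e\<^sup>2 * P.prob {\<omega>. \<exists>j\<le>m. e \<le> \<bar>Y j \<omega>\<bar>} = (\<Sum>j\<le>m. e\<^sup>2 * P.prob (A j))"
    unfolding un using disj
    by (subst P.finite_measure_finite_Union) (auto simp: sum_distrib_left)
  also have "\<dots> \<le> (\<Sum>j\<le>m. (\<integral>\<omega>. (Y m \<omega>)\<^sup>2 * indicator (A j) \<omega> \<partial>P))"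
  proof (rule sum_mono)
    fix j assume "j \<in> {..m}"
    have "e\<^sup>2 * P.prob (A j) = (\<integral>\<omega>. e\<^sup>2 * indicator (A j) \<omega> \<partial>P)"
      by simp
    also have "\<dots> \<le> (\<integral>\<omega>. (Y j \<omega>)\<^sup>2 * indicator (A j) \<omega> \<partial>P)"
    proof (rule integral_mono[OF _ iYA])
      fix \<omega> show "e\<^sup>2 * indicator (A j) \<omega> \<le> (Y j \<omega>)\<^sup>2 * indicator (A j) \<omega>"
        using e by (auto simp: indicator_def A_def abs_le_square_iff[symmetric])
    qed (rule int[of _ "e\<^sup>2"], auto simp: indicator_def)
    also have "\<dots> \<le> (\<integral>\<omega>. (Y m \<omega>)\<^sup>2 * indicator (A j) \<omega> \<partial>P)"
      using \<open>j \<in> {..m}\<close> by (intro YA) auto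
    finally show "e\<^sup>2 * P.prob (A j) \<le> (\<integral>\<omega>. (Y m \<omega>)\<^sup>2 * indicator (A j) \<omega> \<partial>P)" .
  qed
  also have "\<dots> = (\<integral>\<omega>. (\<Sum>j\<le>m. (Y m \<omega>)\<^sup>2 * indicator (A j) \<omega>) \<partial>P)"
    by (rule Bochner_Integration.integral_sum[symmetric]) (rule iYA)
  also have "\<dots> \<le> (\<integral>\<omega>. (Y m \<omega>)\<^sup>2 \<partial>P)"
  proof (rule integral_mono)
    fix \<omega>
    have "(\<Sum>j\<le>m. (indicator (A j) \<omega> :: real)) = indicator (\<Union>j\<le>m. A j) \<omega>"
      by (rule indicator_UN_disjoint[OF _ disj, symmetric]) simp
    then show "(\<Sum>j\<le>m. (Y m \<omega>)\<^sup>2 * indicator (A j) \<omega>) \<le> (Y m \<omega>)\<^sup>2"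
      by (simp add: sum_distrib_left[symmetric] indicator_def)
  qed (rule Bochner_Integration.integrable_sum iY iYA)+
  also have "\<dots> = (\<integral>\<omega>. (Z (N + m) \<omega>)\<^sup>2 \<partial>P) - (\<integral>\<omega>. (Z N \<omega>)\<^sup>2 \<partial>P)"
  proof -
    have *: "(\<integral>\<omega>. Z (N + m) \<omega> * Z N \<omega> \<partial>P) = (\<integral>\<omega>. Z N \<omega> * Z N \<omega> \<partial>P)"
      unfolding Z_def
      by (rule harmonic_orthogonal[OF harm u, where L = K]) (use u in \<open>auto simp: W_comb_seq_le\<close>)
    have i: "integrable P (\<lambda>\<omega>. Z k \<omega> * Z l \<omega>)" for k l
      by (rule int[of _ "K * K"]) (use Zb K in \<open>auto simp: abs_mult intro!: mult_mono\<close>)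
    have "(\<integral>\<omega>. (Y m \<omega>)\<^sup>2 \<partial>P) = (\<integral>\<omega>. Z (N + m) \<omega> * Z (N + m) \<omega> - 2 * (Z (N + m) \<omega> * Z N \<omega>) + Z N \<omega> * Z N \<omega> \<partial>P)"
      by (intro Bochner_Integration.integral_cong) (auto simp: Y_def power2_eq_square algebra_simps)
    also have "\<dots> = (\<integral>\<omega>. Z (N + m) \<omega> * Z (N + m) \<omega> \<partial>P) - (\<integral>\<omega>. Z N \<omega> * Z N \<omega> \<partial>P)"
      using i by (simp add: *)
    finally show ?thesis by (simp add: power2_eq_square)
  qed
  finally show ?thesis by (simp add: Z_def Y_def)
qed

text \<open>Convergence of a martingale bounded in L2. Its second moments \<open>s\<close> increase
  to a limit \<open>l\<close>, so the maximal inequality bounds the probability \<open>E e N\<close>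
  of an oscillation of size e after time N by \<open>l - s N\<close> divided by the square of e,
  which tends to 0. Paths outside some \<open>E e N\<close> for every rational-like e = 1/(k+1) are
  Cauchy.\<close>

lemma harmonic_convergent:
  assumes harm: "harmonic u" and u: "\<And>g. 0 \<le> u g" "\<And>g. u g \<le> K"
  shows "AE \<omega> in P. convergent (\<lambda>n. u (W n \<omega>))"
proof -
  note [measurable] = borel_measurable_W[of u]
  define s where "s n = (\<integral>\<omega>. (u (W n \<omega>))\<^sup>2 \<partial>P)" for n
  have K: "K \<ge> 0" using u order_trans by blast
  have s_mono: "s N \<le> s (N + m)" for N m
  proof -
    have "0 \<le> 1\<^sup>2 * P.prob {\<omega>. \<exists>j\<le>m. 1 \<le> \<bar>u (W (N + j) \<omega>) - u (W N \<omega>)\<bar>}" by simp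
    also have "\<dots> \<le> s (N + m) - s N"
      unfolding s_def by (rule harmonic_maximal[OF harm u]) simp
    finally show ?thesis by simp
  qed
  have s_le: "s n \<le> K\<^sup>2" for n
  proof -
    have "s n \<le> (\<integral>\<omega>. K\<^sup>2 \<partial>P)"
      unfolding s_def using u
      by (intro integral_mono P.integrable_const_bound[where B = "K\<^sup>2"]) (auto intro: power_mono)
    then show ?thesis using P.prob_space by simp
  qed
  have "convergent s"
    using s_le by (intro Bseq_mono_convergent BseqI'[where K = "K\<^sup>2"])
      (auto simp: s_def le_iff_add intro!: s_mono[unfolded s_def])
  then obtain l where l: "s \<longlonglongrightarrow> l" by (auto simp: convergent_def)
  have s_l: "s n \<le> l" for n
    by (rule incseq_le[OF _ l]) (auto simp: incseq_def le_iff_add intro!: s_mono)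
  define E where "E e N = {\<omega>. \<exists>j. e \<le> \<bar>u (W (N + j) \<omega>) - u (W N \<omega>)\<bar>}" for e N
  have E[measurable]: "E e N \<in> sets P" for e N
  proof -
    have "{\<omega> \<in> space P. \<exists>j. e \<le> \<bar>u (W (N + j) \<omega>) - u (W N \<omega>)\<bar>} \<in> sets P" by measurable
    then show ?thesis by (simp add: E_def)
  qed
  have bd: "e\<^sup>2 * P.prob (E e N) \<le> l - s N" if e: "e > 0" for e N
  proof -
    define D where "D m = {\<omega>. \<exists>j\<le>m. e \<le> \<bar>u (W (N + j) \<omega>) - u (W N \<omega>)\<bar>}" for m
    have D: "D m \<in> sets P" for m
    proof -
      have "{\<omega> \<in> space P. \<exists>j\<le>m. e \<le> \<bar>u (W (N + j) \<omega>) - u (W N \<omega>)\<bar>} \<in> sets P" by measurable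
      then show ?thesis by (simp add: D_def)
    qed
    have "(\<lambda>m. P.prob (D m)) \<longlonglongrightarrow> P.prob (\<Union>m. D m)"
      using D by (intro P.finite_Lim_measure_incseq) (auto simp: incseq_def D_def intro: order_trans)
    also have "(\<Union>m. D m) = E e N" by (auto simp: D_def E_def)
    finally have "(\<lambda>m. e\<^sup>2 * P.prob (D m)) \<longlonglongrightarrow> e\<^sup>2 * P.prob (E e N)"
      by (intro tendsto_intros)
    then show ?thesis
    proof (rule LIMSEQ_le_const2, intro exI allI impI)
      fix m
      have "e\<^sup>2 * P.prob (D m) \<le> s (N + m) - s N"
        unfolding D_def s_def by (rule harmonic_maximal[OF harm u e])
      with s_l[of "N + m"] show "e\<^sup>2 * P.prob (D m) \<le> l - s N" by simp
    qed
  qed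
  have null: "AE \<omega> in P. \<exists>N. \<omega> \<notin> E e N" if e: "e > 0" for e
  proof -
    have "P.prob (\<Inter>N. E e N) = 0"
    proof (rule ccontr)
      assume "P.prob (\<Inter>N. E e N) \<noteq> 0"
      then have pos: "e\<^sup>2 * P.prob (\<Inter>N. E e N) > 0" using e by (simp add: zero_less_measure_iff)
      have "(\<lambda>N. l - s N) \<longlonglongrightarrow> l - l" by (intro tendsto_intros l)
      then have "\<forall>\<^sub>F N in sequentially. l - s N < e\<^sup>2 * P.prob (\<Inter>N. E e N)"
        using pos order_tendstoD(2) by fastforce
      then obtain N where N: "l - s N < e\<^sup>2 * P.prob (\<Inter>N. E e N)"
        by (auto simp: eventually_sequentially)
      have "P.prob (\<Inter>N. E e N) \<le> P.prob (E e N)"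
        by (rule P.finite_measure_mono) auto
      then have "e\<^sup>2 * P.prob (\<Inter>N. E e N) \<le> e\<^sup>2 * P.prob (E e N)"
        by (rule mult_left_mono) simp
      with bd[OF e, of N] N show False by simp
    qed
    then have "AE \<omega> in P. \<omega> \<notin> (\<Inter>N. E e N)"
      by (subst (asm) P.prob_eq_0) auto
    then show ?thesis by simp
  qed
  have "AE \<omega> in P. \<forall>k. \<exists>N. \<omega> \<notin> E (inverse (real (Suc k))) N"
    by (subst AE_all_countable) (auto intro!: null)
  then show ?thesis
  proof eventually_elim
    case (elim \<omega>)
    have "Cauchy (\<lambda>n. u (W n \<omega>))"
    proof (rule metric_CauchyI)
      fix e :: real assume "e > 0"
      then obtain k where k: "inverse (real (Suc k)) < e / 2"
        using reals_Archimedean[of "e / 2"] by auto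
      obtain N where N: "\<omega> \<notin> E (inverse (real (Suc k))) N" using elim by blast
      have *: "\<bar>u (W n \<omega>) - u (W N \<omega>)\<bar> < e / 2" if "n \<ge> N" for n
      proof -
        from le_Suc_ex[OF that] obtain j where "n = N + j" ..
        then have "\<bar>u (W n \<omega>) - u (W N \<omega>)\<bar> < inverse (real (Suc k))"
          using N by (simp add: E_def not_le)
        with k show ?thesis by linarith
      qed
      show "\<exists>M. \<forall>m\<ge>M. \<forall>n\<ge>M. dist (u (W m \<omega>)) (u (W n \<omega>)) < e"
      proof (intro exI[of _ N] allI impI)
        fix m n assume "N \<le> m" "N \<le> n"
        then show "dist (u (W m \<omega>)) (u (W n \<omega>)) < e"
          using *[of m] *[of n] unfolding dist_real_def by linarith
      qed
    qed
    then show ?case by (simp add: Cauchy_convergent_iff)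
  qed
qed


section \<open>The walk visits infinitely many group elements\<close>

lemma sets_W: "{\<omega>. R (W n \<omega>)} \<in> sets P"
  using measurable_sets[OF measurable_W, of "{g\<in>carrier G. R g}" n] by (simp add: vimage_def)

lemma W_hits: "h \<in> set_pmf (step n) \<Longrightarrow> P.prob {\<omega>. W n \<omega> = h} > 0"
proof -
  assume h: "h \<in> set_pmf (step n)"
  have *: "{\<omega>. W n \<omega> = h} \<in> sets P" by (rule sets_W)
  have "emeasure P {\<omega>. W n \<omega> = h} = (\<integral>\<^sup>+\<omega>. indicator {h} (W n \<omega>) \<partial>P)"
    using nn_integral_indicator[OF *] by (simp add: indicator_def)
  also have "\<dots> = emeasure (step n) {h}"
    by (subst nn_integral_W) simp
  also have "\<dots> = ennreal (pmf (step n) h)"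
    by (rule emeasure_pmf_single)
  finally show ?thesis
    using h by (simp add: P.emeasure_eq_measure set_pmf_iff pmf_nonneg less_le)
qed

text \<open>A finite set F is almost surely left: some h moves every element of F out of F, and
  infinitely many independent blocks of increments get a chance to multiply to h. There are
  countably many finite sets F. The result is what makes the convergence property, which speaks of
  distinct elements, applicable along the walk.\<close>

lemma AE_infinite_range:
  assumes inf: "infinite (carrier G)"
  shows "AE \<omega> in P. infinite (range (\<lambda>n. W n \<omega>))"
proof -
  have null: "AE \<omega> in P. \<not> (\<forall>n. W n \<omega> \<in> F)" if F: "finite F" "F \<subseteq> carrier G" for F
  proof -
    \<comment> \<open>An h that is not a quotient of two elements of F carries F off itself by right
      multiplication.\<close>
    have "finite ((\<lambda>(g, f). inv g \<otimes> f) ` (F \<times> F))" using F by simp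
    then obtain h where h: "h \<in> carrier G" "h \<notin> (\<lambda>(g, f). inv g \<otimes> f) ` (F \<times> F)"
      using inf by (meson finite_subset subsetI)
    have hF: "g \<otimes> h \<notin> F" if "g \<in> F" for g
    proof
      assume "g \<otimes> h \<in> F"
      moreover have "h = inv g \<otimes> (g \<otimes> h)" using that F h by (auto simp: inv_solve_left subset_eq)
      ultimately show False using h(2) that by force
    qed
    obtain L where L: "L > 0" "h \<in> set_pmf (step L)" using carrier_step[OF h(1)] .
    define p where "p = P.prob {\<omega>. W L \<omega> = h}"
    have p: "0 < p" "p \<le> 1" using W_hits[OF L(2)] by (auto simp: p_def)
    define Q where "Q g = {\<omega>. \<forall>n. g \<otimes> W n \<omega> \<in> F}" for g
    have Qm: "Q g \<in> sets P" for g
    proof -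
      have "(\<Inter>n. {\<omega>. g \<otimes> W n \<omega> \<in> F}) \<in> sets P"
        by (intro sets.countable_INT) (auto intro: sets_W)
      also have "(\<Inter>n. {\<omega>. g \<otimes> W n \<omega> \<in> F}) = Q g" by (auto simp: Q_def)
      finally show ?thesis .
    qed
    \<comment> \<open>Each block of L increments has product h with probability p, independently of
      the earlier blocks, and a path that stays in F survives no such block.\<close>
    have Q: "emeasure P (Q g) \<le> ennreal ((1 - p) ^ k)" if "g \<in> carrier G" for g k
      using that
    proof (induction k arbitrary: g)
      case 0 then show ?case using P.emeasure_le_1 by simp
    next
      case (Suc k)
      have "emeasure P (Q g) = (\<integral>\<^sup>+\<omega>. indicator (Q g) \<omega> \<partial>P)" using Qm by simp
      also have "\<dots> = (\<integral>\<^sup>+\<omega>. \<integral>\<^sup>+\<omega>'. indicator (Q g) (comb_seq L \<omega> \<omega>') \<partial>P \<partial>P)"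
        using Qm by (intro nn_integral_P_comb_seq) simp
      also have "\<dots> \<le> (\<integral>\<^sup>+\<omega>. ennreal ((1 - p) ^ k) * indicator {\<omega>. W L \<omega> \<noteq> h} \<omega> \<partial>P)"
      proof (rule nn_integral_mono)
        fix \<omega>
        have "(indicator (Q g) (comb_seq L \<omega> \<omega>') :: ennreal) \<le>
            indicator (Q (g \<otimes> W L \<omega>)) \<omega>' * indicator {\<omega>. W L \<omega> \<noteq> h} \<omega>" for \<omega>'
        proof (cases "comb_seq L \<omega> \<omega>' \<in> Q g")
          case True
          then have *: "g \<otimes> W n (comb_seq L \<omega> \<omega>') \<in> F" for n by (simp add: Q_def)
          have "g \<otimes> (W L \<omega> \<otimes> W n \<omega>') \<in> F" for n
            using *[of "L + n"] by (simp add: W_comb_seq)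
          then have 1: "\<omega>' \<in> Q (g \<otimes> W L \<omega>)" using Suc.prems by (simp add: Q_def m_assoc)
          have "g \<in> F" using *[of 0] Suc.prems by simp
          moreover have "g \<otimes> W L \<omega> \<in> F" using *[of L] by (simp add: W_comb_seq_le)
          ultimately have "W L \<omega> \<noteq> h" using hF by auto
          with 1 show ?thesis by (simp add: indicator_def)
        qed simp
        then have "(\<integral>\<^sup>+\<omega>'. indicator (Q g) (comb_seq L \<omega> \<omega>') \<partial>P) \<le>
            (\<integral>\<^sup>+\<omega>'. indicator (Q (g \<otimes> W L \<omega>)) \<omega>' * indicator {\<omega>. W L \<omega> \<noteq> h} \<omega> \<partial>P)"
          by (intro nn_integral_mono)
        also have "\<dots> = emeasure P (Q (g \<otimes> W L \<omega>)) * indicator {\<omega>. W L \<omega> \<noteq> h} \<omega>"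
          using Qm by (subst nn_integral_multc) auto
        also have "\<dots> \<le> ennreal ((1 - p) ^ k) * indicator {\<omega>. W L \<omega> \<noteq> h} \<omega>"
          using Suc by (intro mult_right_mono) auto
        finally show "(\<integral>\<^sup>+\<omega>'. indicator (Q g) (comb_seq L \<omega> \<omega>') \<partial>P) \<le>
          ennreal ((1 - p) ^ k) * indicator {\<omega>. W L \<omega> \<noteq> h} \<omega>" .
      qed
      also have "\<dots> = ennreal ((1 - p) ^ k) * emeasure P {\<omega>. W L \<omega> \<noteq> h}"
        by (rule nn_integral_cmult_indicator) (rule sets_W)
      also have "emeasure P {\<omega>. W L \<omega> \<noteq> h} = ennreal (1 - p)"
        using P.prob_compl[OF sets_W[where n = L and R = "\<lambda>g. g = h"]]
        by (simp add: P.emeasure_eq_measure p_def Collect_neg_eq Compl_eq_Diff_UNIV)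
      also have "ennreal ((1 - p) ^ k) * ennreal (1 - p) = ennreal ((1 - p) ^ Suc k)"
        using p by (simp add: ennreal_mult[symmetric] mult.commute)
      finally show ?case .
    qed
    have "P.prob (Q \<one>) \<le> 0"
    proof (rule LIMSEQ_le_const)
      show "(\<lambda>k. (1 - p) ^ k) \<longlonglongrightarrow> 0" using p by (intro LIMSEQ_realpow_zero) auto
      show "\<exists>N. \<forall>n\<ge>N. P.prob (Q \<one>) \<le> (1 - p) ^ n"
        using Q[OF one_closed] p by (simp add: P.emeasure_eq_measure)
    qed
    then have "AE \<omega> in P. \<omega> \<notin> Q \<one>"
      using Qm by (subst P.prob_eq_0[symmetric]) (auto simp: measure_le_0_iff)
    then show ?thesis by (simp add: Q_def)
  qed
  have "AE \<omega> in P. \<forall>F\<in>{F. finite F \<and> F \<subseteq> carrier G}. \<not> (\<forall>n. W n \<omega> \<in> F)"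
    using null by (subst AE_ball_countable[OF countable_Collect_finite_subset[OF countable_carrier]]) simp
  then show ?thesis
    by eventually_elim (metis (no_types, lifting) W_closed image_subset_iff mem_Collect_eq rangeI)
qed

end

subsection \<open>Stationary actions and Furstenberg entropy\<close>

text \<open>Domination of c N by M gives absolute continuity at once. On the set A where the density
  exceeds 1/c, the integral of its excess is nonpositive, hence 0.\<close>

lemma AE_RN_deriv_bound:
  fixes c :: real
  assumes "finite_measure M" and N: "sets N = sets M" and c: "c > 0"
    and le: "\<And>A. A \<in> sets M \<Longrightarrow> ennreal c * emeasure N A \<le> emeasure M A"
  shows "density M (RN_deriv M N) = N" and "AE x in M. ennreal c * RN_deriv M N x \<le> 1"
proof -
  interpret finite_measure M by fact
  show dens: "density M (RN_deriv M N) = N"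
  proof (rule density_RN_deriv)
    show "absolutely_continuous M N"
      unfolding absolutely_continuous_def
    proof
      fix A assume A: "A \<in> null_sets M"
      then have "ennreal c * emeasure N A \<le> 0" using le[of A] null_setsD1[OF A] null_setsD2[OF A] by simp
      then have "emeasure N A = 0" using c by (simp add: ennreal_eq_0_iff)
      then show "A \<in> null_sets N" using A N by (auto simp: null_sets_def)
    qed
  qed (simp add: N)
  define A where "A = {x\<in>space M. ennreal c * RN_deriv M N x > 1}"
  have A[measurable]: "A \<in> sets M" unfolding A_def by measurable
  have "(\<integral>\<^sup>+x. (ennreal c * RN_deriv M N x - 1) * indicator A x \<partial>M) + emeasure M A =
      (\<integral>\<^sup>+x. (ennreal c * RN_deriv M N x - 1) * indicator A x + indicator A x \<partial>M)"
    by (subst nn_integral_add) auto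
  also have "\<dots> = (\<integral>\<^sup>+x. ennreal c * (RN_deriv M N x * indicator A x) \<partial>M)"
    by (intro nn_integral_cong) (auto simp: A_def indicator_def diff_add_cancel_ennreal)
  also have "\<dots> = ennreal c * emeasure N A"
    by (subst nn_integral_cmult) (auto simp: emeasure_density[symmetric] dens)
  also have "\<dots> \<le> 0 + emeasure M A" using le A by simp
  finally have "(\<integral>\<^sup>+x. (ennreal c * RN_deriv M N x - 1) * indicator A x \<partial>M) = 0"
    by (simp add: ennreal_add_left_cancel_le add.commute)
  then have "AE x in M. (ennreal c * RN_deriv M N x - 1) * indicator A x = 0"
    by (subst (asm) nn_integral_0_iff_AE) auto
  then show "AE x in M. ennreal c * RN_deriv M N x \<le> 1"
  proof (rule AE_mp, intro AE_I2 impI)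
    fix x assume "x \<in> space M" "(ennreal c * RN_deriv M N x - 1) * indicator A x = 0"
    then show "ennreal c * RN_deriv M N x \<le> 1"
      by (cases "x \<in> A") (auto simp: A_def diff_eq_0_iff_ennreal not_less)
  qed
qed

text \<open>No topology is involved, so that the joint law on a product \<sigma>-algebra is an
  instance alongside the two boundaries.\<close>

locale stationary_action = walk G \<mu> for G :: "('g, 'x) monoid_scheme" (structure) and \<mu> +
  fixes \<alpha> :: "'g \<Rightarrow> 'y \<Rightarrow> 'y" and \<eta> :: "'y measure"
  assumes prob_\<eta>: "prob_space \<eta>" and space_\<eta> [simp]: "space \<eta> = UNIV"
    and act_mult: "g \<in> carrier G \<Longrightarrow> h \<in> carrier G \<Longrightarrow> \<alpha> (g \<otimes> h) y = \<alpha> g (\<alpha> h y)"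
    and act_one [simp]: "\<alpha> \<one> y = y"
    and meas [measurable]: "g \<in> carrier G \<Longrightarrow> \<alpha> g \<in> \<eta> \<rightarrow>\<^sub>M \<eta>"
    and stat: "A \<in> sets \<eta> \<Longrightarrow> emeasure \<eta> A = (\<integral>\<^sup>+g. emeasure \<eta> (\<alpha> g -` A) \<partial>\<mu>)"
begin

sublocale \<eta>: prob_space \<eta> by (rule prob_\<eta>)

lemma act_inv: "g \<in> carrier G \<Longrightarrow> \<alpha> (inv g) (\<alpha> g y) = y" "g \<in> carrier G \<Longrightarrow> \<alpha> g (\<alpha> (inv g) y) = y"
  by (simp_all add: act_mult[symmetric])

abbreviation tr :: "'g \<Rightarrow> 'y measure" where "tr g \<equiv> distr \<eta> \<eta> (\<alpha> g)"

lemma vimage_act: "g \<in> carrier G \<Longrightarrow> A \<in> sets \<eta> \<Longrightarrow> \<alpha> g -` A \<in> sets \<eta>"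
  using measurable_sets[OF meas, of g A] by simp

lemma emeasure_tr: "g \<in> carrier G \<Longrightarrow> A \<in> sets \<eta> \<Longrightarrow> emeasure (tr g) A = emeasure \<eta> (\<alpha> g -` A)"
  by (simp add: emeasure_distr meas)

text \<open>Stationarity of sets says that \<eta> is the mixture
  \<open>measure_pmf \<mu> \<bind> K\<close> of its translates; integration against a mixture then
  covers all nonnegative functions. \<open>trunc\<close> makes K a kernel on the whole type.\<close>

lemma stat_nn_integral_\<mu>:
  assumes f: "f \<in> borel_measurable \<eta>"
  shows "(\<integral>\<^sup>+y. f y \<partial>\<eta>) = (\<integral>\<^sup>+g. \<integral>\<^sup>+y. f (\<alpha> g y) \<partial>\<eta> \<partial>\<mu>)"
proof -
  define K where "K g = tr (trunc g)" for g
  have K: "K \<in> measure_pmf \<mu> \<rightarrow>\<^sub>M subprob_algebra \<eta>"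
  proof -
    have "subprob_space (K g)" for g
      unfolding K_def by (intro prob_space_imp_subprob_space \<eta>.prob_space_distr meas) simp
    then show ?thesis by (auto simp: space_subprob_algebra K_def)
  qed
  have "\<eta> = measure_pmf \<mu> \<bind> K"
  proof (rule measure_eqI)
    fix A assume A: "A \<in> sets \<eta>"
    have "emeasure (measure_pmf \<mu> \<bind> K) A = (\<integral>\<^sup>+g. emeasure (K g) A \<partial>\<mu>)"
      using K A by (intro emeasure_bind) auto
    also have "\<dots> = (\<integral>\<^sup>+g. emeasure \<eta> (\<alpha> g -` A) \<partial>\<mu>)"
      using set_mu A by (intro nn_integral_cong_AE) (auto simp: AE_measure_pmf_iff K_def emeasure_tr subset_eq)
    finally show "emeasure \<eta> A = emeasure (measure_pmf \<mu> \<bind> K) A"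
      using stat[OF A] by simp
  qed (use K in \<open>auto simp: sets_bind[OF sets_kernel[OF K]]\<close>)
  then have "(\<integral>\<^sup>+y. f y \<partial>\<eta>) = (\<integral>\<^sup>+y. f y \<partial>(measure_pmf \<mu> \<bind> K))" by simp
  also have "\<dots> = (\<integral>\<^sup>+g. \<integral>\<^sup>+y. f y \<partial>K g \<partial>\<mu>)"
    by (rule nn_integral_bind[OF f K])
  also have "\<dots> = (\<integral>\<^sup>+g. \<integral>\<^sup>+y. f (\<alpha> g y) \<partial>\<eta> \<partial>\<mu>)"
    using set_mu f
    by (intro nn_integral_cong_AE) (auto simp: AE_measure_pmf_iff K_def nn_integral_distr meas subset_eq)
  finally show ?thesis .
qed

lemma stat_nn_integral:
  assumes "f \<in> borel_measurable \<eta>"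
  shows "(\<integral>\<^sup>+g. \<integral>\<^sup>+y. f (\<alpha> g y) \<partial>\<eta> \<partial>step n) = (\<integral>\<^sup>+y. f y \<partial>\<eta>)"
  using assms
proof (induction n arbitrary: f)
  case (Suc n)
  have "(\<integral>\<^sup>+g. \<integral>\<^sup>+y. f (\<alpha> g y) \<partial>\<eta> \<partial>step (Suc n)) =
      (\<integral>\<^sup>+g. \<integral>\<^sup>+h. \<integral>\<^sup>+y. f (\<alpha> (g \<otimes> h) y) \<partial>\<eta> \<partial>step n \<partial>\<mu>)"
    by (rule nn_integral_step_Suc)
  also have "\<dots> = (\<integral>\<^sup>+g. \<integral>\<^sup>+h. \<integral>\<^sup>+y. f (\<alpha> g (\<alpha> h y)) \<partial>\<eta> \<partial>step n \<partial>\<mu>)"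
    using set_mu set_step
    by (intro nn_integral_cong_AE AE_pmfI) (auto simp: act_mult subset_eq intro!: nn_integral_cong_AE AE_pmfI)
  also have "\<dots> = (\<integral>\<^sup>+g. \<integral>\<^sup>+y. f (\<alpha> g y) \<partial>\<eta> \<partial>\<mu>)"
  proof (intro nn_integral_cong_AE AE_pmfI)
    fix g assume "g \<in> set_pmf \<mu>"
    then have [measurable]: "\<alpha> g \<in> \<eta> \<rightarrow>\<^sub>M \<eta>" using set_mu by auto
    have "(\<lambda>y. f (\<alpha> g y)) \<in> borel_measurable \<eta>" using Suc.prems by measurable
    then show "(\<integral>\<^sup>+h. \<integral>\<^sup>+y. f (\<alpha> g (\<alpha> h y)) \<partial>\<eta> \<partial>step n) = (\<integral>\<^sup>+y. f (\<alpha> g y) \<partial>\<eta>)"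
      by (rule Suc.IH)
  qed
  also have "\<dots> = (\<integral>\<^sup>+y. f y \<partial>\<eta>)"
    by (rule stat_nn_integral_\<mu>[symmetric]) fact
  finally show ?case .
qed simp

lemma emeasure_stat_step:
  assumes A: "A \<in> sets \<eta>"
  shows "(\<integral>\<^sup>+g. emeasure \<eta> (\<alpha> g -` A) \<partial>step n) = emeasure \<eta> A"
proof -
  have "(\<integral>\<^sup>+g. emeasure \<eta> (\<alpha> g -` A) \<partial>step n) = (\<integral>\<^sup>+g. \<integral>\<^sup>+y. indicator A (\<alpha> g y) \<partial>\<eta> \<partial>step n)"
  proof (intro nn_integral_cong_AE AE_pmfI)
    fix g assume "g \<in> set_pmf (step n)"
    then have "\<alpha> g -` A \<in> sets \<eta>" using set_step A by (auto intro: vimage_act)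
    then show "emeasure \<eta> (\<alpha> g -` A) = (\<integral>\<^sup>+y. indicator A (\<alpha> g y) \<partial>\<eta>)"
      by (simp add: nn_integral_indicator[symmetric] indicator_vimage del: nn_integral_indicator)
  qed
  also have "\<dots> = emeasure \<eta> A" using A by (subst stat_nn_integral) auto
  finally show ?thesis .
qed

text \<open>The translate by g, weighted with its mass, is one of the summands in the stationarity
  identity at time n. So translates have bounded densities, with a bound that is the reciprocal of a
  transition probability.\<close>

lemma quasi_invariant:
  assumes g: "g \<in> carrier G" and A: "A \<in> sets \<eta>"
  shows "ennreal (pmf (step n) g) * emeasure \<eta> (\<alpha> g -` A) \<le> emeasure \<eta> A"
proof -
  have "ennreal (pmf (step n) g) * emeasure \<eta> (\<alpha> g -` A) =
      (\<integral>\<^sup>+h. emeasure \<eta> (\<alpha> g -` A) * indicator {g} h \<partial>step n)"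
    by (subst nn_integral_cmult_indicator) (auto simp: emeasure_pmf_single mult.commute)
  also have "\<dots> \<le> (\<integral>\<^sup>+h. emeasure \<eta> (\<alpha> h -` A) \<partial>step n)"
    by (intro nn_integral_mono) (auto simp: indicator_def)
  also have "\<dots> = emeasure \<eta> A" by (rule emeasure_stat_step[OF A])
  finally show ?thesis .
qed

section \<open>Densities of translates and Furstenberg entropy\<close>

definition \<rho> :: "'g \<Rightarrow> 'y \<Rightarrow> real" where
  "\<rho> g y = enn2real (RN_deriv \<eta> (tr g) y)"

lemma \<rho>_measurable [measurable]: "\<rho> g \<in> borel_measurable \<eta>"
  unfolding \<rho>_def[abs_def] by measurable

lemma \<rho>_nonneg [simp]: "0 \<le> \<rho> g y" by (simp add: \<rho>_def)

lemma RN_deriv_translate: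
  assumes "g \<in> set_pmf (step n)"
  shows "density \<eta> (RN_deriv \<eta> (tr g)) = tr g"
    and "AE y in \<eta>. ennreal (pmf (step n) g) * RN_deriv \<eta> (tr g) y \<le> 1"
proof -
  have p: "pmf (step n) g > 0" and g: "g \<in> carrier G"
    using assms set_step by (auto simp: pmf_positive_iff)
  have le: "A \<in> sets \<eta> \<Longrightarrow> ennreal (pmf (step n) g) * emeasure (tr g) A \<le> emeasure \<eta> A" for A
    using quasi_invariant[OF g] g by (simp add: emeasure_tr)
  show "density \<eta> (RN_deriv \<eta> (tr g)) = tr g"
    and "AE y in \<eta>. ennreal (pmf (step n) g) * RN_deriv \<eta> (tr g) y \<le> 1"
    using AE_RN_deriv_bound[OF \<eta>.finite_measure_axioms _ p le] by auto
qed

lemma ennreal_\<rho>: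
  assumes "g \<in> carrier G"
  shows "AE y in \<eta>. ennreal (\<rho> g y) = RN_deriv \<eta> (tr g) y"
proof -
  obtain n where n: "g \<in> set_pmf (step n)" using carrier_step assms by blast
  then have p: "pmf (step n) g > 0" by (simp add: pmf_positive_iff)
  show ?thesis
    using RN_deriv_translate(2)[OF n]
  proof eventually_elim
    case (elim y)
    then have "RN_deriv \<eta> (tr g) y \<noteq> \<top>"
      using p by (auto simp: ennreal_mult_top top_unique)
    then show ?case by (simp add: \<rho>_def less_top)
  qed
qed

lemma density_\<rho>: assumes "g \<in> carrier G" shows "tr g = density \<eta> (\<rho> g)"
proof -
  obtain n where n: "g \<in> set_pmf (step n)" using carrier_step assms by blast
  have "density \<eta> (\<lambda>y. ennreal (\<rho> g y)) = density \<eta> (RN_deriv \<eta> (tr g))"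
    by (rule density_cong) (auto intro: ennreal_\<rho> assms)
  then show ?thesis using RN_deriv_translate(1)[OF n] by simp
qed

lemma \<rho>_le: assumes "g \<in> set_pmf (step n)"
  shows "AE y in \<eta>. \<rho> g y \<le> 1 / pmf (step n) g"
proof -
  have p: "pmf (step n) g > 0" and g: "g \<in> carrier G"
    using assms set_step by (auto simp: pmf_positive_iff)
  show ?thesis
    using RN_deriv_translate(2)[OF assms] ennreal_\<rho>[OF g]
  proof eventually_elim
    case (elim y)
    then have "ennreal (pmf (step n) g * \<rho> g y) \<le> ennreal 1"
      by (simp add: ennreal_mult)
    then have "pmf (step n) g * \<rho> g y \<le> 1" by (subst (asm) ennreal_le_iff) auto
    then show ?case using p by (simp add: field_simps)
  qed
qed

lemma AE_act:
  assumes g: "g \<in> carrier G" and "AE y in \<eta>. R y"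
  shows "AE y in \<eta>. R (\<alpha> g y)"
proof -
  have "AE y in tr g. R y"
    unfolding density_\<rho>[OF g]
    by (subst AE_density) (use assms(2) in auto)
  then show ?thesis by (rule AE_distrD[OF meas[OF g]])
qed

lemma nn_integral_act:
  assumes g: "g \<in> carrier G" and [measurable]: "f \<in> borel_measurable \<eta>"
  shows "(\<integral>\<^sup>+y. f (\<alpha> g y) \<partial>\<eta>) = (\<integral>\<^sup>+y. ennreal (\<rho> g y) * f y \<partial>\<eta>)"
proof -
  have "(\<integral>\<^sup>+y. f (\<alpha> g y) \<partial>\<eta>) = (\<integral>\<^sup>+y. f y \<partial>tr g)"
    using meas[OF g] by (subst nn_integral_distr) auto
  also have "\<dots> = (\<integral>\<^sup>+y. ennreal (\<rho> g y) * f y \<partial>\<eta>)"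
    unfolding density_\<rho>[OF g] by (subst nn_integral_density) auto
  finally show ?thesis .
qed

text \<open>The density of g\<eta> read off at the moved point. As \<open>\<alpha> g y\<close> has
  law g\<eta>, integrals of functions of \<open>J g\<close> against \<eta> are integrals of
  functions of the density against g\<eta>. Up to null sets it is the reciprocal of the density of
  the translate by the inverse of g.\<close>

definition J :: "'g \<Rightarrow> 'y \<Rightarrow> real" where "J g y = \<rho> g (\<alpha> g y)"

lemma J_measurable [measurable]: "g \<in> carrier G \<Longrightarrow> J g \<in> borel_measurable \<eta>"
  unfolding J_def[abs_def] by measurable

text \<open>A density is positive almost everywhere for the measure that it defines, and here this
  measure is the image of \<eta> under \<open>\<alpha> g\<close>.\<close>

lemma J_pos: assumes "g \<in> carrier G" shows "AE y in \<eta>. 0 < J g y"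
proof -
  have "AE y in tr g. 0 < \<rho> g y"
    unfolding density_\<rho>[OF assms] by (subst AE_density) (auto simp: less_le)
  then show ?thesis unfolding J_def by (rule AE_distrD[OF meas[OF assms]])
qed

lemma J_le: "g \<in> set_pmf (step n) \<Longrightarrow> AE y in \<eta>. J g y \<le> 1 / pmf (step n) g"
  unfolding J_def by (rule AE_act) (use set_step \<rho>_le in auto)

text \<open>After the change of variables the integrand is \<rho> times 1/\<rho>, which is 1, or 0
  where \<rho> vanishes because \<open>1 / 0 = 0\<close>; hence an inequality.\<close>

lemma nn_integral_inverse_J:
  assumes g: "g \<in> carrier G" shows "(\<integral>\<^sup>+y. ennreal (1 / J g y) \<partial>\<eta>) \<le> 1"
proof -
  have "(\<integral>\<^sup>+y. ennreal (1 / J g y) \<partial>\<eta>) = (\<integral>\<^sup>+y. ennreal (\<rho> g y) * ennreal (1 / \<rho> g y) \<partial>\<eta>)"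
    unfolding J_def by (rule nn_integral_act[OF g]) simp
  also have "\<dots> \<le> (\<integral>\<^sup>+y. 1 \<partial>\<eta>)"
    by (intro nn_integral_mono) (simp add: ennreal_mult[symmetric])
  finally show ?thesis using \<eta>.emeasure_space_1 by simp
qed

text \<open>The chain rule for Radon-Nikodym derivatives. Both sides, read before the final
  translation by \<open>g \<otimes> h\<close>, are densities of the same translate of \<eta>, and
  densities are unique.\<close>

lemma J_mult:
  assumes g: "g \<in> carrier G" and h: "h \<in> carrier G"
  shows "AE y in \<eta>. J (g \<otimes> h) y = J g (\<alpha> h y) * J h y"
proof -
  have gh: "g \<otimes> h \<in> carrier G" using g h by simp
  have [measurable]: "\<alpha> (inv g) \<in> \<eta> \<rightarrow>\<^sub>M \<eta>" using g by auto
  have "density \<eta> (\<lambda>y. ennreal (\<rho> (g \<otimes> h) y)) = density \<eta> (\<lambda>y. ennreal (\<rho> g y) * ennreal (\<rho> h (\<alpha> (inv g) y)))"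
  proof (rule measure_eqI)
    fix A assume "A \<in> sets (density \<eta> (\<lambda>y. ennreal (\<rho> (g \<otimes> h) y)))"
    then have A[measurable]: "A \<in> sets \<eta>" by simp
    have [measurable]: "(\<lambda>y. indicator A (\<alpha> g y) :: ennreal) \<in> borel_measurable \<eta>"
      using meas[OF g] A by measurable
    have "emeasure (density \<eta> (\<lambda>y. ennreal (\<rho> (g \<otimes> h) y))) A = (\<integral>\<^sup>+y. indicator A (\<alpha> (g \<otimes> h) y) \<partial>\<eta>)"
      by (subst nn_integral_act[OF gh]) (auto simp: emeasure_density)
    also have "\<dots> = (\<integral>\<^sup>+y. indicator A (\<alpha> g (\<alpha> h y)) \<partial>\<eta>)" using g h by (simp add: act_mult)
    also have "\<dots> = (\<integral>\<^sup>+y. ennreal (\<rho> h y) * indicator A (\<alpha> g y) \<partial>\<eta>)"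
      by (rule nn_integral_act[OF h]) simp
    also have "\<dots> = (\<integral>\<^sup>+y. ennreal (\<rho> h (\<alpha> (inv g) (\<alpha> g y))) * indicator A (\<alpha> g y) \<partial>\<eta>)"
      using g by (simp add: act_inv)
    also have "\<dots> = (\<integral>\<^sup>+y. ennreal (\<rho> g y) * (ennreal (\<rho> h (\<alpha> (inv g) y)) * indicator A y) \<partial>\<eta>)"
      by (rule nn_integral_act[OF g]) simp
    also have "\<dots> = emeasure (density \<eta> (\<lambda>y. ennreal (\<rho> g y) * ennreal (\<rho> h (\<alpha> (inv g) y)))) A"
      by (subst emeasure_density) (auto simp: mult.assoc)
    finally show "emeasure (density \<eta> (\<lambda>y. ennreal (\<rho> (g \<otimes> h) y))) A = \<dots>" .
  qed simp
  then have "AE y in \<eta>. ennreal (\<rho> (g \<otimes> h) y) = ennreal (\<rho> g y) * ennreal (\<rho> h (\<alpha> (inv g) y))"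
    by (subst (asm) \<eta>.density_unique_iff) auto
  then have "AE y in \<eta>. \<rho> (g \<otimes> h) y = \<rho> g y * \<rho> h (\<alpha> (inv g) y)"
    by eventually_elim (simp add: ennreal_mult[symmetric])
  from AE_act[OF gh this] show ?thesis
    by eventually_elim (use g h in \<open>simp add: J_def act_mult act_inv\<close>)
qed

text \<open>The relative entropy of g\<eta> with respect to \<eta>. Its mean over \<mu> is the
  Furstenberg entropy of the action.\<close>

definition ent :: "'g \<Rightarrow> real" where "ent g = (\<integral>y. ln (J g y) \<partial>\<eta>)"

text \<open>From above \<open>ln (J g y)\<close> is bounded by the constant of \<open>J_le\<close>;
  from below by \<open>1 - 1 / J g y\<close>, which is integrable by
  \<open>nn_integral_inverse_J\<close>.\<close>

lemma integrable_ln_J: assumes "g \<in> carrier G" shows "integrable \<eta> (\<lambda>y. ln (J g y))"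
proof -
  note [measurable] = assms
  obtain n where n: "g \<in> set_pmf (step n)" using carrier_step assms by blast
  have p: "0 < pmf (step n) g" "pmf (step n) g \<le> 1" using n by (auto simp: pmf_positive_iff pmf_le_1)
  have int: "integrable \<eta> (\<lambda>y. 1 / J g y)"
    using nn_integral_inverse_J[OF assms]
    by (intro integrableI_bounded) (auto simp: J_def less_top[symmetric] top_unique)
  show ?thesis
  proof (rule Bochner_Integration.integrable_bound[where f = "\<lambda>y. 1 / J g y + (- ln (pmf (step n) g))"])
    show "AE y in \<eta>. norm (ln (J g y)) \<le> norm (1 / J g y + - ln (pmf (step n) g))"
      using J_pos[OF assms] J_le[OF n]
    proof eventually_elim
      case (elim y)
      have 1: "ln (J g y) \<le> - ln (pmf (step n) g)"
        using ln_mono[OF elim(2) elim(1)] elim p by (simp add: ln_div)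
      have "- ln (J g y) \<le> 1 / J g y - 1"
        using ln_le_minus_one[of "1 / J g y"] elim by (simp add: ln_div)
      moreover have "- ln (pmf (step n) g) \<ge> 0" using p by simp
      moreover have "1 / J g y > 0" using elim by simp
      ultimately show ?case using 1 unfolding real_norm_def by linarith
    qed
  qed (use int in auto)
qed

lemma ent_nonneg: assumes "g \<in> carrier G" shows "0 \<le> ent g"
proof -
  note [measurable] = assms
  have int: "integrable \<eta> (\<lambda>y. 1 / J g y)"
    using nn_integral_inverse_J[OF assms]
    by (intro integrableI_bounded) (auto simp: J_def less_top[symmetric] top_unique)
  have "(\<integral>y. 1 / J g y \<partial>\<eta>) \<le> 1"
    using nn_integral_inverse_J[OF assms] nn_integral_eq_integral[OF int] by (simp add: J_def)
  moreover have "(\<integral>y. - ln (J g y) \<partial>\<eta>) \<le> (\<integral>y. 1 / J g y - 1 \<partial>\<eta>)"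
  proof (rule integral_mono_AE)
    show "AE y in \<eta>. - ln (J g y) \<le> 1 / J g y - 1"
      using J_pos[OF assms]
    proof eventually_elim
      case (elim y)
      then show ?case using ln_le_minus_one[of "1 / J g y"] by (simp add: ln_div)
    qed
  qed (use int integrable_ln_J[OF assms] in auto)
  ultimately show ?thesis
    using int \<eta>.prob_space by (simp add: ent_def)
qed

text \<open>The bound on the density, integrated. Averaged over g it says that the entropy of any
  stationary action for n steps is at most the Shannon entropy of \<open>step n\<close>.\<close>

lemma ent_le: assumes "g \<in> set_pmf (step n)" shows "ent g \<le> - ln (pmf (step n) g)"
proof -
  have g: "g \<in> carrier G" using assms set_step by auto
  have p: "0 < pmf (step n) g" using assms by (auto simp: pmf_positive_iff)
  have "ent g \<le> (\<integral>y. - ln (pmf (step n) g) \<partial>\<eta>)"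
    unfolding ent_def
  proof (rule integral_mono_AE[OF integrable_ln_J[OF g]])
    show "AE y in \<eta>. ln (J g y) \<le> - ln (pmf (step n) g)"
      using J_pos[OF g] J_le[OF assms]
    proof eventually_elim
      case (elim y)
      then show ?case using ln_mono[OF elim(2) elim(1)] p by (simp add: ln_div)
    qed
  qed simp
  then show ?thesis using \<eta>.prob_space by simp
qed

text \<open>By the chain rule, the entropy of \<open>g \<otimes> h\<close> is that of h plus the
  integral of \<open>ln (J g (\<alpha> h y))\<close>. Averaging over h of law \<open>step n\<close>
  replaces \<open>\<alpha> h y\<close> by a point of law \<eta>, by stationarity, and turns the last
  term into the entropy of g.\<close>

lemma ent_step_Suc:
  assumes fin: "(\<integral>\<^sup>+g. ennreal (- ln (pmf \<mu> g)) \<partial>\<mu>) < \<infinity>"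
  shows "(\<integral>\<^sup>+g. ennreal (ent g) \<partial>step (Suc n)) = (\<integral>\<^sup>+g. ennreal (ent g) \<partial>\<mu>) + (\<integral>\<^sup>+g. ennreal (ent g) \<partial>step n)"
proof -
  define lg where "lg g = - ln (pmf \<mu> g)" for g
  \<comment> \<open>The logarithm has no sign, but \<open>lg g - ln (J g y)\<close> is nonnegative, so additivity can be shown
    in \<open>ennreal\<close> without integrability side conditions.\<close>
  define e where "e g y = ennreal (lg g - ln (J g y))" for g y
  have ent_lg: "ent g \<le> lg g" if "g \<in> set_pmf \<mu>" for g
    using ent_le[of g "Suc 0"] that by (simp add: step_1 lg_def)
  have lg0: "0 \<le> lg g" if "g \<in> set_pmf \<mu>" for g
    using that by (auto simp: lg_def pmf_le_1 pmf_positive_iff)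
  have J_lg: "AE y in \<eta>. ln (J g y) \<le> lg g" if g: "g \<in> set_pmf \<mu>" for g
  proof -
    have "AE y in \<eta>. 0 < J g y" using g set_mu by (auto intro: J_pos)
    moreover have "AE y in \<eta>. J g y \<le> 1 / pmf \<mu> g"
      using J_le[of g "Suc 0"] g unfolding step_1 by simp
    ultimately show ?thesis
    proof eventually_elim
      case (elim y)
      have "ln (J g y) \<le> ln (1 / pmf \<mu> g)" using elim by (intro ln_mono) auto
      then show ?case using g by (simp add: lg_def ln_div set_pmf_iff)
    qed
  qed
  have e_int: "(\<integral>\<^sup>+y. e g y \<partial>\<eta>) = ennreal (lg g - ent g)" if g: "g \<in> set_pmf \<mu>" for g
  proof -
    have gc: "g \<in> carrier G" using g set_mu by auto
    have "(\<integral>\<^sup>+y. e g y \<partial>\<eta>) = ennreal (\<integral>y. lg g - ln (J g y) \<partial>\<eta>)"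
      unfolding e_def using J_lg[OF g] integrable_ln_J[OF gc]
      by (intro nn_integral_eq_integral) auto
    also have "(\<integral>y. lg g - ln (J g y) \<partial>\<eta>) = lg g - ent g"
      using integrable_ln_J[OF gc] \<eta>.prob_space by (simp add: ent_def)
    finally show ?thesis .
  qed
  have key: "ennreal (ent (g \<otimes> h)) + (\<integral>\<^sup>+y. e g (\<alpha> h y) \<partial>\<eta>) = ennreal (lg g) + ennreal (ent h)"
    if g: "g \<in> set_pmf \<mu>" and h: "h \<in> set_pmf (step n)" for g h
  proof -
    have gc: "g \<in> carrier G" and hc: "h \<in> carrier G" using g h set_mu set_step by auto
    have ghc: "g \<otimes> h \<in> carrier G" using gc hc by simp
    have eq: "AE y in \<eta>. ln (J g (\<alpha> h y)) = ln (J (g \<otimes> h) y) - ln (J h y)"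
      using J_mult[OF gc hc] J_pos[OF hc] J_pos[OF ghc]
    proof eventually_elim
      case (elim y)
      then have "J g (\<alpha> h y) > 0" by (simp add: zero_less_mult_iff)
      then show ?case using elim by (simp add: ln_mult)
    qed
    have [measurable]: "(\<lambda>y. J g (\<alpha> h y)) \<in> borel_measurable \<eta>"
      using J_measurable[OF gc] meas[OF hc] by measurable
    have "(\<integral>\<^sup>+y. e g (\<alpha> h y) \<partial>\<eta>) = (\<integral>\<^sup>+y. ennreal (lg g - (ln (J (g \<otimes> h) y) - ln (J h y))) \<partial>\<eta>)"
      unfolding e_def using eq by (intro nn_integral_cong_AE) auto
    also have "\<dots> = ennreal (\<integral>y. lg g - (ln (J (g \<otimes> h) y) - ln (J h y)) \<partial>\<eta>)"
    proof (rule nn_integral_eq_integral)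
      show "AE y in \<eta>. 0 \<le> lg g - (ln (J (g \<otimes> h) y) - ln (J h y))"
        using eq AE_act[OF hc J_lg[OF g]] by eventually_elim simp
    qed (use integrable_ln_J[OF hc] integrable_ln_J[OF ghc] in auto)
    also have "(\<integral>y. lg g - (ln (J (g \<otimes> h) y) - ln (J h y)) \<partial>\<eta>) = lg g - (ent (g \<otimes> h) - ent h)"
      using integrable_ln_J[OF hc] integrable_ln_J[OF ghc] \<eta>.prob_space by (simp add: ent_def)
    finally have 1: "(\<integral>\<^sup>+y. e g (\<alpha> h y) \<partial>\<eta>) = ennreal (lg g - (ent (g \<otimes> h) - ent h))" .
    have "ent (g \<otimes> h) - ent h \<le> lg g"
    proof -
      have "(\<integral>y. ln (J (g \<otimes> h) y) - ln (J h y) \<partial>\<eta>) \<le> (\<integral>y. lg g \<partial>\<eta>)"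
      proof (rule integral_mono_AE)
        show "AE y in \<eta>. ln (J (g \<otimes> h) y) - ln (J h y) \<le> lg g"
          using eq AE_act[OF hc J_lg[OF g]] by eventually_elim simp
      qed (use integrable_ln_J[OF hc] integrable_ln_J[OF ghc] in auto)
      then show ?thesis
        using integrable_ln_J[OF hc] integrable_ln_J[OF ghc] \<eta>.prob_space by (simp add: ent_def)
    qed
    then show ?thesis
      unfolding 1 using ent_nonneg[OF ghc] ent_nonneg[OF hc] lg0[OF g]
      by (simp add: ennreal_plus[symmetric] del: ennreal_plus)
  qed
  let ?E = "\<integral>\<^sup>+g. ennreal (lg g - ent g) \<partial>\<mu>"
  have "(\<integral>\<^sup>+g. ennreal (ent g) \<partial>step (Suc n)) + ?E =
      (\<integral>\<^sup>+g. (\<integral>\<^sup>+h. ennreal (ent (g \<otimes> h)) \<partial>step n) + (\<integral>\<^sup>+h. \<integral>\<^sup>+y. e g (\<alpha> h y) \<partial>\<eta> \<partial>step n) \<partial>\<mu>)"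
  proof -
    \<comment> \<open>Stationarity at time n inserts the average over h for free.\<close>
    have "?E = (\<integral>\<^sup>+g. \<integral>\<^sup>+h. \<integral>\<^sup>+y. e g (\<alpha> h y) \<partial>\<eta> \<partial>step n \<partial>\<mu>)"
    proof (intro nn_integral_cong_AE AE_pmfI)
      fix g assume g: "g \<in> set_pmf \<mu>"
      then have "e g \<in> borel_measurable \<eta>"
        using J_measurable[of g] set_mu unfolding e_def[abs_def] by auto
      then show "ennreal (lg g - ent g) = (\<integral>\<^sup>+h. \<integral>\<^sup>+y. e g (\<alpha> h y) \<partial>\<eta> \<partial>step n)"
        by (simp add: stat_nn_integral e_int[OF g])
    qed
    then show ?thesis by (simp add: nn_integral_step_Suc nn_integral_add)
  qed
  also have "\<dots> = (\<integral>\<^sup>+g. (\<integral>\<^sup>+h. ennreal (ent (g \<otimes> h)) + (\<integral>\<^sup>+y. e g (\<alpha> h y) \<partial>\<eta>) \<partial>step n) \<partial>\<mu>)"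
    by (simp add: nn_integral_add)
  also have "\<dots> = (\<integral>\<^sup>+g. (\<integral>\<^sup>+h. ennreal (lg g) + ennreal (ent h) \<partial>step n) \<partial>\<mu>)"
    by (intro nn_integral_cong_AE AE_pmfI) (rule key)
  also have "\<dots> = (\<integral>\<^sup>+g. ennreal (lg g) \<partial>\<mu>) + (\<integral>\<^sup>+h. ennreal (ent h) \<partial>step n)"
    by (simp add: nn_integral_add measure_pmf.emeasure_space_1)
  also have "(\<integral>\<^sup>+g. ennreal (lg g) \<partial>\<mu>) = (\<integral>\<^sup>+g. ennreal (ent g) + ennreal (lg g - ent g) \<partial>\<mu>)"
    using ent_lg ent_nonneg set_mu
    by (intro nn_integral_cong_AE AE_pmfI) (auto simp: ennreal_plus[symmetric] subset_eq simp del: ennreal_plus)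
  also have "\<dots> = (\<integral>\<^sup>+g. ennreal (ent g) \<partial>\<mu>) + ?E"
    by (rule nn_integral_add) auto
  finally have "?E + (\<integral>\<^sup>+g. ennreal (ent g) \<partial>step (Suc n)) =
      ?E + ((\<integral>\<^sup>+g. ennreal (ent g) \<partial>\<mu>) + (\<integral>\<^sup>+g. ennreal (ent g) \<partial>step n))"
    by (simp add: ac_simps)
  \<comment> \<open>Finite entropy of \<mu> is used to cancel \<open>?E\<close> from both
    sides.\<close>
  moreover have "?E < \<infinity>"
  proof -
    have "?E \<le> (\<integral>\<^sup>+g. ennreal (- ln (pmf \<mu> g)) \<partial>\<mu>)"
      using ent_nonneg set_mu
      by (intro nn_integral_mono_AE AE_pmfI ennreal_leI) (auto simp: lg_def subset_eq)
    with fin show ?thesis by simp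
  qed
  ultimately show ?thesis by (auto simp: ennreal_add_left_cancel)
qed

lemma ent_step:
  assumes fin: "(\<integral>\<^sup>+g. ennreal (- ln (pmf \<mu> g)) \<partial>\<mu>) < \<infinity>"
  shows "(\<integral>\<^sup>+g. ennreal (ent g) \<partial>step n) = of_nat n * (\<integral>\<^sup>+g. ennreal (ent g) \<partial>\<mu>)"
proof (induction n)
  case 0
  \<comment> \<open>At time 0 the law is the unit mass at the identity, so the bound is
    \<open>- ln 1\<close>.\<close>
  have "ent \<one> \<le> 0" using ent_le[of \<one> 0] by simp
  then show ?case by (simp add: ennreal_neg)
next
  case (Suc n)
  show ?case by (simp only: ent_step_Suc[OF fin] Suc) (simp add: distrib_right)
qed

end

section \<open>Gibbs' inequality for the walk given its limit\<close>

context stationary_action begin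

text \<open>Gibbs' inequality, applied to the conditional law \<open>g \<mapsto> step n g * d(g\<eta>)/d\<eta> (y)\<close> of the walk given its
  limit \<open>y\<close>.\<close>

lemma entropy_step_le:
  fixes Q :: "'y \<Rightarrow> 'g \<Rightarrow> real"
  assumes Q_meas: "\<And>g. g \<in> carrier G \<Longrightarrow> (\<lambda>y. Q y g) \<in> borel_measurable \<eta>"
    and Q_pos: "\<And>g y. g \<in> set_pmf (step n) \<Longrightarrow> 0 < Q y g"
    and Q_le: "\<And>g y. g \<in> set_pmf (step n) \<Longrightarrow> Q y g \<le> 1"
    and Q_sum: "\<And>y. (\<integral>\<^sup>+g. ennreal (Q y g) \<partial>count_space (set_pmf (step n))) \<le> 1"
  shows "(\<integral>\<^sup>+g. ennreal (- ln (pmf (step n) g)) \<partial>step n)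
    \<le> (\<integral>\<^sup>+g. ennreal (ent g) \<partial>step n) + (\<integral>\<^sup>+g. \<integral>\<^sup>+y. ennreal (- ln (Q (\<alpha> g y) g)) \<partial>\<eta> \<partial>step n)"
proof -
  \<comment> \<open>The ratio of the code distribution to the conditional law of the walk,
    integrated over y: the linear term that \<open>ln t \<le> t - 1\<close> leaves behind.\<close>
  define m where "m g = (\<integral>\<^sup>+y. ennreal (Q (\<alpha> g y) g / (pmf (step n) g * J g y)) \<partial>\<eta>)" for g
  have pt: "ennreal (- ln (pmf (step n) g)) + 1 \<le>
      ennreal (ent g) + (\<integral>\<^sup>+y. ennreal (- ln (Q (\<alpha> g y) g)) \<partial>\<eta>) + m g"
    if g: "g \<in> set_pmf (step n)" for g
  proof -
    define p where "p = pmf (step n) g"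
    have p: "0 < p" "p \<le> 1" using g by (auto simp: p_def pmf_positive_iff pmf_le_1)
    have gc[measurable]: "g \<in> carrier G" using g set_step by auto
    have [measurable]: "(\<lambda>y. Q (\<alpha> g y) g) \<in> borel_measurable \<eta>"
      using Q_meas[OF gc] meas[OF gc] by measurable
    define a where "a y = - ln (Q (\<alpha> g y) g)" for y
    define b where "b y = Q (\<alpha> g y) g / (p * J g y)" for y
    have [measurable]: "a \<in> borel_measurable \<eta>" "b \<in> borel_measurable \<eta>"
      by (auto simp: a_def[abs_def] b_def[abs_def])
    have a0: "0 \<le> a y" for y using Q_pos[OF g] Q_le[OF g] by (simp add: a_def)
    have b0: "0 \<le> b y" for y using less_imp_le[OF Q_pos[OF g]] p by (simp add: b_def J_def)
    \<comment> \<open>This is \<open>ln t \<le> t - 1\<close> at \<open>t = b y\<close>.\<close>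
    have main: "AE y in \<eta>. - ln p + 1 - ln (J g y) \<le> a y + b y"
      using J_pos[OF gc]
    proof eventually_elim
      case (elim y)
      have q: "0 < Q (\<alpha> g y) g" by (rule Q_pos[OF g])
      have "ln (b y) \<le> b y - 1" using q p elim by (intro ln_le_minus_one) (simp add: b_def)
      moreover have "ln (b y) = ln (Q (\<alpha> g y) g) - (ln p + ln (J g y))"
        using q p elim by (simp add: b_def ln_div ln_mult)
      ultimately show ?case by (simp add: a_def)
    qed
    have "ennreal (- ln p + 1) \<le> ennreal (ent g) + (\<integral>\<^sup>+y. ennreal (a y + b y) \<partial>\<eta>)"
    proof (cases "(\<integral>\<^sup>+y. ennreal (a y + b y) \<partial>\<eta>) = \<top>")
      case False
      then have int: "integrable \<eta> (\<lambda>y. a y + b y)"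
        using a0 b0 by (intro integrableI_bounded) (auto simp: less_top)
      have "(- ln p + 1) - ent g = (\<integral>y. - ln p + 1 - ln (J g y) \<partial>\<eta>)"
        using integrable_ln_J[OF gc] \<eta>.prob_space by (simp add: ent_def)
      also have "\<dots> \<le> (\<integral>y. a y + b y \<partial>\<eta>)"
        using integrable_ln_J[OF gc] by (intro integral_mono_AE int main) auto
      finally have "- ln p + 1 \<le> ent g + (\<integral>y. a y + b y \<partial>\<eta>)" by simp
      then have "ennreal (- ln p + 1) \<le> ennreal (ent g + (\<integral>y. a y + b y \<partial>\<eta>))" by (rule ennreal_leI)
      also have "\<dots> = ennreal (ent g) + (\<integral>\<^sup>+y. ennreal (a y + b y) \<partial>\<eta>)"
        using a0 b0 ent_nonneg[OF gc]
        by (subst nn_integral_eq_integral[OF int]) (auto intro!: ennreal_plus integral_nonneg_AE)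
      finally show ?thesis .
    qed simp
    also have "(\<integral>\<^sup>+y. ennreal (a y + b y) \<partial>\<eta>) = (\<integral>\<^sup>+y. ennreal (a y) \<partial>\<eta>) + (\<integral>\<^sup>+y. ennreal (b y) \<partial>\<eta>)"
      using a0 b0 by (simp add: nn_integral_add)
    also have "ennreal (- ln p + 1) = ennreal (- ln p) + 1"
      using p by (subst ennreal_plus) auto
    finally show ?thesis by (simp add: a_def b_def m_def p_def add.assoc)
  qed
  have m: "(\<integral>\<^sup>+g. m g \<partial>step n) \<le> 1"
  proof -
    have "(\<integral>\<^sup>+g. m g \<partial>step n) = (\<integral>\<^sup>+g. ennreal (pmf (step n) g) * m g \<partial>count_space (set_pmf (step n)))"
      by (subst nn_integral_measure_pmf) (auto simp: nn_integral_count_space_indicator set_pmf_iff indicator_def intro!: nn_integral_cong)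
    also have "\<dots> \<le> (\<integral>\<^sup>+g. \<integral>\<^sup>+y. ennreal (Q y g) \<partial>\<eta> \<partial>count_space (set_pmf (step n)))"
    proof (rule nn_integral_mono)
      fix g assume "g \<in> space (count_space (set_pmf (step n)))"
      then have g: "g \<in> set_pmf (step n)" by simp
      then have gc[measurable]: "g \<in> carrier G" using set_step by auto
      have p: "0 < pmf (step n) g" using g by (simp add: pmf_positive_iff)
      note [measurable] = Q_meas[OF gc]
      \<comment> \<open>Moving the point back by g brings in the factor \<open>\<rho> g y\<close>,
        which cancels the denominator together with the weight \<open>pmf (step n) g\<close>. What
        remains is the total mass of Q, at most 1.\<close>
      have "m g = (\<integral>\<^sup>+y. ennreal (\<rho> g y) * ennreal (Q y g / (pmf (step n) g * \<rho> g y)) \<partial>\<eta>)"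
        unfolding m_def J_def by (rule nn_integral_act[OF gc]) simp
      then have "ennreal (pmf (step n) g) * m g =
          (\<integral>\<^sup>+y. ennreal (pmf (step n) g) * (ennreal (\<rho> g y) * ennreal (Q y g / (pmf (step n) g * \<rho> g y))) \<partial>\<eta>)"
        by (simp add: nn_integral_cmult)
      also have "\<dots> \<le> (\<integral>\<^sup>+y. ennreal (Q y g) \<partial>\<eta>)"
        using p Q_pos[OF g, THEN less_imp_le]
        by (intro nn_integral_mono) (auto simp: ennreal_mult[symmetric] intro!: ennreal_leI)
      finally show "ennreal (pmf (step n) g) * m g \<le> (\<integral>\<^sup>+y. ennreal (Q y g) \<partial>\<eta>)" .
    qed
    also have "\<dots> = (\<integral>\<^sup>+y. \<integral>\<^sup>+g. ennreal (Q y g) \<partial>count_space (set_pmf (step n)) \<partial>\<eta>)"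
      using Q_meas set_step
      by (intro nn_integral_count_space_nn_integral[symmetric]) (auto simp: subset_eq)
    also have "\<dots> \<le> (\<integral>\<^sup>+y. 1 \<partial>\<eta>)" by (intro nn_integral_mono Q_sum)
    finally show ?thesis using \<eta>.emeasure_space_1 by simp
  qed
  let ?H = "\<integral>\<^sup>+g. ennreal (- ln (pmf (step n) g)) \<partial>step n"
  let ?R = "(\<integral>\<^sup>+g. ennreal (ent g) \<partial>step n) + (\<integral>\<^sup>+g. \<integral>\<^sup>+y. ennreal (- ln (Q (\<alpha> g y) g)) \<partial>\<eta> \<partial>step n)"
  \<comment> \<open>The 1 from \<open>t - 1\<close> is carried to the left so that all terms are
    nonnegative, and is cancelled at the end against the bound on the mean of
    \<open>m\<close>.\<close>
  have "?H + 1 = (\<integral>\<^sup>+g. ennreal (- ln (pmf (step n) g)) + 1 \<partial>step n)"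
    by (simp add: nn_integral_add measure_pmf.emeasure_space_1)
  also have "\<dots> \<le> (\<integral>\<^sup>+g. ennreal (ent g) + (\<integral>\<^sup>+y. ennreal (- ln (Q (\<alpha> g y) g)) \<partial>\<eta>) + m g \<partial>step n)"
    by (intro nn_integral_mono_AE AE_pmfI) (rule pt)
  also have "\<dots> = ?R + (\<integral>\<^sup>+g. m g \<partial>step n)"
    by (simp add: nn_integral_add)
  also have "\<dots> \<le> ?R + 1" using m by (rule add_left_mono)
  finally show ?thesis by (simp add: add.commute[of _ 1] ennreal_add_left_cancel_le)
qed

end

section \<open>Entropy under factor maps\<close>

locale factor_action = Y: stationary_action G \<mu> \<alpha> \<eta> + Z: stationary_action G \<mu> \<phi> \<nu>
  for G :: "('g, 'x) monoid_scheme" (structure) and \<mu> and \<alpha> :: "'g \<Rightarrow> 'y \<Rightarrow> 'y" and \<eta>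
    and \<phi> :: "'g \<Rightarrow> 'z \<Rightarrow> 'z" and \<nu> +
  fixes \<pi> :: "'y \<Rightarrow> 'z"
  assumes \<pi>_meas [measurable]: "\<pi> \<in> \<eta> \<rightarrow>\<^sub>M \<nu>"
    and \<pi>_distr: "distr \<eta> \<nu> \<pi> = \<nu>"
    and \<pi>_act: "g \<in> carrier G \<Longrightarrow> \<pi> (\<alpha> g y) = \<phi> g (\<pi> y)"
begin

lemma nn_integral_\<pi>: "f \<in> borel_measurable \<nu> \<Longrightarrow> (\<integral>\<^sup>+y. f (\<pi> y) \<partial>\<eta>) = (\<integral>\<^sup>+z. f z \<partial>\<nu>)"
  using nn_integral_distr[OF \<pi>_meas, of f] unfolding \<pi>_distr by simp

lemma AE_\<pi>: "AE z in \<nu>. R z \<Longrightarrow> AE y in \<eta>. R (\<pi> y)"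
  using AE_distrD[OF \<pi>_meas, of R] unfolding \<pi>_distr .

text \<open>The change of variables multiplies by the density upstairs, which cancels the
  denominator. Where that density vanishes the left side contributes 0, hence the
  inequality.\<close>

lemma nn_integral_ratio:
  assumes gc: "g \<in> carrier G" and [measurable]: "f \<in> borel_measurable \<eta>"
  shows "(\<integral>\<^sup>+y. f (\<alpha> g y) * ennreal (Z.J g (\<pi> y) / Y.J g y) \<partial>\<eta>) \<le> (\<integral>\<^sup>+y. f y * ennreal (Z.\<rho> g (\<pi> y)) \<partial>\<eta>)"
proof -
  have "(\<integral>\<^sup>+y. f (\<alpha> g y) * ennreal (Z.J g (\<pi> y) / Y.J g y) \<partial>\<eta>) =
      (\<integral>\<^sup>+y. ennreal (Y.\<rho> g y) * (f y * ennreal (Z.\<rho> g (\<pi> y) / Y.\<rho> g y)) \<partial>\<eta>)"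
    unfolding Y.J_def Z.J_def \<pi>_act[OF gc, symmetric]
    by (rule Y.nn_integral_act[OF gc]) measurable
  also have "\<dots> = (\<integral>\<^sup>+y. f y * ennreal (Y.\<rho> g y * (Z.\<rho> g (\<pi> y) / Y.\<rho> g y)) \<partial>\<eta>)"
    by (intro nn_integral_cong) (simp only: ennreal_mult[OF Y.\<rho>_nonneg divide_nonneg_nonneg[OF Z.\<rho>_nonneg Y.\<rho>_nonneg]] ac_simps)
  also have "\<dots> \<le> (\<integral>\<^sup>+y. f y * ennreal (Z.\<rho> g (\<pi> y)) \<partial>\<eta>)"
    by (intro nn_integral_mono mult_left_mono ennreal_leI) auto
  finally show ?thesis .
qed

lemma nn_integral_Z_\<rho>: assumes gc: "g \<in> carrier G" shows "(\<integral>\<^sup>+y. ennreal (Z.\<rho> g (\<pi> y)) \<partial>\<eta>) = 1"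
proof -
  have "(\<integral>\<^sup>+y. ennreal (Z.\<rho> g (\<pi> y)) \<partial>\<eta>) = (\<integral>\<^sup>+z. ennreal (Z.\<rho> g z) \<partial>\<nu>)"
    by (rule nn_integral_\<pi>) simp
  also have "\<dots> = (\<integral>\<^sup>+z. 1 \<partial>\<nu>)"
    using Z.nn_integral_act[OF gc, of "\<lambda>_. 1"] by simp
  finally show ?thesis using Z.\<eta>.emeasure_space_1 by simp
qed

text \<open>Let r be the ratio of the lifted density below to the density above. The function
  \<open>k = r - 1 - ln r\<close> is nonnegative, and its integral is at most the difference of the
  entropies since r has integral at most 1. If the entropies agree, k vanishes almost everywhere,
  and \<open>ln r = r - 1\<close> only at r = 1.\<close>

lemma
  assumes gc: "g \<in> carrier G"
  shows ent_factor_le: "Z.ent g \<le> Y.ent g"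
    and ent_factor_eq: "Y.ent g \<le> Z.ent g \<Longrightarrow> AE y in \<eta>. Z.J g (\<pi> y) / Y.J g y = 1"
proof -
  note [measurable] = gc
  define r where "r y = Z.J g (\<pi> y) / Y.J g y" for y
  have [measurable]: "r \<in> borel_measurable \<eta>"
    using Z.J_measurable[OF gc] unfolding r_def[abs_def] by measurable
  have r0: "0 \<le> r y" for y by (simp add: r_def Z.J_def Y.J_def)
  have "(\<integral>\<^sup>+y. ennreal (r y) \<partial>\<eta>) \<le> 1"
    using nn_integral_ratio[OF gc, of "\<lambda>_. 1"] nn_integral_Z_\<rho>[OF gc] by (simp add: r_def)
  then have int_r: "integrable \<eta> r" and r1: "(\<integral>y. r y \<partial>\<eta>) \<le> 1"
  proof -
    show int: "integrable \<eta> r"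
      using \<open>(\<integral>\<^sup>+y. ennreal (r y) \<partial>\<eta>) \<le> 1\<close> r0
      by (intro integrableI_bounded) (auto simp: less_top[symmetric] top_unique)
    show "(\<integral>y. r y \<partial>\<eta>) \<le> 1"
      using \<open>(\<integral>\<^sup>+y. ennreal (r y) \<partial>\<eta>) \<le> 1\<close> nn_integral_eq_integral[OF int] r0 by simp
  qed
  have int_Z: "integrable \<eta> (\<lambda>y. ln (Z.J g (\<pi> y)))"
    using Z.integrable_ln_J[OF gc] by (subst (asm) \<pi>_distr[symmetric]) (simp add: integrable_distr_eq)
  have ent_Z: "Z.ent g = (\<integral>y. ln (Z.J g (\<pi> y)) \<partial>\<eta>)"
    unfolding Z.ent_def by (subst \<pi>_distr[symmetric]) (simp add: integral_distr)
  define k where "k y = r y - 1 + ln (Y.J g y) - ln (Z.J g (\<pi> y))" for y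
  have int_k: "integrable \<eta> k"
    unfolding k_def[abs_def] using int_r int_Z Y.integrable_ln_J[OF gc] by auto
  have k_int: "(\<integral>y. k y \<partial>\<eta>) = (\<integral>y. r y \<partial>\<eta>) - 1 + Y.ent g - Z.ent g"
    unfolding k_def ent_Z Y.ent_def using int_r int_Z Y.integrable_ln_J[OF gc] Y.\<eta>.prob_space by simp
  have pos: "AE y in \<eta>. 0 < r y \<and> ln (r y) = ln (Z.J g (\<pi> y)) - ln (Y.J g y)"
    using Y.J_pos[OF gc] AE_\<pi>[OF Z.J_pos[OF gc]]
    by eventually_elim (simp add: r_def ln_div)
  have k0: "AE y in \<eta>. 0 \<le> k y"
    using pos
  proof eventually_elim
    case (elim y)
    then show ?case using ln_le_minus_one[of "r y"] by (simp add: k_def)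
  qed
  show "Z.ent g \<le> Y.ent g"
    using integral_nonneg_AE[OF k0] k_int r1 by simp
  assume "Y.ent g \<le> Z.ent g"
  then have "(\<integral>y. k y \<partial>\<eta>) = 0"
    using integral_nonneg_AE[OF k0] k_int r1 by simp
  then have "AE y in \<eta>. k y = 0"
    using integral_nonneg_eq_0_iff_AE[OF int_k k0] by simp
  then show "AE y in \<eta>. Z.J g (\<pi> y) / Y.J g y = 1"
    using pos
  proof eventually_elim
    case (elim y)
    then show ?case using ln_eq_minus_one[of "r y"] by (simp add: k_def r_def[symmetric])
  qed
qed

text \<open>With r = 1 the ratio estimate gives an inequality for every set. Applied to A and to its
  complement, with both sides adding up to the total mass 1, it leaves no room for
  strictness.\<close>

lemma density_factor:
  assumes gc: "g \<in> carrier G" and le: "Y.ent g \<le> Z.ent g" and A: "A \<in> sets \<eta>"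
  shows "emeasure \<eta> (\<alpha> g -` A) = (\<integral>\<^sup>+y. indicator A y * ennreal (Z.\<rho> g (\<pi> y)) \<partial>\<eta>)"
proof -
  have half: "emeasure \<eta> (\<alpha> g -` B) \<le> (\<integral>\<^sup>+y. indicator B y * ennreal (Z.\<rho> g (\<pi> y)) \<partial>\<eta>)"
    if B: "B \<in> sets \<eta>" for B
  proof -
    have "emeasure \<eta> (\<alpha> g -` B) = (\<integral>\<^sup>+y. indicator B (\<alpha> g y) \<partial>\<eta>)"
      using Y.vimage_act[OF gc B]
      by (simp add: nn_integral_indicator[symmetric] indicator_vimage del: nn_integral_indicator)
    also have "\<dots> = (\<integral>\<^sup>+y. indicator B (\<alpha> g y) * ennreal (Z.J g (\<pi> y) / Y.J g y) \<partial>\<eta>)"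
    proof (rule nn_integral_cong_AE)
      show "AE y in \<eta>. (indicator B (\<alpha> g y) :: ennreal) = indicator B (\<alpha> g y) * ennreal (Z.J g (\<pi> y) / Y.J g y)"
        using ent_factor_eq[OF gc le] by eventually_elim simp
    qed
    also have "\<dots> \<le> (\<integral>\<^sup>+y. indicator B y * ennreal (Z.\<rho> g (\<pi> y)) \<partial>\<eta>)"
      using B by (intro nn_integral_ratio[OF gc]) simp
    finally show ?thesis .
  qed
  have gA: "\<alpha> g -` A \<in> sets \<eta>" by (rule Y.vimage_act[OF gc A])
  have A': "UNIV - A \<in> sets \<eta>" using sets.compl_sets[OF A] by simp
  let ?I = "\<lambda>B. \<integral>\<^sup>+y. indicator B y * ennreal (Z.\<rho> g (\<pi> y)) \<partial>\<eta>"
  have "emeasure \<eta> (\<alpha> g -` A) + emeasure \<eta> (\<alpha> g -` (UNIV - A)) = 1"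
    using Y.\<eta>.emeasure_space_1 gA sets.compl_sets[OF gA]
    by (subst plus_emeasure) (auto simp: vimage_Diff Un_Diff_cancel)
  moreover have "?I A + ?I (UNIV - A) = 1"
  proof -
    have "?I A + ?I (UNIV - A) = (\<integral>\<^sup>+y. indicator A y * ennreal (Z.\<rho> g (\<pi> y)) + indicator (UNIV - A) y * ennreal (Z.\<rho> g (\<pi> y)) \<partial>\<eta>)"
    proof (rule nn_integral_add[symmetric])
      have *: "(\<lambda>y. indicator B y * ennreal (Z.\<rho> g (\<pi> y))) \<in> borel_measurable \<eta>" if "B \<in> sets \<eta>" for B
        using that measurable_compose[OF \<pi>_meas Z.\<rho>_measurable] by measurable
      from *[OF A] *[OF A']
      show "(\<lambda>y. indicator A y * ennreal (Z.\<rho> g (\<pi> y))) \<in> borel_measurable \<eta>"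
        and "(\<lambda>y. indicator (UNIV - A) y * ennreal (Z.\<rho> g (\<pi> y))) \<in> borel_measurable \<eta>" .
    qed
    also have "\<dots> = (\<integral>\<^sup>+y. ennreal (Z.\<rho> g (\<pi> y)) \<partial>\<eta>)"
      by (intro nn_integral_cong) (auto simp: indicator_def)
    finally show ?thesis using nn_integral_Z_\<rho>[OF gc] by simp
  qed
  ultimately have "?I A + ?I (UNIV - A) = emeasure \<eta> (\<alpha> g -` A) + emeasure \<eta> (\<alpha> g -` (UNIV - A))"
    and 1: "?I A + ?I (UNIV - A) = 1" by simp_all
  note this(1)
  also have "emeasure \<eta> (\<alpha> g -` A) + emeasure \<eta> (\<alpha> g -` (UNIV - A)) \<le> emeasure \<eta> (\<alpha> g -` A) + ?I (UNIV - A)"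
    by (rule add_left_mono[OF half[OF A']])
  finally have "?I A + ?I (UNIV - A) \<le> emeasure \<eta> (\<alpha> g -` A) + ?I (UNIV - A)" .
  moreover have "?I (UNIV - A) \<noteq> \<top>"
  proof
    assume "?I (UNIV - A) = \<top>"
    with 1 show False by simp
  qed
  then have "?I (UNIV - A) < \<top>" by (simp add: less_top)
  ultimately have "?I A \<le> emeasure \<eta> (\<alpha> g -` A)"
    by (auto simp: add.commute[of _ "?I (UNIV - A)"] ennreal_add_left_cancel_le)
  with half[OF A] show ?thesis by simp
qed

end

subsection \<open>Limit points of the walk in a boundary\<close>

locale boundary_action = stationary_action G \<mu> \<alpha> \<eta>
  for G :: "('g, 'x) monoid_scheme" (structure) and \<mu> and \<alpha> :: "'g \<Rightarrow> 'y :: metric_space \<Rightarrow> 'y" and \<eta> +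
  assumes sets_\<eta>: "sets \<eta> = sets borel"
    and conv: "AE \<omega> in P. \<exists>b. \<forall>f::'y \<Rightarrow> real. continuous_on UNIV f \<and> bounded (range f) \<longrightarrow>
        (\<lambda>n. \<integral>y. f (\<alpha> (W n \<omega>) y) \<partial>\<eta>) \<longlonglongrightarrow> f b"
begin

lemma borel_\<eta>: "f \<in> borel_measurable borel \<Longrightarrow> f \<in> borel_measurable \<eta>"
  by (simp add: measurable_cong_sets[OF sets_\<eta> refl])

lemma measurable_act_borel: "g \<in> carrier G \<Longrightarrow> \<alpha> g \<in> borel \<rightarrow>\<^sub>M borel"
  using meas[of g] by (simp add: measurable_cong_sets[OF sets_\<eta> sets_\<eta>])

definition limit_at :: "(nat \<Rightarrow> 'g) \<Rightarrow> 'y \<Rightarrow> bool" where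
  "limit_at \<omega> b \<longleftrightarrow> (\<forall>f::'y \<Rightarrow> real. continuous_on UNIV f \<and> bounded (range f) \<longrightarrow>
        (\<lambda>n. \<integral>y. f (\<alpha> (W n \<omega>) y) \<partial>\<eta>) \<longlonglongrightarrow> f b)"

lemma bounded_cutoff:
  fixes U :: "'y set"
  shows "continuous_on UNIV (\<lambda>x. min 1 (real k * infdist x (- U)))" and "bounded (range (\<lambda>x. min 1 (real k * infdist x (- U))))"
proof -
  show "continuous_on UNIV (\<lambda>x. min 1 (real k * infdist x (- U)))"
    by (intro continuous_intros)
  show "bounded (range (\<lambda>x. min 1 (real k * infdist x (- U))))"
    by (rule boundedI[where B = 1]) (auto simp: infdist_nonneg)
qed

text \<open>The limits are chosen arbitrarily outside a null set. Measurability survives because the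
  preimage of an open U is the set where a limit of measurable functions, the integrals of a cutoff
  f that is positive exactly on U, is positive.\<close>

lemma ex_limit_map: "\<exists>\<xi>. \<xi> \<in> P \<rightarrow>\<^sub>M borel \<and> (AE \<omega> in P. limit_at \<omega> (\<xi> \<omega>))"
proof -
  have "AE \<omega> in P. \<exists>b. limit_at \<omega> b" using conv by (simp add: limit_at_def)
  then obtain N where N: "{\<omega>\<in>space P. \<not> (\<exists>b. limit_at \<omega> b)} \<subseteq> N" "emeasure P N = 0" "N \<in> sets P"
    by (rule AE_E)
  define \<xi> where "\<xi> \<omega> = (if \<omega> \<in> N then undefined else (SOME b. limit_at \<omega> b))" for \<omega>
  have lim: "limit_at \<omega> (\<xi> \<omega>)" if "\<omega> \<notin> N" for \<omega>
  proof -
    have "\<exists>b. limit_at \<omega> b" using that N(1) by auto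
    then show ?thesis using that by (simp add: \<xi>_def someI_ex)
  qed
  have "\<xi> \<in> P \<rightarrow>\<^sub>M borel"
  proof (rule borel_measurableI)
    fix U :: "'y set" assume U: "open U"
    show "\<xi> -` U \<inter> space P \<in> sets P"
    \<comment> \<open>\<open>infdist\<close> to the empty set is 0, so the cutoff says nothing about
      the whole space.\<close>
    proof (cases "U = UNIV")
      case False
      define f where "f x = min 1 (real 1 * infdist x (- U))" for x
      have f0: "f x > 0 \<longleftrightarrow> x \<in> U" for x
      proof -
        have "closed (- U)" "- U \<noteq> {}" using U False by auto
        then have "x \<in> U \<longleftrightarrow> infdist x (- U) \<noteq> 0"
          using in_closed_iff_infdist_zero[of "- U" x] by auto
        then show ?thesis using infdist_nonneg[of x "- U"] by (auto simp: f_def min_def)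
      qed
      define l where "l \<omega> = lim (\<lambda>n. \<integral>y. f (\<alpha> (W n \<omega>) y) \<partial>\<eta>)" for \<omega>
      have l: "l \<in> borel_measurable P"
        unfolding l_def
        by (intro borel_measurable_lim_metric borel_measurable_W[of "\<lambda>g. \<integral>y. f (\<alpha> g y) \<partial>\<eta>"])
      have l\<xi>: "l \<omega> = f (\<xi> \<omega>)" if "\<omega> \<notin> N" for \<omega>
      proof -
        have "continuous_on UNIV f" "bounded (range f)"
          unfolding f_def by (rule bounded_cutoff)+
        then show ?thesis
          unfolding l_def using lim[OF that] by (intro limI) (auto simp: limit_at_def)
      qed
      have "\<xi> -` U \<inter> space P = ({\<omega>\<in>space P. l \<omega> > 0} - N) \<union> (if undefined \<in> U then N else {})"
        using l\<xi> f0 by (auto simp: \<xi>_def split: if_splits)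
      also have "\<dots> \<in> sets P"
      proof -
        have "{\<omega>\<in>space P. l \<omega> > 0} \<in> sets P" using l by measurable
        with N(3) show ?thesis by auto
      qed
      finally show ?thesis .
    qed (use sets.top[of P] in simp)
  qed
  moreover have "AE \<omega> in P. limit_at \<omega> (\<xi> \<omega>)"
    using N lim by (intro AE_I[of _ _ N]) auto
  ultimately show ?thesis by blast
qed

definition \<xi> :: "(nat \<Rightarrow> 'g) \<Rightarrow> 'y" where
  "\<xi> = (SOME \<xi>. \<xi> \<in> P \<rightarrow>\<^sub>M borel \<and> (AE \<omega> in P. limit_at \<omega> (\<xi> \<omega>)))"

lemma \<xi>_measurable [measurable]: "\<xi> \<in> P \<rightarrow>\<^sub>M borel" and \<xi>_limit: "AE \<omega> in P. limit_at \<omega> (\<xi> \<omega>)"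
  using someI_ex[OF ex_limit_map] by (auto simp: \<xi>_def)

text \<open>The mean L1 distance between f on the translate of \<eta> by the walk and the value of f
  at the limit. Weak convergence speaks only of continuous f; this averaged form extends to bounded
  Borel f, because the moved point and the limit both have law \<eta>.\<close>

definition dev :: "('y \<Rightarrow> real) \<Rightarrow> nat \<Rightarrow> ennreal" where
  "dev f n = (\<integral>\<^sup>+\<omega>. \<integral>\<^sup>+y. ennreal \<bar>f (\<alpha> (W n \<omega>) y) - f (\<xi> \<omega>)\<bar> \<partial>\<eta> \<partial>P)"

lemma measurable_W_\<xi>:
  assumes "\<And>g. g \<in> carrier G \<Longrightarrow> F g \<in> borel_measurable borel"
  shows "(\<lambda>\<omega>. F (W n \<omega>) (\<xi> \<omega>)) \<in> borel_measurable P"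
  by (rule measurable_compose_countable'[OF _ measurable_W countable_carrier])
    (use assms in \<open>measurable\<close>)

lemma measurable_dev:
  assumes [measurable]: "f \<in> borel_measurable borel"
  shows "(\<lambda>\<omega>. \<integral>\<^sup>+y. ennreal \<bar>f (\<alpha> (W n \<omega>) y) - f (\<xi> \<omega>)\<bar> \<partial>\<eta>) \<in> borel_measurable P"
proof (rule measurable_W_\<xi>[of "\<lambda>g c. \<integral>\<^sup>+y. ennreal \<bar>f (\<alpha> g y) - f c\<bar> \<partial>\<eta>"])
  fix g assume g: "g \<in> carrier G"
  have [measurable]: "(\<lambda>y. f (\<alpha> g y)) \<in> borel_measurable \<eta>"
    using measurable_act_borel[OF g] by (intro borel_\<eta>) measurable
  show "(\<lambda>c. \<integral>\<^sup>+y. ennreal \<bar>f (\<alpha> g y) - f c\<bar> \<partial>\<eta>) \<in> borel_measurable borel"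
    by measurable
qed

lemma stat_W:
  assumes "f \<in> borel_measurable borel"
  shows "(\<integral>\<^sup>+\<omega>. \<integral>\<^sup>+y. f (\<alpha> (W n \<omega>) y) \<partial>\<eta> \<partial>P) = (\<integral>\<^sup>+y. f y \<partial>\<eta>)"
  using stat_nn_integral[OF borel_\<eta>[OF assms], of n] nn_integral_W[of "\<lambda>g. \<integral>\<^sup>+y. f (\<alpha> g y) \<partial>\<eta>" n] by simp

lemma measurable_act_W: "f \<in> borel_measurable borel \<Longrightarrow> (\<lambda>y. f (\<alpha> (W n \<omega>) y)) \<in> borel_measurable \<eta>"
  by (intro borel_\<eta> measurable_compose[OF measurable_act_borel]) auto

text \<open>For a fixed path, weak convergence is tested on
  \<open>h x = \<bar>f x - f (\<xi> \<omega>)\<bar>\<close>, which is continuous and vanishes at the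
  limit; dominated convergence does the rest.\<close>

lemma dev_continuous:
  assumes c: "continuous_on UNIV f" and b: "bounded (range f)"
  shows "dev f \<longlonglongrightarrow> 0"
proof -
  obtain K where K: "\<And>x. \<bar>f x\<bar> \<le> K" using b by (auto simp: bounded_iff)
  have fm: "f \<in> borel_measurable borel" by (rule borel_measurable_continuous_onI[OF c])
  have "(\<lambda>n. \<integral>\<^sup>+\<omega>. \<integral>\<^sup>+y. ennreal \<bar>f (\<alpha> (W n \<omega>) y) - f (\<xi> \<omega>)\<bar> \<partial>\<eta> \<partial>P) \<longlonglongrightarrow> (\<integral>\<^sup>+\<omega>. 0 \<partial>P)"
  proof (rule nn_integral_dominated_convergence[where w = "\<lambda>_. ennreal (2 * K)"])
    show "AE \<omega> in P. (\<integral>\<^sup>+y. ennreal \<bar>f (\<alpha> (W n \<omega>) y) - f (\<xi> \<omega>)\<bar> \<partial>\<eta>) \<le> ennreal (2 * K)" for n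
    proof (rule AE_I2)
      fix \<omega>
      have "(\<integral>\<^sup>+y. ennreal \<bar>f (\<alpha> (W n \<omega>) y) - f (\<xi> \<omega>)\<bar> \<partial>\<eta>) \<le> (\<integral>\<^sup>+y. ennreal (2 * K) \<partial>\<eta>)"
      proof (intro nn_integral_mono ennreal_leI)
        fix y show "\<bar>f (\<alpha> (W n \<omega>) y) - f (\<xi> \<omega>)\<bar> \<le> 2 * K"
          using K[of "\<alpha> (W n \<omega>) y"] K[of "\<xi> \<omega>"] by linarith
      qed
      then show "(\<integral>\<^sup>+y. ennreal \<bar>f (\<alpha> (W n \<omega>) y) - f (\<xi> \<omega>)\<bar> \<partial>\<eta>) \<le> ennreal (2 * K)"
        using \<eta>.emeasure_space_1 by simp
    qed
    show "(\<integral>\<^sup>+\<omega>. ennreal (2 * K) \<partial>P) < \<infinity>" using P.emeasure_space_1 by simp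
    show "AE \<omega> in P. (\<lambda>n. \<integral>\<^sup>+y. ennreal \<bar>f (\<alpha> (W n \<omega>) y) - f (\<xi> \<omega>)\<bar> \<partial>\<eta>) \<longlonglongrightarrow> 0"
      using \<xi>_limit
    proof eventually_elim
      case (elim \<omega>)
      define h where "h x = \<bar>f x - f (\<xi> \<omega>)\<bar>" for x
      have hb: "\<bar>h x\<bar> \<le> 2 * K" for x
        using K[of x] K[of "\<xi> \<omega>"] unfolding h_def by linarith
      have "continuous_on UNIV h" unfolding h_def by (intro continuous_intros c)
      moreover have "bounded (range h)" using hb by (auto simp: bounded_iff)
      ultimately have "(\<lambda>n. \<integral>y. h (\<alpha> (W n \<omega>) y) \<partial>\<eta>) \<longlonglongrightarrow> h (\<xi> \<omega>)"
        using elim unfolding limit_at_def by blast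
      then have "(\<lambda>n. ennreal (\<integral>y. h (\<alpha> (W n \<omega>) y) \<partial>\<eta>)) \<longlonglongrightarrow> ennreal 0"
        by (intro tendsto_ennrealI) (simp add: h_def)
      moreover have "ennreal (\<integral>y. h (\<alpha> (W n \<omega>) y) \<partial>\<eta>) = (\<integral>\<^sup>+y. ennreal (h (\<alpha> (W n \<omega>) y)) \<partial>\<eta>)" for n
      proof (rule nn_integral_eq_integral[symmetric])
        show "integrable \<eta> (\<lambda>y. h (\<alpha> (W n \<omega>) y))"
        proof (rule \<eta>.integrable_const_bound[where B = "2 * K"])
          show "(\<lambda>y. h (\<alpha> (W n \<omega>) y)) \<in> borel_measurable \<eta>"
            using fm by (intro measurable_act_W) (simp add: h_def)
        qed (use hb in auto)
      qed (simp add: h_def)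
      ultimately show ?case by (simp add: h_def)
    qed
  qed (use measurable_dev[OF fm] in auto)
  then show ?thesis by (simp add: dev_def[abs_def])
qed

text \<open>By stationarity the mean of f on the translated measures is its \<eta>-integral at every
  time n, and it differs from the mean of f at the limit by at most \<open>dev f n\<close>.\<close>

lemma nn_integral_\<xi>_continuous:
  assumes c: "continuous_on UNIV f" and b: "bounded (range f)" and nn: "\<And>x. 0 \<le> f x"
  shows "(\<integral>\<^sup>+\<omega>. ennreal (f (\<xi> \<omega>)) \<partial>P) = (\<integral>\<^sup>+y. ennreal (f y) \<partial>\<eta>)"
proof -
  have fm[measurable]: "f \<in> borel_measurable borel" by (rule borel_measurable_continuous_onI[OF c])
  note [measurable] = measurable_act_W[OF fm] measurable_dev[OF fm]
  have mW: "(\<lambda>\<omega>. \<integral>\<^sup>+y. ennreal (f (\<alpha> (W n \<omega>) y)) \<partial>\<eta>) \<in> borel_measurable P" for n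
    by (rule borel_measurable_W[of "\<lambda>g. \<integral>\<^sup>+y. ennreal (f (\<alpha> g y)) \<partial>\<eta>"])
  have 1: "(\<integral>\<^sup>+\<omega>. ennreal (f (\<xi> \<omega>)) \<partial>P) \<le> (\<integral>\<^sup>+y. ennreal (f y) \<partial>\<eta>) + dev f n" for n
  proof -
    have "(\<integral>\<^sup>+\<omega>. ennreal (f (\<xi> \<omega>)) \<partial>P) = (\<integral>\<^sup>+\<omega>. \<integral>\<^sup>+y. ennreal (f (\<xi> \<omega>)) \<partial>\<eta> \<partial>P)"
      using \<eta>.emeasure_space_1 by simp
    also have "\<dots> \<le> (\<integral>\<^sup>+\<omega>. \<integral>\<^sup>+y. ennreal (f (\<alpha> (W n \<omega>) y)) + ennreal \<bar>f (\<alpha> (W n \<omega>) y) - f (\<xi> \<omega>)\<bar> \<partial>\<eta> \<partial>P)"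
      using nn by (intro nn_integral_mono) (auto simp: ennreal_plus[symmetric] simp del: ennreal_plus intro!: ennreal_leI)
    also have "\<dots> = (\<integral>\<^sup>+\<omega>. \<integral>\<^sup>+y. ennreal (f (\<alpha> (W n \<omega>) y)) \<partial>\<eta> \<partial>P) + dev f n"
      unfolding dev_def using mW by (simp add: nn_integral_add)
    also have "(\<integral>\<^sup>+\<omega>. \<integral>\<^sup>+y. ennreal (f (\<alpha> (W n \<omega>) y)) \<partial>\<eta> \<partial>P) = (\<integral>\<^sup>+y. ennreal (f y) \<partial>\<eta>)"
      by (rule stat_W) measurable
    finally show ?thesis .
  qed
  have 2: "(\<integral>\<^sup>+y. ennreal (f y) \<partial>\<eta>) \<le> (\<integral>\<^sup>+\<omega>. ennreal (f (\<xi> \<omega>)) \<partial>P) + dev f n" for n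
  proof -
    have "(\<integral>\<^sup>+y. ennreal (f y) \<partial>\<eta>) = (\<integral>\<^sup>+\<omega>. \<integral>\<^sup>+y. ennreal (f (\<alpha> (W n \<omega>) y)) \<partial>\<eta> \<partial>P)"
      by (rule stat_W[symmetric]) measurable
    also have "\<dots> \<le> (\<integral>\<^sup>+\<omega>. \<integral>\<^sup>+y. ennreal (f (\<xi> \<omega>)) + ennreal \<bar>f (\<alpha> (W n \<omega>) y) - f (\<xi> \<omega>)\<bar> \<partial>\<eta> \<partial>P)"
      using nn by (intro nn_integral_mono) (auto simp: ennreal_plus[symmetric] simp del: ennreal_plus intro!: ennreal_leI)
    also have "\<dots> = (\<integral>\<^sup>+\<omega>. ennreal (f (\<xi> \<omega>)) \<partial>P) + dev f n"
      unfolding dev_def using \<eta>.emeasure_space_1 by (simp add: nn_integral_add)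
    finally show ?thesis .
  qed
  have T0: "(\<lambda>n. a + dev f n) \<longlonglongrightarrow> a + 0" for a
    by (intro tendsto_intros dev_continuous c b)
  show ?thesis
  proof (rule antisym)
    show "(\<integral>\<^sup>+\<omega>. ennreal (f (\<xi> \<omega>)) \<partial>P) \<le> (\<integral>\<^sup>+y. ennreal (f y) \<partial>\<eta>)"
      using LIMSEQ_le_const[OF T0, of "\<integral>\<^sup>+\<omega>. ennreal (f (\<xi> \<omega>)) \<partial>P"] 1 by auto
    show "(\<integral>\<^sup>+y. ennreal (f y) \<partial>\<eta>) \<le> (\<integral>\<^sup>+\<omega>. ennreal (f (\<xi> \<omega>)) \<partial>P)"
      using LIMSEQ_le_const[OF T0, of "\<integral>\<^sup>+y. ennreal (f y) \<partial>\<eta>"] 2 by auto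
  qed
qed

lemma cutoff_sup:
  fixes U :: "'y set" assumes U: "open U" "U \<noteq> UNIV"
  shows "(SUP k. ennreal (min 1 (real k * infdist x (- U)))) = indicator U x"
proof (rule antisym)
  show "(SUP k. ennreal (min 1 (real k * infdist x (- U)))) \<le> indicator U x"
    by (rule SUP_least) (auto simp: indicator_def)
  show "indicator U x \<le> (SUP k. ennreal (min 1 (real k * infdist x (- U))))"
  proof (cases "x \<in> U")
    case True
    then have "infdist x (- U) > 0"
      using U in_closed_iff_infdist_zero[of "- U" x] infdist_nonneg[of x "- U"] by (auto simp: less_le)
    then obtain k where "1 < real k * infdist x (- U)"
      using reals_Archimedean3[of "infdist x (- U)"] by auto
    then have "ennreal (min 1 (real k * infdist x (- U))) = 1" by simp
    then show ?thesis using True by (auto intro!: SUP_upper2[of k])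
  qed simp
qed

lemma cutoff_incseq:
  fixes U :: "'y set"
  shows "incseq (\<lambda>k x. ennreal (min 1 (real k * infdist x (- U))))"
proof (intro incseq_SucI le_funI ennreal_leI)
  fix k x
  have "real k * infdist x (- U) \<le> real (Suc k) * infdist x (- U)"
    by (intro mult_right_mono) (auto simp: infdist_nonneg)
  then show "min 1 (real k * infdist x (- U)) \<le> min 1 (real (Suc k) * infdist x (- U))"
    by linarith
qed

text \<open>Cutoffs increasing to the indicator of an open set carry the equality from continuous
  functions to open sets, which determine a finite measure.\<close>

lemma distr_\<xi>: "distr P borel \<xi> = \<eta>"
proof (rule measure_eqI_generator_eq[where E = "Collect open" and \<Omega> = UNIV and A = "\<lambda>_. UNIV"])
  fix U :: "'y set" assume "U \<in> Collect open"
  then have U: "open U" by simp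
  show "emeasure (distr P borel \<xi>) U = emeasure \<eta> U"
  proof (cases "U = UNIV")
    case True
    then show ?thesis
      using P.emeasure_space_1 \<eta>.emeasure_space_1 by (simp add: emeasure_distr)
  next
    case False
    let ?f = "\<lambda>k x. min 1 (real k * infdist x (- U))"
    have [measurable]: "?f k \<in> borel_measurable borel" for k
      by (rule borel_measurable_continuous_onI[OF bounded_cutoff(1)])
    have [measurable]: "?f k \<in> borel_measurable \<eta>" for k by (rule borel_\<eta>) simp
    have [measurable]: "U \<in> sets borel" using U by simp
    have inc: "incseq (\<lambda>k \<omega>. ennreal (?f k (\<xi> \<omega>)))"
      using cutoff_incseq[of U] by (auto simp: incseq_def le_fun_def)
    have "emeasure (distr P borel \<xi>) U = (\<integral>\<^sup>+\<omega>. indicator U (\<xi> \<omega>) \<partial>P)"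
      using nn_integral_distr[OF \<xi>_measurable, of "indicator U"] by simp
    also have "\<dots> = (\<integral>\<^sup>+\<omega>. (SUP k. ennreal (?f k (\<xi> \<omega>))) \<partial>P)"
      by (simp add: cutoff_sup U False)
    also have "\<dots> = (SUP k. \<integral>\<^sup>+\<omega>. ennreal (?f k (\<xi> \<omega>)) \<partial>P)"
      using inc by (intro nn_integral_monotone_convergence_SUP) auto
    also have "\<dots> = (SUP k. \<integral>\<^sup>+y. ennreal (?f k y) \<partial>\<eta>)"
      by (subst nn_integral_\<xi>_continuous[OF bounded_cutoff]) (auto simp: infdist_nonneg)
    also have "\<dots> = (\<integral>\<^sup>+y. (SUP k. ennreal (?f k y)) \<partial>\<eta>)"
      using cutoff_incseq by (intro nn_integral_monotone_convergence_SUP[symmetric]) auto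
    also have "\<dots> = emeasure \<eta> U"
      using U by (simp add: cutoff_sup False sets_\<eta>)
    finally show ?thesis .
  qed
next
  show "emeasure (distr P borel \<xi>) UNIV \<noteq> \<infinity>" for i :: nat
    using P.emeasure_space_1 by (simp add: emeasure_distr)
qed (auto simp: Int_stable_def sets_\<eta> borel_def)

lemma nn_integral_\<xi>: "f \<in> borel_measurable borel \<Longrightarrow> (\<integral>\<^sup>+\<omega>. f (\<xi> \<omega>) \<partial>P) = (\<integral>\<^sup>+y. f y \<partial>\<eta>)"
  using nn_integral_distr[OF \<xi>_measurable, of f] unfolding distr_\<xi> by (simp add: borel_\<eta>)

text \<open>Replacing f by h is paid once at the moved point and once at the limit, both of law
  \<eta>; hence the factor 2.\<close>

lemma dev_perturb:
  assumes [measurable]: "f \<in> borel_measurable borel" "h \<in> borel_measurable borel"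
  shows "dev f n \<le> dev h n + 2 * (\<integral>\<^sup>+y. ennreal \<bar>f y - h y\<bar> \<partial>\<eta>)"
proof -
  let ?d = "\<lambda>y. ennreal \<bar>f y - h y\<bar>"
  have d: "?d \<in> borel_measurable borel" by measurable
  note [measurable] = measurable_act_W[OF assms(1)] measurable_act_W[OF assms(2)] measurable_act_W[OF d] measurable_dev[OF assms(2)]
  have mW: "(\<lambda>\<omega>. \<integral>\<^sup>+y. ?d (\<alpha> (W n \<omega>) y) \<partial>\<eta>) \<in> borel_measurable P"
    by (rule borel_measurable_W[of "\<lambda>g. \<integral>\<^sup>+y. ?d (\<alpha> g y) \<partial>\<eta>"])
  have "dev f n \<le> (\<integral>\<^sup>+\<omega>. \<integral>\<^sup>+y. (ennreal \<bar>h (\<alpha> (W n \<omega>) y) - h (\<xi> \<omega>)\<bar> + ?d (\<alpha> (W n \<omega>) y)) + ?d (\<xi> \<omega>) \<partial>\<eta> \<partial>P)"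
    unfolding dev_def
    by (intro nn_integral_mono) (auto simp: ennreal_plus[symmetric] simp del: ennreal_plus intro!: ennreal_leI)
  also have "\<dots> = (\<integral>\<^sup>+\<omega>. ((\<integral>\<^sup>+y. ennreal \<bar>h (\<alpha> (W n \<omega>) y) - h (\<xi> \<omega>)\<bar> \<partial>\<eta>) + (\<integral>\<^sup>+y. ?d (\<alpha> (W n \<omega>) y) \<partial>\<eta>)) + ?d (\<xi> \<omega>) \<partial>P)"
    using \<eta>.emeasure_space_1 by (simp add: nn_integral_add)
  also have "\<dots> = (dev h n + (\<integral>\<^sup>+y. ?d y \<partial>\<eta>)) + (\<integral>\<^sup>+y. ?d y \<partial>\<eta>)"
    unfolding dev_def using mW stat_W[OF d] nn_integral_\<xi>[OF d] by (simp add: nn_integral_add)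
  finally show ?thesis by (simp add: mult_2 add.assoc)
qed

text \<open>The cost of \<open>dev_perturb\<close> is uniform in n, so the functions with vanishing
  deviation are closed under L1 limits.\<close>

lemma dev_limit:
  assumes [measurable]: "f \<in> borel_measurable borel" "\<And>k. h k \<in> borel_measurable borel"
    and h: "\<And>k. dev (h k) \<longlonglongrightarrow> 0" and lim: "(\<lambda>k. \<integral>\<^sup>+y. ennreal \<bar>f y - h k y\<bar> \<partial>\<eta>) \<longlonglongrightarrow> 0"
  shows "dev f \<longlonglongrightarrow> 0"
proof -
  have lim_le: "limsup (dev f) \<le> 2 * (\<integral>\<^sup>+y. ennreal \<bar>f y - h k y\<bar> \<partial>\<eta>)" for k
  proof -
    let ?c = "2 * (\<integral>\<^sup>+y. ennreal \<bar>f y - h k y\<bar> \<partial>\<eta>)"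
    have "limsup (dev f) \<le> limsup (\<lambda>n. dev (h k) n + ?c)"
      by (intro Limsup_mono always_eventually allI dev_perturb) auto
    also have "(\<lambda>n. dev (h k) n + ?c) \<longlonglongrightarrow> 0 + ?c" by (intro tendsto_intros h)
    then have "limsup (\<lambda>n. dev (h k) n + ?c) = ?c" by (intro lim_imp_Limsup) auto
    finally show ?thesis .
  qed
  have "(\<lambda>k. 2 * (\<integral>\<^sup>+y. ennreal \<bar>f y - h k y\<bar> \<partial>\<eta>)) \<longlonglongrightarrow> 2 * 0"
    by (intro ennreal_tendsto_cmult lim) simp
  then have "limsup (dev f) \<le> 0"
    using lim_le LIMSEQ_le_const by fastforce
  moreover have "liminf (dev f) \<le> limsup (dev f)" by (rule Liminf_le_Limsup) simp
  ultimately have "liminf (dev f) = 0" "limsup (dev f) = 0" by auto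
  then show "dev f \<longlonglongrightarrow> 0"
    by (intro Liminf_eq_Limsup) auto
qed

lemma dev_add_le:
  assumes f: "f \<in> borel_measurable borel" and h: "h \<in> borel_measurable borel"
  shows "dev (\<lambda>y. f y + h y) n \<le> dev f n + dev h n"
proof -
  note [measurable] = measurable_act_W[OF f] measurable_act_W[OF h] measurable_dev[OF f] measurable_dev[OF h]
  have "dev (\<lambda>y. f y + h y) n \<le> (\<integral>\<^sup>+\<omega>. \<integral>\<^sup>+y. ennreal \<bar>f (\<alpha> (W n \<omega>) y) - f (\<xi> \<omega>)\<bar> +
      ennreal \<bar>h (\<alpha> (W n \<omega>) y) - h (\<xi> \<omega>)\<bar> \<partial>\<eta> \<partial>P)"
    unfolding dev_def
    by (intro nn_integral_mono) (auto simp: ennreal_plus[symmetric] simp del: ennreal_plus intro!: ennreal_leI)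
  also have "\<dots> = dev f n + dev h n"
    unfolding dev_def by (simp add: nn_integral_add)
  finally show ?thesis .
qed

lemma dev_add:
  assumes "f \<in> borel_measurable borel" "h \<in> borel_measurable borel" "dev f \<longlonglongrightarrow> 0" "dev h \<longlonglongrightarrow> 0"
  shows "dev (\<lambda>y. f y + h y) \<longlonglongrightarrow> 0"
proof -
  have lim: "(\<lambda>n. dev f n + dev h n) \<longlonglongrightarrow> 0"
    using tendsto_add[OF assms(3,4)] by simp
  show ?thesis
    by (rule tendsto_sandwich[OF _ _ tendsto_const lim]) (use dev_add_le assms in auto)
qed

text \<open>Dynkin's argument from the open sets: cutoffs settle these, complements do not change
  the deviation, and partial sums converge in L1 to the indicator of a disjoint union.\<close>

lemma dev_indicator:
  assumes "A \<in> sets borel" shows "dev (indicator A) \<longlonglongrightarrow> 0"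
proof -
  have "Int_stable (Collect open :: 'y set set)" "Collect open \<subseteq> Pow (UNIV :: 'y set)"
    "A \<in> sigma_sets UNIV (Collect open)"
    using assms by (auto simp: borel_def Int_stable_def)
  then show ?thesis
  proof (induction rule: sigma_sets_induct_disjoint)
    case (basic U)
    then have U: "open U" by simp
    show ?case
    proof (cases "U = UNIV")
      case True
      have "dev (indicator U) = (\<lambda>_. 0)" by (auto simp: dev_def True fun_eq_iff)
      then show ?thesis by simp
    next
      case False
      let ?f = "\<lambda>k x. min 1 (real k * infdist x (- U))"
      have [measurable]: "?f k \<in> borel_measurable borel" for k
        by (rule borel_measurable_continuous_onI[OF bounded_cutoff(1)])
      have m1[measurable]: "?f k \<in> borel_measurable \<eta>" for k by (rule borel_\<eta>) simp
      have [measurable]: "U \<in> sets borel" using U by simp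
      have m2[measurable]: "(indicator U :: _ \<Rightarrow> real) \<in> borel_measurable \<eta>" by (rule borel_\<eta>) simp
      show ?thesis
      proof (rule dev_limit[where h = ?f])
        have "(\<lambda>k. \<integral>\<^sup>+y. ennreal \<bar>indicator U y - ?f k y\<bar> \<partial>\<eta>) \<longlonglongrightarrow> (\<integral>\<^sup>+y. 0 \<partial>\<eta>)"
        proof (rule nn_integral_dominated_convergence[where w = "\<lambda>_. 1"])
          show "AE y in \<eta>. ennreal \<bar>indicator U y - ?f k y\<bar> \<le> 1" for k
            by (rule AE_I2) (auto simp: indicator_def infdist_nonneg abs_le_iff min_def intro!: ennreal_leI[of _ 1, simplified])
          show "AE y in \<eta>. (\<lambda>k. ennreal \<bar>indicator U y - ?f k y\<bar>) \<longlonglongrightarrow> 0"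
          proof (rule AE_I2)
            fix y
            have "(\<lambda>k. ennreal (?f k y)) \<longlonglongrightarrow> (SUP k. ennreal (?f k y))"
              using cutoff_incseq[of U] by (intro LIMSEQ_SUP) (auto simp: incseq_def le_fun_def)
            then have "(\<lambda>k. ennreal (?f k y)) \<longlonglongrightarrow> ennreal (indicator U y)"
              by (simp add: cutoff_sup U False ennreal_indicator)
            then have "(\<lambda>k. ?f k y) \<longlonglongrightarrow> indicator U y"
              by (subst (asm) tendsto_ennreal_iff) (auto simp: infdist_nonneg)
            then have "(\<lambda>k. ennreal \<bar>indicator U y - ?f k y\<bar>) \<longlonglongrightarrow> ennreal \<bar>indicator U y - indicator U y\<bar>"
              by (intro tendsto_intros)
            then show "(\<lambda>k. ennreal \<bar>indicator U y - ?f k y\<bar>) \<longlonglongrightarrow> 0" by simp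
          qed
        qed (use \<eta>.emeasure_space_1 in auto)
        then show "(\<lambda>k. \<integral>\<^sup>+y. ennreal \<bar>indicator U y - ?f k y\<bar> \<partial>\<eta>) \<longlonglongrightarrow> 0" by simp
      qed (auto intro: dev_continuous bounded_cutoff)
    qed
  next
    case empty
    have "dev (indicator {}) = (\<lambda>_. 0)" by (auto simp: dev_def fun_eq_iff)
    then show ?case by (simp only: tendsto_const)
  next
    case (compl A)
    have "dev (indicator (UNIV - A)) = dev (indicator A)"
      unfolding dev_def fun_eq_iff by (intro allI nn_integral_cong) (auto simp: indicator_def)
    then show ?case using compl by simp
  next
    case (union A)
    have Ab[measurable]: "A i \<in> sets borel" for i using union by (auto simp: borel_def)
    have Ae: "A i \<in> sets \<eta>" for i by (simp add: sets_\<eta>)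
    let ?h = "\<lambda>k y. \<Sum>i<k. indicator (A i) y :: real"
    have hh: "?h k y = indicator (\<Union>i<k. A i) y" for k y
      using union(1) by (intro indicator_UN_disjoint[symmetric]) (auto simp: disjoint_family_on_def)
    have Th: "dev (?h k) \<longlonglongrightarrow> 0" for k
    proof (induction k)
      case 0
      have "dev (?h 0) = (\<lambda>_. 0)" by (auto simp: dev_def fun_eq_iff)
      then show ?case by simp
    next
      case (Suc k)
      have "dev (\<lambda>y. ?h k y + indicator (A k) y) \<longlonglongrightarrow> 0"
        by (intro dev_add Suc union) measurable
      then show ?case by (simp add: add.commute)
    qed
    show ?case
    proof (rule dev_limit[where h = ?h])
      have m1: "?h k \<in> borel_measurable \<eta>" for k by (rule borel_\<eta>) measurable
      have m2: "(indicator (\<Union>i. A i) :: _ \<Rightarrow> real) \<in> borel_measurable \<eta>" by (rule borel_\<eta>) measurable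
      have "(\<lambda>k. \<integral>\<^sup>+y. ennreal \<bar>indicator (\<Union>i. A i) y - ?h k y\<bar> \<partial>\<eta>) \<longlonglongrightarrow> (\<integral>\<^sup>+y. 0 \<partial>\<eta>)"
      proof (rule nn_integral_dominated_convergence[where w = "\<lambda>_. 1"])
        show "AE y in \<eta>. ennreal \<bar>indicator (\<Union>i. A i) y - ?h k y\<bar> \<le> 1" for k
          unfolding hh by (rule AE_I2) (auto simp: indicator_def)
        show "AE y in \<eta>. (\<lambda>k. ennreal \<bar>indicator (\<Union>i. A i) y - ?h k y\<bar>) \<longlonglongrightarrow> 0"
        proof (rule AE_I2)
          fix y
          have "\<forall>\<^sub>F k in sequentially. ennreal \<bar>indicator (\<Union>i. A i) y - ?h k y\<bar> = 0"
          proof (cases "y \<in> (\<Union>i. A i)")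
            case True
            then obtain i where "y \<in> A i" by auto
            then show ?thesis
              unfolding hh by (intro eventually_sequentiallyI[of "Suc i"]) (auto simp: indicator_def)
          qed (auto simp: hh indicator_def)
          then show "(\<lambda>k. ennreal \<bar>indicator (\<Union>i. A i) y - ?h k y\<bar>) \<longlonglongrightarrow> 0"
            by (rule tendsto_eventually)
        qed
      qed (use \<eta>.emeasure_space_1 m1 m2 in auto)
      then show "(\<lambda>k. \<integral>\<^sup>+y. ennreal \<bar>indicator (\<Union>i. A i) y - ?h k y\<bar> \<partial>\<eta>) \<longlonglongrightarrow> 0" by simp
    qed (use Th in auto)
  qed
qed


lemma dev_cmult:
  assumes f: "f \<in> borel_measurable borel" and "dev f \<longlonglongrightarrow> 0"
  shows "dev (\<lambda>y. c * f y) \<longlonglongrightarrow> 0"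
proof -
  note [measurable] = measurable_act_W[OF f] measurable_dev[OF f]
  have "dev (\<lambda>y. c * f y) = (\<lambda>n. ennreal \<bar>c\<bar> * dev f n)"
    unfolding dev_def fun_eq_iff
    by (simp add: right_diff_distrib[symmetric] abs_mult ennreal_mult nn_integral_cmult)
  moreover have "(\<lambda>n. ennreal \<bar>c\<bar> * dev f n) \<longlonglongrightarrow> ennreal \<bar>c\<bar> * 0"
    by (intro ennreal_tendsto_cmult assms) simp
  ultimately show ?thesis by simp
qed

lemma dev_bounded:
  assumes q[measurable]: "q \<in> borel_measurable borel" and q01: "\<And>y. 0 \<le> q y" "\<And>y. q y \<le> 1"
  shows "dev q \<longlonglongrightarrow> 0"
proof -
  \<comment> \<open>A staircase: it counts the levels i/(k+1) with i \<ge> 1 that q reaches, so it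
    lies within 1/(k+1) of q and is a combination of indicators.\<close>
  define h where "h k y = (1 / real (Suc k)) * (\<Sum>i=1..Suc k. indicator {y. real i \<le> real (Suc k) * q y} y)" for k y
  have dev_sum: "dev (\<lambda>y. \<Sum>i\<in>I. indicator (A i) y) \<longlonglongrightarrow> 0"
    if "finite I" "\<And>i. A i \<in> sets borel" for I :: "nat set" and A
    using that
  proof (induction I rule: finite_induct)
    case empty
    have "dev (\<lambda>y. \<Sum>i\<in>{}. indicator (A i) y) = (\<lambda>_. 0)" by (auto simp: dev_def fun_eq_iff)
    then show ?case by (simp only: tendsto_const)
  next
    case (insert i I)
    then have [measurable]: "A i \<in> sets borel" for i by simp
    have "dev (\<lambda>y. indicator (A i) y + (\<Sum>i\<in>I. indicator (A i) y)) \<longlonglongrightarrow> 0"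
      using insert by (intro dev_add dev_indicator) measurable
    then show ?case using insert by simp
  qed
  have hm[measurable]: "h k \<in> borel_measurable borel" for k
    unfolding h_def by measurable
  have close: "\<bar>q y - h k y\<bar> \<le> 1 / real (Suc k)" for k y
  proof -
    define m where "m = nat \<lfloor>real (Suc k) * q y\<rfloor>"
    have pos: "0 \<le> real (Suc k) * q y" using q01 by simp
    have le: "real (Suc k) * q y \<le> real (Suc k)" using q01(2)[of y] by (simp add: mult_left_le)
    have m: "real m \<le> real (Suc k) * q y" "real (Suc k) * q y < real m + 1"
      using pos by (auto simp: m_def)
    then have mk: "m \<le> Suc k" using le by linarith
    have "{i \<in> {1..Suc k}. real i \<le> real (Suc k) * q y} = {1..m}"
      using m mk by auto
    moreover have "(\<Sum>i=1..Suc k. indicator {y. real i \<le> real (Suc k) * q y} y) =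
        (\<Sum>i\<in>{i \<in> {1..Suc k}. real i \<le> real (Suc k) * q y}. 1 :: real)"
      unfolding sum.inter_filter[OF finite_atLeastAtMost] by (intro sum.cong) (auto simp: indicator_def)
    ultimately have "(\<Sum>i=1..Suc k. indicator {y. real i \<le> real (Suc k) * q y} y) = real m"
      by (simp only: sum_constant) simp
    then have h: "h k y = real m / real (Suc k)" by (simp add: h_def)
    have "q y - h k y = (real (Suc k) * q y - real m) / real (Suc k)"
      by (simp add: h field_simps)
    moreover have "\<bar>real (Suc k) * q y - real m\<bar> \<le> 1" using m by linarith
    ultimately show ?thesis by (simp add: divide_right_mono)
  qed
  show ?thesis
  proof (rule dev_limit[where h = h])
    show "dev (h k) \<longlonglongrightarrow> 0" for k
      unfolding h_def by (intro dev_cmult dev_sum) measurable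
    have lim: "(\<lambda>k. ennreal (1 / real (Suc k))) \<longlonglongrightarrow> 0"
      using tendsto_ennrealI[OF LIMSEQ_inverse_real_of_nat] by (simp add: inverse_eq_divide)
    have "(\<integral>\<^sup>+y. ennreal \<bar>q y - h k y\<bar> \<partial>\<eta>) \<le> ennreal (1 / real (Suc k))" for k
    proof -
      have "(\<integral>\<^sup>+y. ennreal \<bar>q y - h k y\<bar> \<partial>\<eta>) \<le> (\<integral>\<^sup>+y. ennreal (1 / real (Suc k)) \<partial>\<eta>)"
        by (intro nn_integral_mono ennreal_leI close)
      then show ?thesis using \<eta>.emeasure_space_1 by simp
    qed
    then show "(\<lambda>k. \<integral>\<^sup>+y. ennreal \<bar>q y - h k y\<bar> \<partial>\<eta>) \<longlonglongrightarrow> 0"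
      by (intro tendsto_sandwich[OF _ _ tendsto_const lim]) auto
  qed measurable
qed

end

subsection \<open>Two boundaries and their joint law\<close>

locale boundary_pair = A: boundary_action G \<mu> \<phi> \<nu> + B: boundary_action G \<mu> \<psi> \<eta>
  for G :: "('g, 'x) monoid_scheme" (structure) and \<mu>
    and \<phi> :: "'g \<Rightarrow> 'm::metric_space \<Rightarrow> 'm" and \<nu> and \<psi> :: "'g \<Rightarrow> 'b::polish_space \<Rightarrow> 'b" and \<eta>
begin

text \<open>Both limits are taken along the same path, so the coordinates are usually far from
  independent. The \<sigma>-algebra is the product one, as the first factor carries no countability
  assumption in this locale.\<close>

definition joint :: "('m \<times> 'b) measure" where
  "joint = distr A.P (borel \<Otimes>\<^sub>M borel) (\<lambda>\<omega>. (A.\<xi> \<omega>, B.\<xi> \<omega>))"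

definition diag :: "'g \<Rightarrow> 'm \<times> 'b \<Rightarrow> 'm \<times> 'b" where
  "diag g = (\<lambda>(x, b). (\<phi> g x, \<psi> g b))"

lemma sets_joint: "sets joint = sets (borel \<Otimes>\<^sub>M borel)" by (simp add: joint_def)

lemma space_joint [simp]: "space joint = UNIV" by (simp add: joint_def space_pair_measure)

lemma measurable_\<xi>_pair [measurable]: "(\<lambda>\<omega>. (A.\<xi> \<omega>, B.\<xi> \<omega>)) \<in> A.P \<rightarrow>\<^sub>M borel \<Otimes>\<^sub>M borel"
  by measurable

lemma diag_measurable: "g \<in> carrier G \<Longrightarrow> diag g \<in> joint \<rightarrow>\<^sub>M joint"
proof -
  assume g: "g \<in> carrier G"
  note [measurable] = A.measurable_act_borel[OF g] B.measurable_act_borel[OF g]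
  have "diag g \<in> borel \<Otimes>\<^sub>M borel \<rightarrow>\<^sub>M borel \<Otimes>\<^sub>M borel"
    unfolding diag_def by measurable
  then show ?thesis by (simp add: measurable_cong_sets[OF sets_joint sets_joint])
qed

lemma prob_joint: "prob_space joint"
  unfolding joint_def by (rule A.P.prob_space_distr) measurable

text \<open>Along a path both translated measures concentrate at their limits, so the averaged
  translates of the product of \<nu> and \<eta> converge to the joint law. The error
  \<open>t\<close> has mean \<open>A.dev\<close> plus \<open>B.dev\<close> of the two
  indicators.\<close>

lemma joint_Times:
  assumes D: "D \<in> sets borel" and A: "A \<in> sets borel"
  shows "(\<lambda>n. \<integral>\<^sup>+\<omega>. emeasure \<nu> (\<phi> (A.W n \<omega>) -` D) * emeasure \<eta> (\<psi> (A.W n \<omega>) -` A) \<partial>A.P)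
    \<longlonglongrightarrow> emeasure joint (D \<times> A)"
proof -
  note [measurable] = D A
  let ?d = "indicator D :: 'm \<Rightarrow> real" and ?a = "indicator A :: 'b \<Rightarrow> real"
  let ?DW = "\<lambda>\<omega> n. \<phi> (A.W n \<omega>) -` D" and ?AW = "\<lambda>\<omega> n. \<psi> (A.W n \<omega>) -` A"
  let ?c = "\<lambda>n. \<integral>\<^sup>+\<omega>. emeasure \<nu> (?DW \<omega> n) * emeasure \<eta> (?AW \<omega> n) \<partial>A.P"
  have DW[measurable]: "?DW \<omega> n \<in> sets \<nu>" and AW[measurable]: "?AW \<omega> n \<in> sets \<eta>" for \<omega> n
    using A.vimage_act[of "A.W n \<omega>" D] B.vimage_act[of "A.W n \<omega>" A]
    by (auto simp: A.sets_\<eta> B.sets_\<eta>)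
  have dm: "?d \<in> borel_measurable borel" and am: "?a \<in> borel_measurable borel" by simp_all
  define t where "t n \<omega> = (\<integral>\<^sup>+x. ennreal \<bar>?d (\<phi> (A.W n \<omega>) x) - ?d (A.\<xi> \<omega>)\<bar> \<partial>\<nu>) +
      (\<integral>\<^sup>+b. ennreal \<bar>?a (\<psi> (A.W n \<omega>) b) - ?a (B.\<xi> \<omega>)\<bar> \<partial>\<eta>)" for n \<omega>
  have t: "(\<integral>\<^sup>+\<omega>. t n \<omega> \<partial>A.P) = A.dev ?d n + B.dev ?a n" for n
    unfolding t_def A.dev_def B.dev_def
    by (intro nn_integral_add A.measurable_dev B.measurable_dev dm am)
  have t_meas: "t n \<in> borel_measurable A.P" for n
    unfolding t_def by (intro borel_measurable_add A.measurable_dev B.measurable_dev dm am)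
  have prod: "emeasure \<nu> (?DW \<omega> n) * emeasure \<eta> (?AW \<omega> n) =
      (\<integral>\<^sup>+x. \<integral>\<^sup>+b. indicator (?DW \<omega> n) x * indicator (?AW \<omega> n) b \<partial>\<eta> \<partial>\<nu>)" for \<omega> n
    by (simp add: nn_integral_cmult nn_integral_multc)
  have c_meas: "(\<lambda>\<omega>. emeasure \<nu> (?DW \<omega> n) * emeasure \<eta> (?AW \<omega> n)) \<in> borel_measurable A.P" for n
    by (rule A.borel_measurable_W[of "\<lambda>g. emeasure \<nu> (\<phi> g -` D) * emeasure \<eta> (\<psi> g -` A)"])
  let ?j = "\<lambda>\<omega>. indicator D (A.\<xi> \<omega>) * indicator A (B.\<xi> \<omega>) :: ennreal"
  have j: "emeasure joint (D \<times> A) = (\<integral>\<^sup>+\<omega>. ?j \<omega> \<partial>A.P)"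
  proof -
    have "emeasure joint (D \<times> A) = (\<integral>\<^sup>+z. indicator (D \<times> A) z \<partial>joint)"
      by (simp add: sets_joint)
    also have "\<dots> = (\<integral>\<^sup>+\<omega>. indicator (D \<times> A) (A.\<xi> \<omega>, B.\<xi> \<omega>) \<partial>A.P)"
      unfolding joint_def by (rule nn_integral_distr) measurable
    finally show ?thesis by (simp add: indicator_times)
  qed
  have j_meas: "?j \<in> borel_measurable A.P" by measurable
  have add_const: "(\<integral>\<^sup>+x. \<integral>\<^sup>+b. u + (ennreal \<bar>?d (\<phi> (A.W n \<omega>) x) - ?d (A.\<xi> \<omega>)\<bar> + ennreal \<bar>?a (\<psi> (A.W n \<omega>) b) - ?a (B.\<xi> \<omega>)\<bar>) \<partial>\<eta> \<partial>\<nu>)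
      = u + t n \<omega>" for u n \<omega>
    unfolding t_def using A.\<eta>.emeasure_space_1 B.\<eta>.emeasure_space_1
      A.measurable_act_W[OF dm] B.measurable_act_W[OF am]
    by (simp add: nn_integral_add)
  have 1: "?j \<omega> \<le> emeasure \<nu> (?DW \<omega> n) * emeasure \<eta> (?AW \<omega> n) + t n \<omega>" for \<omega> n
  proof -
    note [measurable] = A.measurable_act_W[OF dm] B.measurable_act_W[OF am]
    have "?j \<omega> = (\<integral>\<^sup>+x. \<integral>\<^sup>+b. ?j \<omega> \<partial>\<eta> \<partial>\<nu>)"
      using A.\<eta>.emeasure_space_1 B.\<eta>.emeasure_space_1 by simp
    also have "\<dots> \<le> (\<integral>\<^sup>+x. \<integral>\<^sup>+b. indicator (?DW \<omega> n) x * indicator (?AW \<omega> n) b +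
        (ennreal \<bar>?d (\<phi> (A.W n \<omega>) x) - ?d (A.\<xi> \<omega>)\<bar> + ennreal \<bar>?a (\<psi> (A.W n \<omega>) b) - ?a (B.\<xi> \<omega>)\<bar>) \<partial>\<eta> \<partial>\<nu>)"
      by (intro nn_integral_mono) (auto simp: indicator_def)
    also have "\<dots> = emeasure \<nu> (?DW \<omega> n) * emeasure \<eta> (?AW \<omega> n) + t n \<omega>"
      unfolding prod t_def using A.\<eta>.emeasure_space_1 B.\<eta>.emeasure_space_1
      by (simp add: nn_integral_add nn_integral_cmult nn_integral_multc add.assoc)
    finally show ?thesis .
  qed
  have 2: "emeasure \<nu> (?DW \<omega> n) * emeasure \<eta> (?AW \<omega> n) \<le> ?j \<omega> + t n \<omega>" for \<omega> n
  proof -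
    have "emeasure \<nu> (?DW \<omega> n) * emeasure \<eta> (?AW \<omega> n) \<le> (\<integral>\<^sup>+x. \<integral>\<^sup>+b. ?j \<omega> +
        (ennreal \<bar>?d (\<phi> (A.W n \<omega>) x) - ?d (A.\<xi> \<omega>)\<bar> + ennreal \<bar>?a (\<psi> (A.W n \<omega>) b) - ?a (B.\<xi> \<omega>)\<bar>) \<partial>\<eta> \<partial>\<nu>)"
      unfolding prod by (intro nn_integral_mono) (auto simp: indicator_def)
    then show ?thesis by (simp only: add_const)
  qed
  have t0: "(\<lambda>n. A.dev ?d n + B.dev ?a n) \<longlonglongrightarrow> 0"
    using tendsto_add[OF A.dev_indicator[OF D] B.dev_indicator[OF A]] by simp
  have le1: "emeasure joint (D \<times> A) \<le> ?c n + (A.dev ?d n + B.dev ?a n)" for n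
    unfolding j t[symmetric] using c_meas t_meas 1
    by (subst nn_integral_add[symmetric]) (auto intro!: nn_integral_mono)
  have le2: "?c n \<le> emeasure joint (D \<times> A) + (A.dev ?d n + B.dev ?a n)" for n
    unfolding j t[symmetric] using j_meas t_meas 2
    by (subst nn_integral_add[symmetric]) (auto intro!: nn_integral_mono)
  have fin: "emeasure joint (D \<times> A) \<noteq> \<top>"
    using finite_measure.emeasure_finite[OF prob_space.finite_measure[OF prob_joint]] by simp
  show ?thesis
  proof (rule tendsto_sandwich)
    show "\<forall>\<^sub>F n in sequentially. emeasure joint (D \<times> A) - (A.dev ?d n + B.dev ?a n) \<le> ?c n"
    proof (intro always_eventually allI)
      fix n
      show "emeasure joint (D \<times> A) - (A.dev ?d n + B.dev ?a n) \<le> ?c n"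
        using le1[of n] fin by (simp add: ennreal_minus_le_iff add.commute[of "?c n"])
    qed
    show "\<forall>\<^sub>F n in sequentially. ?c n \<le> emeasure joint (D \<times> A) + (A.dev ?d n + B.dev ?a n)"
      using le2 by (intro always_eventually allI)
    have "(\<lambda>n. emeasure joint (D \<times> A) - (A.dev ?d n + B.dev ?a n)) \<longlonglongrightarrow> emeasure joint (D \<times> A) - 0"
      by (intro tendsto_diff_ennreal tendsto_const t0 fin) simp
    then show "(\<lambda>n. emeasure joint (D \<times> A) - (A.dev ?d n + B.dev ?a n)) \<longlonglongrightarrow> emeasure joint (D \<times> A)" by simp
    show "(\<lambda>n. emeasure joint (D \<times> A) + (A.dev ?d n + B.dev ?a n)) \<longlonglongrightarrow> emeasure joint (D \<times> A)"
      using tendsto_add[OF tendsto_const t0] by simp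
  qed
qed

lemma diag_vimage: "diag g -` (D \<times> A) = (\<phi> g -` D) \<times> (\<psi> g -` A)"
  by (auto simp: diag_def)

text \<open>The averaged products obey an exact recursion when the first increment is split off;
  both sides converge by \<open>joint_Times\<close>.\<close>

lemma joint_stationary_Times:
  assumes D: "D \<in> sets borel" and A: "A \<in> sets borel"
  shows "emeasure joint (D \<times> A) = (\<integral>\<^sup>+g. emeasure joint (diag g -` (D \<times> A)) \<partial>\<mu>)"
proof -
  interpret J: prob_space joint by (rule prob_joint)
  let ?c = "\<lambda>D A n. \<integral>\<^sup>+\<omega>. emeasure \<nu> (\<phi> (A.W n \<omega>) -` D) * emeasure \<eta> (\<psi> (A.W n \<omega>) -` A) \<partial>A.P"
  have step: "?c D A (Suc n) = (\<integral>\<^sup>+g. ?c (\<phi> g -` D) (\<psi> g -` A) n \<partial>\<mu>)" for n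
  proof -
    have "?c D A (Suc n) = (\<integral>\<^sup>+g. \<integral>\<^sup>+\<omega>. emeasure \<nu> (\<phi> (g \<otimes> A.W n \<omega>) -` D) * emeasure \<eta> (\<psi> (g \<otimes> A.W n \<omega>) -` A) \<partial>A.P \<partial>\<mu>)"
      using A.nn_integral_W_Suc[of "\<lambda>g. emeasure \<nu> (\<phi> g -` D) * emeasure \<eta> (\<psi> g -` A)" n] .
    also have "\<dots> = (\<integral>\<^sup>+g. ?c (\<phi> g -` D) (\<psi> g -` A) n \<partial>\<mu>)"
    proof (rule nn_integral_cong_AE, rule AE_pmfI, rule nn_integral_cong)
      fix g \<omega> assume "g \<in> set_pmf \<mu>"
      then have "g \<in> carrier G" using A.set_mu by auto
      then have "\<phi> (g \<otimes> A.W n \<omega>) -` D = \<phi> (A.W n \<omega>) -` (\<phi> g -` D)" "\<psi> (g \<otimes> A.W n \<omega>) -` A = \<psi> (A.W n \<omega>) -` (\<psi> g -` A)"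
        by (auto simp: A.act_mult B.act_mult)
      then show "emeasure \<nu> (\<phi> (g \<otimes> A.W n \<omega>) -` D) * emeasure \<eta> (\<psi> (g \<otimes> A.W n \<omega>) -` A) =
        emeasure \<nu> (\<phi> (A.W n \<omega>) -` (\<phi> g -` D)) * emeasure \<eta> (\<psi> (A.W n \<omega>) -` (\<psi> g -` A))" by simp
    qed
    finally show ?thesis .
  qed
  have "(\<lambda>n. \<integral>\<^sup>+g. ?c (\<phi> g -` D) (\<psi> g -` A) n \<partial>\<mu>) \<longlonglongrightarrow> (\<integral>\<^sup>+g. emeasure joint (diag g -` (D \<times> A)) \<partial>\<mu>)"
  proof (rule nn_integral_dominated_convergence[where w = "\<lambda>_. 1"])
    show "AE g in \<mu>. ?c (\<phi> g -` D) (\<psi> g -` A) n \<le> 1" for n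
    proof (rule AE_I2)
      fix g
      have "?c (\<phi> g -` D) (\<psi> g -` A) n \<le> (\<integral>\<^sup>+\<omega>. 1 * 1 \<partial>A.P)"
        by (intro nn_integral_mono mult_mono A.\<eta>.emeasure_le_1 B.\<eta>.emeasure_le_1) auto
      then show "?c (\<phi> g -` D) (\<psi> g -` A) n \<le> 1" using A.P.emeasure_space_1 by simp
    qed
    show "AE g in \<mu>. (\<lambda>n. ?c (\<phi> g -` D) (\<psi> g -` A) n) \<longlonglongrightarrow> emeasure joint (diag g -` (D \<times> A))"
    proof (rule AE_pmfI)
      fix g assume "g \<in> set_pmf \<mu>"
      then have g: "g \<in> carrier G" using A.set_mu by auto
      show "(\<lambda>n. ?c (\<phi> g -` D) (\<psi> g -` A) n) \<longlonglongrightarrow> emeasure joint (diag g -` (D \<times> A))"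
        unfolding diag_vimage
        using A.vimage_act[OF g, of D] B.vimage_act[OF g, of A] D A
        by (intro joint_Times) (simp_all add: A.sets_\<eta> B.sets_\<eta>)
    qed
  qed (auto simp: measure_pmf.emeasure_space_1)
  moreover have "(\<lambda>n. ?c D A (Suc n)) \<longlonglongrightarrow> emeasure joint (D \<times> A)"
    by (rule LIMSEQ_Suc) (rule joint_Times[OF D A])
  ultimately show ?thesis
    unfolding step using LIMSEQ_unique by blast
qed

text \<open>Rectangles are stable under intersection, so stationarity on them becomes equality of
  \<open>joint\<close> with the mixture of its translates, hence stationarity on every measurable
  set.\<close>

lemma joint_stationary: "stationary_action G \<mu> diag joint"
proof (intro stationary_action.intro stationary_action_axioms.intro A.walk_axioms prob_joint)
  interpret J: prob_space joint by (rule prob_joint)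
  show "space joint = UNIV" by simp
  show "diag g \<in> joint \<rightarrow>\<^sub>M joint" if "g \<in> carrier G" for g by (rule diag_measurable[OF that])
  show "diag (g \<otimes> h) y = diag g (diag h y)" if "g \<in> carrier G" "h \<in> carrier G" for g h y
    using that by (simp add: diag_def A.act_mult B.act_mult split: prod.split)
  show "diag \<one> y = y" for y by (simp add: diag_def split: prod.split)
  define K where "K g = distr joint joint (diag (A.trunc g))" for g
  have K: "K \<in> measure_pmf \<mu> \<rightarrow>\<^sub>M subprob_algebra joint"
  proof -
    have "subprob_space (K g)" for g
      unfolding K_def by (intro prob_space_imp_subprob_space J.prob_space_distr diag_measurable) simp
    then show ?thesis by (auto simp: space_subprob_algebra K_def)
  qed
  have emK: "emeasure (measure_pmf \<mu> \<bind> K) A = (\<integral>\<^sup>+g. emeasure joint (diag g -` A) \<partial>\<mu>)" if A: "A \<in> sets joint" for A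
  proof -
    have "emeasure (measure_pmf \<mu> \<bind> K) A = (\<integral>\<^sup>+g. emeasure (K g) A \<partial>\<mu>)"
      using K A by (intro emeasure_bind) auto
    also have "\<dots> = (\<integral>\<^sup>+g. emeasure joint (diag g -` A) \<partial>\<mu>)"
      using A.set_mu A
      by (intro nn_integral_cong_AE AE_pmfI) (auto simp: K_def emeasure_distr diag_measurable subset_eq)
    finally show ?thesis .
  qed
  have "joint = measure_pmf \<mu> \<bind> K"
  proof (rule measure_eqI_generator_eq[where E = "{a \<times> b | a b. a \<in> sets borel \<and> b \<in> sets borel}" and \<Omega> = UNIV and A = "\<lambda>_. UNIV"])
    fix E assume "E \<in> {a \<times> b | a b. a \<in> sets (borel :: 'm measure) \<and> b \<in> sets (borel :: 'b measure)}"
    then obtain a b where E: "E = a \<times> b" "a \<in> sets borel" "b \<in> sets borel" by auto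
    then have "E \<in> sets joint" by (simp add: sets_joint)
    then show "emeasure joint E = emeasure (measure_pmf \<mu> \<bind> K) E"
      using joint_stationary_Times E by (simp add: emK)
  next
    show "sets (measure_pmf \<mu> \<bind> K) = sigma_sets UNIV {a \<times> b | a b. a \<in> sets (borel :: 'm measure) \<and> b \<in> sets (borel :: 'b measure)}"
      by (subst sets_bind[OF sets_kernel[OF K]]) (simp_all add: sets_joint sets_pair_measure)
    show "range (\<lambda>_::nat. UNIV :: ('m \<times> 'b) set) \<subseteq> {a \<times> b | a b. a \<in> sets (borel :: 'm measure) \<and> b \<in> sets (borel :: 'b measure)}"
    proof -
      have "(UNIV :: 'm set) \<in> sets borel" "(UNIV :: 'b set) \<in> sets borel" by simp_all
      then have "UNIV \<times> UNIV \<in> {a \<times> b | a b. a \<in> sets (borel :: 'm measure) \<and> b \<in> sets (borel :: 'b measure)}"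
        by blast
      then show ?thesis by simp
    qed
    show "Int_stable {a \<times> b | a b. a \<in> sets (borel :: 'm measure) \<and> b \<in> sets (borel :: 'b measure)}"
      by (rule Int_stable_pair_measure_generator)
    show "sets joint = sigma_sets UNIV {a \<times> b | a b. a \<in> sets (borel :: 'm measure) \<and> b \<in> sets (borel :: 'b measure)}"
      by (simp add: sets_joint sets_pair_measure)
    show "emeasure joint UNIV \<noteq> \<infinity>" for i :: nat
      using J.emeasure_finite by simp
  qed simp_all
  then show "emeasure joint A = (\<integral>\<^sup>+g. emeasure joint (diag g -` A) \<partial>\<mu>)" if "A \<in> sets joint" for A
    using emK[OF that] by simp
qed

sublocale J: factor_action G \<mu> diag joint \<phi> \<nu> fst
proof (intro factor_action.intro joint_stationary factor_action_axioms.intro)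
  show "stationary_action G \<mu> \<phi> \<nu>" by (rule A.stationary_action_axioms)
  have "fst \<in> borel \<Otimes>\<^sub>M borel \<rightarrow>\<^sub>M borel" by measurable
  then show m: "fst \<in> joint \<rightarrow>\<^sub>M \<nu>" by (simp add: measurable_cong_sets[OF sets_joint A.sets_\<eta>])
  have "distr joint \<nu> fst = distr A.P \<nu> (fst \<circ> (\<lambda>\<omega>. (A.\<xi> \<omega>, B.\<xi> \<omega>)))"
    unfolding joint_def
    by (rule distr_distr) (use m in \<open>auto simp: joint_def\<close>)
  also have "\<dots> = distr A.P borel A.\<xi>" by (rule distr_cong) (auto simp: A.sets_\<eta>)
  finally show "distr joint \<nu> fst = \<nu>" by (simp add: A.distr_\<xi>)
qed (auto simp: diag_def)

end

section \<open>Equal entropies make the limit in B a function of the limit in M\<close>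

context boundary_pair begin

lemma emeasure_joint: "E \<in> sets (borel \<Otimes>\<^sub>M borel) \<Longrightarrow> emeasure joint E = emeasure A.P {\<omega>. (A.\<xi> \<omega>, B.\<xi> \<omega>) \<in> E}"
  unfolding joint_def by (subst emeasure_distr) (auto simp: vimage_def)

lemma joint_snd: "A \<in> sets borel \<Longrightarrow> emeasure joint (UNIV \<times> A) = emeasure \<eta> A"
  by (subst (2) B.distr_\<xi>[symmetric], subst emeasure_distr)
    (auto simp: emeasure_joint vimage_def)

context
  assumes ent_le: "g \<in> carrier G \<Longrightarrow> J.Y.ent g \<le> A.ent g"
begin

text \<open>q is the density with respect to \<nu> of the M-marginal \<open>N\<close> of the joint
  law restricted to the event E. One q serves all g because, by \<open>density_factor\<close>,
  translating the joint law multiplies it by a function of the M-coordinate alone.\<close>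

lemma conditional_probability:
  assumes A: "A \<in> sets borel"
  obtains q where "q \<in> borel_measurable borel" "\<And>x. 0 \<le> q x" "\<And>x. q x \<le> (1 :: real)"
    and "\<And>g. g \<in> carrier G \<Longrightarrow> emeasure \<eta> (\<psi> g -` A) = (\<integral>\<^sup>+x. ennreal (q (\<phi> g x)) \<partial>\<nu>)"
proof -
  define E :: "('m \<times> 'b) set" where "E = UNIV \<times> A"
  have E[measurable]: "E \<in> sets joint" using A by (simp add: E_def sets_joint)
  have fst_m[measurable]: "fst \<in> joint \<rightarrow>\<^sub>M \<nu>" by (rule J.\<pi>_meas)
  define N where "N = distr (density joint (indicator E)) \<nu> fst"
  have fst_m': "fst \<in> density joint (indicator E) \<rightarrow>\<^sub>M \<nu>" using fst_m by simp
  have N_int: "(\<integral>\<^sup>+x. h x \<partial>N) = (\<integral>\<^sup>+y. indicator E y * h (fst y) \<partial>joint)" if h[measurable]: "h \<in> borel_measurable \<nu>" for h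
  proof -
    have [measurable]: "(\<lambda>y. h (fst y)) \<in> borel_measurable joint" by measurable
    have "(\<integral>\<^sup>+x. h x \<partial>N) = (\<integral>\<^sup>+y. h (fst y) \<partial>density joint (indicator E))"
      unfolding N_def by (rule nn_integral_distr[OF fst_m']) simp
    also have "\<dots> = (\<integral>\<^sup>+y. indicator E y * h (fst y) \<partial>joint)"
      by (rule nn_integral_density) measurable
    finally show ?thesis .
  qed
  have N_le: "ennreal 1 * emeasure N D \<le> emeasure \<nu> D" if D[measurable]: "D \<in> sets \<nu>" for D
  proof -
    have "emeasure N D = (\<integral>\<^sup>+x. indicator D x \<partial>N)" using D by (simp add: N_def)
    also have "\<dots> \<le> (\<integral>\<^sup>+y. indicator D (fst y) \<partial>joint)"
      by (subst N_int) (auto intro!: nn_integral_mono simp: indicator_def)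
    also have "\<dots> = emeasure \<nu> D"
      by (subst J.nn_integral_\<pi>) auto
    finally show ?thesis by simp
  qed
  define r where "r = RN_deriv \<nu> N"
  have "sets N = sets \<nu>" by (simp add: N_def)
  then have RN: "density \<nu> r = N" "AE x in \<nu>. ennreal 1 * r x \<le> 1"
    unfolding r_def using AE_RN_deriv_bound[OF A.\<eta>.finite_measure_axioms _ zero_less_one N_le] by auto
  have r[measurable]: "r \<in> borel_measurable \<nu>" by (simp add: r_def)
  \<comment> \<open>The density is at most 1 only almost everywhere; the minimum with 1 makes the
    bound hold at every point.\<close>
  define q where "q x = enn2real (min 1 (r x))" for x
  have qr: "AE x in \<nu>. ennreal (q x) = r x"
    using RN(2)
  proof eventually_elim
    case (elim x)
    then have "r x \<le> 1" by simp
    then show ?case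
      by (simp add: q_def min_absorb2 less_top[symmetric] top_unique) (metis ennreal_enn2real ennreal_one_less_top order_le_less_trans)
  qed
  have q[measurable]: "q \<in> borel_measurable \<nu>" unfolding q_def by measurable
  show thesis
  proof
    show "q \<in> borel_measurable borel" using q by (simp add: measurable_cong_sets[OF A.sets_\<eta> refl])
    show "0 \<le> q x" for x by (simp add: q_def)
    show "q x \<le> 1" for x
      unfolding q_def using enn2real_mono[of "min 1 (r x)" 1] by simp
    fix g assume g: "g \<in> carrier G"
    have "emeasure \<eta> (\<psi> g -` A) = emeasure joint (UNIV \<times> \<psi> g -` A)"
      using B.vimage_act[OF g, of A] A by (intro joint_snd[symmetric]) (simp add: B.sets_\<eta>)
    also have "UNIV \<times> \<psi> g -` A = diag g -` E" by (auto simp: diag_def E_def)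
    also have "emeasure joint (diag g -` E) = (\<integral>\<^sup>+y. indicator E y * ennreal (A.\<rho> g (fst y)) \<partial>joint)"
      by (rule J.density_factor[OF g ent_le[OF g] E])
    also have "\<dots> = (\<integral>\<^sup>+x. ennreal (A.\<rho> g x) \<partial>N)" by (rule N_int[symmetric]) measurable
    also have "\<dots> = (\<integral>\<^sup>+x. r x * ennreal (A.\<rho> g x) \<partial>\<nu>)"
      unfolding RN(1)[symmetric] by (rule nn_integral_density) measurable
    also have "\<dots> = (\<integral>\<^sup>+x. ennreal (A.\<rho> g x) * ennreal (q x) \<partial>\<nu>)"
      using qr by (intro nn_integral_cong_AE) (auto elim!: eventually_mono simp: mult.commute)
    also have "\<dots> = (\<integral>\<^sup>+x. ennreal (q (\<phi> g x)) \<partial>\<nu>)"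
      by (rule A.nn_integral_act[OF g, symmetric]) measurable
    finally show "emeasure \<eta> (\<psi> g -` A) = (\<integral>\<^sup>+x. ennreal (q (\<phi> g x)) \<partial>\<nu>)" .
  qed
qed

text \<open>At \<open>g = W n \<omega>\<close> one side of the identity tends in mean to the
  indicator of A at the limit in B, the other to q at the limit in M. The latter rests on
  \<open>dev_bounded\<close>, as q is merely measurable. So q at the limit is almost surely 0 or 1,
  and D is the set where it is 1.\<close>

lemma limit_determined:
  assumes A: "A \<in> sets borel"
  obtains D where "D \<in> sets borel" "AE \<omega> in A.P. B.\<xi> \<omega> \<in> A \<longleftrightarrow> A.\<xi> \<omega> \<in> D"
proof -
  obtain q where q[measurable]: "q \<in> borel_measurable borel" and q01: "\<And>x. 0 \<le> q x" "\<And>x. q x \<le> (1 :: real)"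
    and eq: "\<And>g. g \<in> carrier G \<Longrightarrow> emeasure \<eta> (\<psi> g -` A) = (\<integral>\<^sup>+x. ennreal (q (\<phi> g x)) \<partial>\<nu>)"
    by (rule conditional_probability[OF A]) blast
  let ?a = "indicator A :: 'b \<Rightarrow> real"
  have am[measurable]: "?a \<in> borel_measurable borel" using A by simp
  define t where "t n \<omega> = (\<integral>\<^sup>+x. ennreal \<bar>q (\<phi> (A.W n \<omega>) x) - q (A.\<xi> \<omega>)\<bar> \<partial>\<nu>)" for n \<omega>
  define s where "s n \<omega> = (\<integral>\<^sup>+b. ennreal \<bar>?a (\<psi> (A.W n \<omega>) b) - ?a (B.\<xi> \<omega>)\<bar> \<partial>\<eta>)" for n \<omega>
  have pt: "ennreal \<bar>?a (B.\<xi> \<omega>) - q (A.\<xi> \<omega>)\<bar> \<le> t n \<omega> + s n \<omega>" for n \<omega>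
  proof -
    have g: "A.W n \<omega> \<in> carrier G" by simp
    note [measurable] = A.measurable_act_W[OF q] B.measurable_act_W[OF am]
    have iq: "integrable \<nu> (\<lambda>x. q (\<phi> (A.W n \<omega>) x))"
      by (rule A.\<eta>.integrable_const_bound[where B = 1]) (use q01 in auto)
    have ia: "integrable \<eta> (\<lambda>b. ?a (\<psi> (A.W n \<omega>) b))"
    proof (rule B.\<eta>.integrable_const_bound[where B = 1])
      show "(\<lambda>b. ?a (\<psi> (A.W n \<omega>) b)) \<in> borel_measurable \<eta>" by (rule B.measurable_act_W[OF am])
    qed (auto simp: indicator_def)
    have "ennreal (\<integral>x. q (\<phi> (A.W n \<omega>) x) \<partial>\<nu>) = ennreal (\<integral>b. ?a (\<psi> (A.W n \<omega>) b) \<partial>\<eta>)"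
    proof -
      have "ennreal (\<integral>x. q (\<phi> (A.W n \<omega>) x) \<partial>\<nu>) = emeasure \<eta> (\<psi> (A.W n \<omega>) -` A)"
        using nn_integral_eq_integral[OF iq] q01 eq[OF g] by simp
      also have "\<dots> = (\<integral>\<^sup>+b. indicator (\<psi> (A.W n \<omega>) -` A) b \<partial>\<eta>)"
        using B.vimage_act[OF g, of A] A by (simp add: B.sets_\<eta>)
      also have "\<dots> = (\<integral>\<^sup>+b. ennreal (?a (\<psi> (A.W n \<omega>) b)) \<partial>\<eta>)"
        by (intro nn_integral_cong) (simp add: indicator_def)
      also have "\<dots> = ennreal (\<integral>b. ?a (\<psi> (A.W n \<omega>) b) \<partial>\<eta>)"
        by (rule nn_integral_eq_integral[OF ia]) simp
      finally show ?thesis .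
    qed
    then have same: "(\<integral>x. q (\<phi> (A.W n \<omega>) x) \<partial>\<nu>) = (\<integral>b. ?a (\<psi> (A.W n \<omega>) b) \<partial>\<eta>)"
      using q01 by (subst (asm) ennreal_inj) (auto intro!: integral_nonneg_AE)
    define u where "u = (\<integral>x. \<bar>q (\<phi> (A.W n \<omega>) x) - q (A.\<xi> \<omega>)\<bar> \<partial>\<nu>)"
    define v where "v = (\<integral>b. \<bar>?a (\<psi> (A.W n \<omega>) b) - ?a (B.\<xi> \<omega>)\<bar> \<partial>\<eta>)"
    have "\<bar>(\<integral>x. q (\<phi> (A.W n \<omega>) x) \<partial>\<nu>) - q (A.\<xi> \<omega>)\<bar> \<le> u"
      using integral_abs_bound[of \<nu> "\<lambda>x. q (\<phi> (A.W n \<omega>) x) - q (A.\<xi> \<omega>)"] iq A.\<eta>.prob_space by (simp add: u_def)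
    moreover have "\<bar>(\<integral>b. ?a (\<psi> (A.W n \<omega>) b) \<partial>\<eta>) - ?a (B.\<xi> \<omega>)\<bar> \<le> v"
      using integral_abs_bound[of \<eta> "\<lambda>b. ?a (\<psi> (A.W n \<omega>) b) - ?a (B.\<xi> \<omega>)"] ia B.\<eta>.prob_space by (simp add: v_def)
    ultimately have "\<bar>?a (B.\<xi> \<omega>) - q (A.\<xi> \<omega>)\<bar> \<le> u + v" using same by linarith
    then have "ennreal \<bar>?a (B.\<xi> \<omega>) - q (A.\<xi> \<omega>)\<bar> \<le> ennreal (u + v)" by (rule ennreal_leI)
    also have "\<dots> = ennreal u + ennreal v" by (rule ennreal_plus) (auto simp: u_def v_def)
    also have "ennreal u = t n \<omega>"
      unfolding u_def t_def by (rule nn_integral_eq_integral[symmetric]) (use iq in auto)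
    also have "ennreal v = s n \<omega>"
      unfolding v_def s_def by (rule nn_integral_eq_integral[symmetric]) (use ia in auto)
    finally show ?thesis .
  qed
  have le: "(\<integral>\<^sup>+\<omega>. ennreal \<bar>?a (B.\<xi> \<omega>) - q (A.\<xi> \<omega>)\<bar> \<partial>A.P) \<le> A.dev q n + B.dev ?a n" for n
  proof -
    have "(\<integral>\<^sup>+\<omega>. ennreal \<bar>?a (B.\<xi> \<omega>) - q (A.\<xi> \<omega>)\<bar> \<partial>A.P) \<le> (\<integral>\<^sup>+\<omega>. t n \<omega> + s n \<omega> \<partial>A.P)"
      by (intro nn_integral_mono pt)
    also have "\<dots> = A.dev q n + B.dev ?a n"
      unfolding A.dev_def B.dev_def t_def s_def
      by (intro nn_integral_add A.measurable_dev B.measurable_dev q am)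
    finally show ?thesis .
  qed
  have "(\<lambda>n. A.dev q n + B.dev ?a n) \<longlonglongrightarrow> 0"
    using tendsto_add[OF A.dev_bounded[OF q q01] B.dev_indicator[OF A]] by simp
  then have "(\<integral>\<^sup>+\<omega>. ennreal \<bar>?a (B.\<xi> \<omega>) - q (A.\<xi> \<omega>)\<bar> \<partial>A.P) \<le> 0"
    by (rule LIMSEQ_le_const) (use le in auto)
  moreover have "(\<lambda>\<omega>. ennreal \<bar>?a (B.\<xi> \<omega>) - q (A.\<xi> \<omega>)\<bar>) \<in> borel_measurable A.P" by measurable
  ultimately have "AE \<omega> in A.P. ennreal \<bar>?a (B.\<xi> \<omega>) - q (A.\<xi> \<omega>)\<bar> = 0"
    using nn_integral_0_iff_AE by fastforce
  then have "AE \<omega> in A.P. B.\<xi> \<omega> \<in> A \<longleftrightarrow> A.\<xi> \<omega> \<in> {x. q x = 1}"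
    by eventually_elim (auto simp: indicator_def split: if_splits)
  moreover have "{x. q x = 1} \<in> sets borel"
  proof -
    have "{x\<in>space borel. q x = 1} \<in> sets borel" by measurable
    then show ?thesis by simp
  qed
  ultimately show thesis using that by blast
qed

text \<open>Membership of the limit in each ball of a countable family is decided by a set
  \<open>D n j\<close> of M-limits. Choosing the first centre whose ball is hit gives approximations
  \<open>h n\<close> within \<open>e n\<close>, which converge because the target is
  complete.\<close>

lemma limit_map: "\<exists>f. f \<in> borel \<rightarrow>\<^sub>M borel \<and> (AE \<omega> in A.P. B.\<xi> \<omega> = f (A.\<xi> \<omega>))"
proof -
  obtain C :: "'b set" where C: "countable C" "\<And>U. open U \<Longrightarrow> U \<noteq> {} \<Longrightarrow> \<exists>d\<in>C. d \<in> U"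
    by (rule countable_dense_exists[THEN exE]) blast
  have "C \<noteq> {}" using C(2)[of UNIV] by auto
  define p where "p = from_nat_into C"
  have p: "\<exists>j. dist (p j) b < e" if "e > 0" for b e
  proof -
    have "ball b e \<noteq> {}" using that by simp
    then obtain d where "d \<in> C" "d \<in> ball b e" using C(2)[of "ball b e"] by blast
    then show ?thesis using from_nat_into_surj[OF C(1), of d] by (auto simp: p_def dist_commute)
  qed
  define e where "e n = inverse (real (Suc n))" for n
  have e: "e n > 0" for n by (simp add: e_def)
  define R where "R n j D \<longleftrightarrow> D \<in> sets borel \<and> (AE \<omega> in A.P. B.\<xi> \<omega> \<in> ball (p j) (e n) \<longleftrightarrow> A.\<xi> \<omega> \<in> D)" for n j D
  define D where "D n j = (SOME D. R n j D)" for n j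
  have R: "R n j (D n j)" for n j
  proof -
    have "ball (p j) (e n) \<in> sets borel" by simp
    then obtain D' where "D' \<in> sets borel" "AE \<omega> in A.P. B.\<xi> \<omega> \<in> ball (p j) (e n) \<longleftrightarrow> A.\<xi> \<omega> \<in> D'"
      by (rule limit_determined)
    then have "R n j D'" by (simp add: R_def)
    then show ?thesis unfolding D_def by (rule someI)
  qed
  have D[measurable]: "D n j \<in> sets borel" for n j using R[of n j] by (simp add: R_def)
  have D_AE: "AE \<omega> in A.P. B.\<xi> \<omega> \<in> ball (p j) (e n) \<longleftrightarrow> A.\<xi> \<omega> \<in> D n j" for n j
    using R[of n j] by (simp add: R_def)
  define h where "h n x = p (LEAST j. x \<in> D n j)" for n x
  have h[measurable]: "h n \<in> borel \<rightarrow>\<^sub>M borel" for n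
  proof -
    have "(\<lambda>x. LEAST j. x \<in> D n j) \<in> borel \<rightarrow>\<^sub>M count_space UNIV" by measurable
    from measurable_compose[OF this, of p borel] show ?thesis by (simp add: h_def[abs_def])
  qed
  have close: "AE \<omega> in A.P. \<forall>n. dist (h n (A.\<xi> \<omega>)) (B.\<xi> \<omega>) < e n"
  proof -
    have "AE \<omega> in A.P. \<forall>n j. B.\<xi> \<omega> \<in> ball (p j) (e n) \<longleftrightarrow> A.\<xi> \<omega> \<in> D n j"
      using D_AE by (simp add: AE_all_countable)
    then show ?thesis
    proof eventually_elim
      case (elim \<omega>)
      show ?case
      proof
        fix n
        obtain j where "dist (p j) (B.\<xi> \<omega>) < e n" using p[OF e] by blast
        then have "A.\<xi> \<omega> \<in> D n j" using elim by auto
        then have "A.\<xi> \<omega> \<in> D n (LEAST j. A.\<xi> \<omega> \<in> D n j)" by (rule LeastI)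
        then show "dist (h n (A.\<xi> \<omega>)) (B.\<xi> \<omega>) < e n" using elim by (auto simp: h_def)
      qed
    qed
  qed
  have e0: "e \<longlonglongrightarrow> 0" unfolding e_def using LIMSEQ_inverse_real_of_nat .
  have lim: "AE \<omega> in A.P. (\<lambda>n. h n (A.\<xi> \<omega>)) \<longlonglongrightarrow> B.\<xi> \<omega>"
    using close
  proof eventually_elim
    case (elim \<omega>)
    have "(\<lambda>n. dist (h n (A.\<xi> \<omega>)) (B.\<xi> \<omega>)) \<longlonglongrightarrow> 0"
      by (rule tendsto_sandwich[OF _ _ tendsto_const e0]) (use elim in \<open>auto intro!: always_eventually less_imp_le\<close>)
    then show ?case by (rule tendsto_dist_iff[THEN iffD2])
  qed
  \<comment> \<open>Off a null set of limits the approximations need not converge. E is the Borel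
    set on which they are Cauchy, and f takes the default value \<open>p 0\<close>
    elsewhere.\<close>
  define E where "E = {x. \<forall>k. \<exists>N. \<forall>m\<ge>N. \<forall>n\<ge>N. dist (h m x) (h n x) < e k}"
  have E[measurable]: "E \<in> sets borel"
  proof -
    have "{x\<in>space borel. \<forall>k. \<exists>N. \<forall>m\<ge>N. \<forall>n\<ge>N. dist (h m x) (h n x) < e k} \<in> sets borel" by measurable
    then show ?thesis by (simp add: E_def)
  qed
  have E_Cauchy: "x \<in> E \<longleftrightarrow> Cauchy (\<lambda>n. h n x)" for x
  proof
    assume x: "x \<in> E"
    show "Cauchy (\<lambda>n. h n x)"
    proof (rule metric_CauchyI)
      fix \<epsilon> :: real assume "\<epsilon> > 0"
      then obtain k where k: "e k < \<epsilon>" unfolding e_def using reals_Archimedean by blast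
      obtain N where "\<forall>m\<ge>N. \<forall>n\<ge>N. dist (h m x) (h n x) < e k"
        using x unfolding E_def by blast
      with k show "\<exists>M. \<forall>m\<ge>M. \<forall>n\<ge>M. dist (h m x) (h n x) < \<epsilon>" by (meson less_trans)
    qed
  next
    assume c: "Cauchy (\<lambda>n. h n x)"
    show "x \<in> E" unfolding E_def using metric_CauchyD[OF c e] by blast
  qed
  define f where "f x = (if x \<in> E then lim (\<lambda>n. h n x) else p 0)" for x
  have f: "f \<in> borel \<rightarrow>\<^sub>M borel"
  proof (rule borel_measurable_LIMSEQ_metric)
    show "(\<lambda>x. if x \<in> E then h n x else p 0) \<in> borel \<rightarrow>\<^sub>M borel" for n by measurable
    fix x :: 'm
    show "(\<lambda>n. if x \<in> E then h n x else p 0) \<longlonglongrightarrow> f x"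
      using E_Cauchy[of x] by (auto simp: f_def Cauchy_convergent_iff convergent_LIMSEQ_iff)
  qed
  moreover have "AE \<omega> in A.P. B.\<xi> \<omega> = f (A.\<xi> \<omega>)"
    using lim
  proof eventually_elim
    case (elim \<omega>)
    then have "A.\<xi> \<omega> \<in> E" by (simp add: E_Cauchy LIMSEQ_imp_Cauchy)
    then show ?case using limI[OF elim] by (simp add: f_def)
  qed
  ultimately show ?thesis by blast
qed

text \<open>The joint law lives on the graph of f. The diagonal action preserves null sets, so
  almost every point and its translate by g are both on the graph, which is equivariance.\<close>

lemma boundary_ge_of_entropy: "boundary_ge G \<phi> \<nu> \<psi> \<eta>"
proof -
  obtain f where f[measurable]: "f \<in> borel \<rightarrow>\<^sub>M borel" and f_AE: "AE \<omega> in A.P. B.\<xi> \<omega> = f (A.\<xi> \<omega>)"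
    using limit_map by blast
  have graph: "AE y in joint. snd y = f (fst y)"
  proof -
    have [measurable]: "{y \<in> space (borel \<Otimes>\<^sub>M borel). snd y = f (fst y)} \<in> sets (borel \<Otimes>\<^sub>M borel)"
    proof -
      have "{y \<in> space (borel \<Otimes>\<^sub>M borel). dist (snd y) (f (fst y)) = 0} \<in> sets (borel \<Otimes>\<^sub>M borel)" by measurable
      then show ?thesis by simp
    qed
    show ?thesis
      unfolding joint_def by (subst AE_distr_iff) (use f_AE in auto)
  qed
  have "AE x in \<nu>. f (\<phi> g x) = \<psi> g (f x)" if g: "g \<in> carrier G" for g
  proof -
    note [measurable] = A.measurable_act_borel[OF g] B.measurable_act_borel[OF g]
    have "{x \<in> space borel. dist (f (\<phi> g x)) (\<psi> g (f x)) = 0} \<in> sets borel" by measurable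
    then have m: "{x \<in> space \<nu>. f (\<phi> g x) = \<psi> g (f x)} \<in> sets \<nu>" by (simp add: A.sets_\<eta>)
    have "AE y in joint. f (\<phi> g (fst y)) = \<psi> g (f (fst y))"
      using graph J.Y.AE_act[OF g graph]
      by eventually_elim (auto simp: diag_def split: prod.splits)
    then have "AE x in distr joint \<nu> fst. f (\<phi> g x) = \<psi> g (f x)"
      by (subst AE_distr_iff[OF J.\<pi>_meas m]) 
    then show ?thesis unfolding J.\<pi>_distr .
  qed
  moreover have "distr \<nu> borel f = \<eta>"
  proof -
    have "distr \<nu> borel f = distr A.P borel (f \<circ> A.\<xi>)"
      by (subst A.distr_\<xi>[symmetric]) (rule distr_distr, auto)
    also have "\<dots> = distr A.P borel B.\<xi>"
      by (rule distr_cong_AE) (use f_AE in auto)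
    finally show ?thesis by (simp add: B.distr_\<xi>)
  qed
  ultimately show ?thesis unfolding boundary_ge_def using f by blast
qed

end
end

subsection \<open>Convergence groups\<close>

text \<open>Keep the times at which a value is visited for the first time.\<close>

lemma infinite_range_subseq:
  fixes w :: "nat \<Rightarrow> 'a"
  assumes "infinite (range w)"
  obtains r :: "nat \<Rightarrow> nat" where "strict_mono r" "inj (w \<circ> r)"
proof -
  define A where "A = {n. \<forall>m<n. w m \<noteq> w n}"
  have inj: "inj_on w A"
  proof (rule inj_onI)
    fix m n assume "m \<in> A" "n \<in> A" "w m = w n"
    then show "m = n" by (cases m n rule: linorder_cases) (auto simp: A_def)
  qed
  have "range w \<subseteq> w ` A"
  proof
    fix y assume "y \<in> range w"
    then obtain n where "w n = y" by auto
    define m where "m = (LEAST m. w m = y)"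
    have "w m = y" unfolding m_def using \<open>w n = y\<close> by (rule LeastI)
    moreover have "m \<in> A" using \<open>w m = y\<close> not_less_Least unfolding A_def m_def by fastforce
    ultimately show "y \<in> w ` A" by blast
  qed
  then have "infinite A" using assms finite_imageI finite_subset by blast
  then have e: "strict_mono (enumerate A)" "\<And>n. enumerate A n \<in> A"
    by (auto intro: strict_mono_enumerate enumerate_in_set)
  have "inj (w \<circ> enumerate A)"
    by (rule comp_inj_on[OF strict_mono_imp_inj_on[OF e(1)] inj_on_subset[OF inj]]) (use e(2) in auto)
  with e(1) that show thesis by blast
qed

context stationary_action begin

text \<open>The Poisson transform of a bounded function: its mean value property is stationarity of
  \<eta>, so along the walk it is a bounded martingale.\<close>

lemma harmonic_integral:
  assumes f: "f \<in> borel_measurable \<eta>" and nn: "\<And>x. 0 \<le> f x" and le: "\<And>x. f x \<le> K"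
  shows "harmonic (\<lambda>g. \<integral>y. f (\<alpha> g y) \<partial>\<eta>)" and "\<And>g. 0 \<le> (\<integral>y. f (\<alpha> g y) \<partial>\<eta>)"
    and "\<And>g. (\<integral>y. f (\<alpha> g y) \<partial>\<eta>) \<le> K"
proof -
  show "0 \<le> (\<integral>y. f (\<alpha> g y) \<partial>\<eta>)" for g by (simp add: nn)
  have K: "0 \<le> K" using nn le order_trans by blast
  \<comment> \<open>For g outside the carrier the integrand may fail to be integrable; its integral
    is then 0 by convention.\<close>
  show "(\<integral>y. f (\<alpha> g y) \<partial>\<eta>) \<le> K" for g
  proof (cases "integrable \<eta> (\<lambda>y. f (\<alpha> g y))")
    case True
    then have "(\<integral>y. f (\<alpha> g y) \<partial>\<eta>) \<le> (\<integral>y. K \<partial>\<eta>)" by (intro integral_mono le) auto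
    then show ?thesis using \<eta>.prob_space by simp
  qed (simp add: not_integrable_integral_eq K)
  have eq: "ennreal (\<integral>y. f (\<alpha> g y) \<partial>\<eta>) = (\<integral>\<^sup>+y. ennreal (f (\<alpha> g y)) \<partial>\<eta>)" if g: "g \<in> carrier G" for g
  proof (rule nn_integral_eq_integral[symmetric])
    have "(\<lambda>y. f (\<alpha> g y)) \<in> borel_measurable \<eta>" using f meas[OF g] by measurable
    then show "integrable \<eta> (\<lambda>y. f (\<alpha> g y))"
      by (intro \<eta>.integrable_const_bound[where B = K]) (auto simp: nn le)
  qed (simp add: nn)
  show "harmonic (\<lambda>g. \<integral>y. f (\<alpha> g y) \<partial>\<eta>)"
    unfolding harmonic_def
  proof
    fix g assume g: "g \<in> carrier G"
    have m: "(\<lambda>y. ennreal (f (\<alpha> g y))) \<in> borel_measurable \<eta>" using f meas[OF g] by measurable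
    have "ennreal (\<integral>y. f (\<alpha> g y) \<partial>\<eta>) = (\<integral>\<^sup>+h. \<integral>\<^sup>+y. ennreal (f (\<alpha> g (\<alpha> h y))) \<partial>\<eta> \<partial>\<mu>)"
      unfolding eq[OF g] by (rule stat_nn_integral_\<mu>[OF m])
    also have "\<dots> = (\<integral>\<^sup>+h. ennreal (\<integral>y. f (\<alpha> (g \<otimes> h) y) \<partial>\<eta>) \<partial>\<mu>)"
    proof (intro nn_integral_cong_AE AE_pmfI)
      fix h assume "h \<in> set_pmf \<mu>"
      then have h: "h \<in> carrier G" using set_mu by auto
      have "(\<integral>\<^sup>+y. ennreal (f (\<alpha> g (\<alpha> h y))) \<partial>\<eta>) = (\<integral>\<^sup>+y. ennreal (f (\<alpha> (g \<otimes> h) y)) \<partial>\<eta>)"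
        by (simp add: act_mult[OF g h])
      also have "\<dots> = ennreal (\<integral>y. f (\<alpha> (g \<otimes> h) y) \<partial>\<eta>)"
        using g h by (intro eq[symmetric]) simp
      finally show "(\<integral>\<^sup>+y. ennreal (f (\<alpha> g (\<alpha> h y))) \<partial>\<eta>) = ennreal (\<integral>y. f (\<alpha> (g \<otimes> h) y) \<partial>\<eta>)" .
    qed
    finally show "ennreal (\<integral>y. f (\<alpha> g y) \<partial>\<eta>) = (\<integral>\<^sup>+h. ennreal (\<integral>y. f (\<alpha> (g \<otimes> h) y) \<partial>\<eta>) \<partial>\<mu>)" .
  qed
qed

end

section \<open>Stationary measures of a convergence action\<close>

locale convergence_walk = stationary_action G \<mu> \<phi> \<nu>
  for G :: "('g, 'x) monoid_scheme" (structure) and \<mu> and \<phi> :: "'g \<Rightarrow> 'm :: metric_space \<Rightarrow> 'm" and \<nu> +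
  assumes compact_space: "compact (UNIV :: 'm set)" and infinite_group: "infinite (carrier G)"
    and convergence: "convergence_group G \<phi>" and non_elementary: "non_elementary G \<phi>"
    and minimal: "minimal_action G \<phi>" and sets_\<nu>: "sets \<nu> = sets borel"
begin

lemma inj_\<phi>: "g \<in> carrier G \<Longrightarrow> inj (\<phi> g)"
  by (rule inj_on_inverseI[where g = "\<phi> (inv g)"]) (rule act_inv)

lemma \<phi>_vimage: assumes "g \<in> carrier G" shows "\<phi> g ` A = \<phi> (inv g) -` A"
proof (intro equalityI subsetI)
  fix x assume "x \<in> \<phi> (inv g) -` A"
  then have "\<phi> g (\<phi> (inv g) x) \<in> \<phi> g ` A" by blast
  then show "x \<in> \<phi> g ` A" by (simp add: act_inv(2)[OF assms])
qed (auto simp: act_inv(1)[OF assms])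

lemma \<phi>_Compl: "g \<in> carrier G \<Longrightarrow> \<phi> g ` (- A) = - \<phi> g ` A"
  by (auto simp: \<phi>_vimage)

lemma image_mult: "g \<in> carrier G \<Longrightarrow> h \<in> carrier G \<Longrightarrow> \<phi> (g \<otimes> h) ` A = \<phi> g ` \<phi> h ` A"
  unfolding image_image by (intro image_cong refl act_mult)

lemma continuous_\<phi>: "g \<in> carrier G \<Longrightarrow> continuous_on UNIV (\<phi> g)"
proof -
  assume g: "g \<in> carrier G"
  have "homeomorphism UNIV UNIV (\<phi> g) (\<phi> (inv g))"
    using convergence g unfolding convergence_group_def by simp
  then show ?thesis by (simp add: homeomorphism_def)
qed

lemma open_image: "g \<in> carrier G \<Longrightarrow> open U \<Longrightarrow> open (\<phi> g ` U)"
  by (simp add: \<phi>_vimage open_vimage continuous_\<phi>)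

lemma dynamics:
  fixes s :: "nat \<Rightarrow> 'g"
  assumes "inj s" "range s \<subseteq> carrier G"
  obtains r a b where "strict_mono (r :: nat \<Rightarrow> nat)"
    and "\<And>K U. compact K \<Longrightarrow> a \<notin> K \<Longrightarrow> open U \<Longrightarrow> b \<in> U \<Longrightarrow> \<forall>\<^sub>F k in sequentially. \<phi> (s (r k)) ` K \<subseteq> U"
proof -
  obtain r a b where r: "strict_mono (r :: nat \<Rightarrow> nat)"
    and *: "\<And>K U. compact K \<Longrightarrow> K \<subseteq> UNIV - {a} \<Longrightarrow> open U \<Longrightarrow> b \<in> U \<Longrightarrow> \<exists>N. \<forall>k. r k > N \<longrightarrow> \<phi> (s (r k)) ` K \<subseteq> U"
  proof -
    have *: "\<forall>s::nat \<Rightarrow> 'g. inj s \<and> range s \<subseteq> carrier G \<longrightarrow>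
        (\<exists>r a b. strict_mono (r::nat \<Rightarrow> nat) \<and>
           (\<forall>K U. compact K \<and> K \<subseteq> UNIV - {a} \<and> open U \<and> b \<in> U \<longrightarrow>
              (\<exists>N. \<forall>k. r k > N \<longrightarrow> \<phi> (s (r k)) ` K \<subseteq> U)))"
      using convergence unfolding convergence_group_def by (elim conjE)
    from *[rule_format, OF conjI[OF assms]] obtain r :: "nat \<Rightarrow> nat" and a b where
      "strict_mono r \<and> (\<forall>K U. compact K \<and> K \<subseteq> UNIV - {a} \<and> open U \<and> b \<in> U \<longrightarrow>
              (\<exists>N. \<forall>k. r k > N \<longrightarrow> \<phi> (s (r k)) ` K \<subseteq> U))" by (elim exE)
    then show thesis by (intro that[of r a b]) simp_all
  qed
  show thesis
  proof (rule that[OF r])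
    fix K U assume "compact K" "a \<notin> K" "open U" "b \<in> U"
    then obtain N where N: "\<And>k. r k > N \<Longrightarrow> \<phi> (s (r k)) ` K \<subseteq> U" using *[of K U] by blast
    \<comment> \<open>The definition counts with the index \<open>r k\<close>; as
      \<open>r k \<ge> k\<close>, large k suffice.\<close>
    have "r k > N" if "k \<ge> Suc N" for k
      using seq_suble[OF r, of k] that by simp
    then show "\<forall>\<^sub>F k in sequentially. \<phi> (s (r k)) ` K \<subseteq> U"
      by (intro eventually_sequentiallyI[of "Suc N"] N)
  qed
qed

lemma infinite_sequence:
  assumes "infinite (F :: 'g set)"
  obtains s :: "nat \<Rightarrow> 'g" where "inj s" "range s \<subseteq> F"
proof -
  from infinite_countable_subset[OF assms] obtain s :: "nat \<Rightarrow> 'g" where "inj s \<and> range s \<subseteq> F" ..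
  then show thesis using that by blast
qed

text \<open>In a finite space points are open and \<open>UNIV - {a}\<close> is compact, so some
  group element maps it injectively into \<open>{b}\<close>. Then M has at most two points and is
  itself a forbidden invariant set.\<close>

lemma infinite_space: "infinite (UNIV :: 'm set)"
proof
  assume fin: "finite (UNIV :: 'm set)"
  obtain s :: "nat \<Rightarrow> 'g" where s: "inj s" "range s \<subseteq> carrier G"
    by (rule infinite_sequence[OF infinite_group])
  obtain r a b where r: "strict_mono (r :: nat \<Rightarrow> nat)"
    and d: "\<And>K U. compact K \<Longrightarrow> a \<notin> K \<Longrightarrow> open U \<Longrightarrow> b \<in> U \<Longrightarrow> \<forall>\<^sub>F k in sequentially. \<phi> (s (r k)) ` K \<subseteq> U"
    by (rule dynamics[OF s]) blast
  have "compact (UNIV - {a})" by (rule finite_imp_compact) (rule finite_subset[OF subset_UNIV fin])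
  moreover have "closed (- {b})" by (rule finite_imp_closed) (rule finite_subset[OF subset_UNIV fin])
  then have "open {b}" by (simp add: open_closed)
  ultimately obtain k where k: "\<phi> (s (r k)) ` (UNIV - {a}) \<subseteq> {b}"
    using d[of "UNIV - {a}" "{b}"] by (auto simp: eventually_sequentially)
  have "card (UNIV - {a}) = card (\<phi> (s (r k)) ` (UNIV - {a}))"
    using inj_\<phi>[of "s (r k)"] s(2) by (intro card_image[symmetric]) (auto simp: inj_on_def)
  also have "\<dots> \<le> 1" using card_mono[OF _ k] by simp
  finally have "card (UNIV :: 'm set) \<le> 2" using fin by (simp add: card_Diff_singleton)
  moreover have "card (UNIV :: 'm set) > 0" using fin by (simp add: card_gt_0_iff)
  ultimately have "card (UNIV :: 'm set) = 1 \<or> card (UNIV :: 'm set) = 2" by linarith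
  moreover have "invariant_set G \<phi> UNIV" by (simp add: invariant_set_def)
  ultimately show False using non_elementary unfolding non_elementary_def by blast
qed

lemma singleton_\<nu>: "{x} \<in> sets \<nu>" by (simp add: sets_\<nu>)

text \<open>The points of maximal mass would form a finite invariant set.\<close>

lemma nonatomic: "measure \<nu> {x} = 0"
proof (rule ccontr)
  assume "measure \<nu> {x} \<noteq> 0"
  then have pos: "measure \<nu> {x} > 0" by (simp add: zero_less_measure_iff)
  define A where "A = {y. measure \<nu> {x} \<le> measure \<nu> {y}}"
  have "finite A"
  proof (rule ccontr)
    assume inf: "infinite A"
    obtain n :: nat where n: "1 < real n * measure \<nu> {x}" using reals_Archimedean3[OF pos] by blast
    obtain F where F: "F \<subseteq> A" "finite F" "card F = n" using infinite_arbitrarily_large[OF inf] by blast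
    have "real n * measure \<nu> {x} = (\<Sum>y\<in>F. measure \<nu> {x})" using F by simp
    also have "\<dots> \<le> (\<Sum>y\<in>F. measure \<nu> {y})" using F by (intro sum_mono) (auto simp: A_def)
    also have "\<dots> = measure \<nu> F"
      using F singleton_\<nu> by (intro \<eta>.finite_measure_eq_sum_singleton[symmetric]) auto
    finally show False using n \<eta>.prob_le_1[of F] by linarith
  qed
  define m where "m = Max ((\<lambda>y. measure \<nu> {y}) ` A)"
  have xA: "x \<in> A" by (simp add: A_def)
  have le_m: "measure \<nu> {y} \<le> m" for y
  proof (cases "y \<in> A")
    case True then show ?thesis using \<open>finite A\<close> by (simp add: m_def)
  next
    case False
    then have "measure \<nu> {y} \<le> measure \<nu> {x}" by (simp add: A_def)
    also have "\<dots> \<le> m" using \<open>finite A\<close> xA by (simp add: m_def)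
    finally show ?thesis .
  qed
  have "m \<in> (\<lambda>y. measure \<nu> {y}) ` A" unfolding m_def using \<open>finite A\<close> xA by (intro Max_in) auto
  then obtain z where z: "measure \<nu> {z} = m" by auto
  define F where "F = {y. measure \<nu> {y} = m}"
  have "F \<subseteq> A" using le_m[of x] by (auto simp: F_def A_def)
  then have "finite F" using \<open>finite A\<close> finite_subset by blast
  have m0: "0 \<le> m" using z by (metis measure_nonneg)
  have inv: "\<phi> (inv g) y \<in> F" if g: "g \<in> carrier G" and y: "y \<in> F" for g y
  proof -
    obtain n where n: "g \<in> set_pmf (step n)" using carrier_step[OF g] by blast
    have e: "emeasure \<nu> (\<phi> h -` {y}) = ennreal (measure \<nu> {\<phi> (inv h) y})" if "h \<in> carrier G" for h
    proof -
      have "\<phi> h -` {y} = {\<phi> (inv h) y}" using act_inv[OF that] by auto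
      then show ?thesis by (simp add: \<eta>.emeasure_eq_measure)
    qed
    \<comment> \<open>By stationarity the mass m of y is the mean of the masses of its preimages,
      none above m. So every preimage reached with positive probability has mass m, and n was chosen
      such that g is reached.\<close>
    have "(\<integral>\<^sup>+h. ennreal m - ennreal (measure \<nu> {\<phi> (inv h) y}) \<partial>step n) =
        (\<integral>\<^sup>+h. ennreal m \<partial>step n) - (\<integral>\<^sup>+h. ennreal (measure \<nu> {\<phi> (inv h) y}) \<partial>step n)"
    proof (rule nn_integral_diff)
      have "(\<integral>\<^sup>+h. ennreal (measure \<nu> {\<phi> (inv h) y}) \<partial>step n) \<le> (\<integral>\<^sup>+h. ennreal m \<partial>step n)"
        by (intro nn_integral_mono ennreal_leI le_m)
      also have "\<dots> < \<infinity>" by (simp add: measure_pmf.emeasure_space_1)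
      finally show "(\<integral>\<^sup>+h. ennreal (measure \<nu> {\<phi> (inv h) y}) \<partial>step n) \<noteq> \<infinity>" by simp
    qed (auto intro!: ennreal_leI le_m)
    also have "(\<integral>\<^sup>+h. ennreal m \<partial>step n) = ennreal m" by (simp add: measure_pmf.emeasure_space_1)
    also have "(\<integral>\<^sup>+h. ennreal (measure \<nu> {\<phi> (inv h) y}) \<partial>step n) = (\<integral>\<^sup>+h. emeasure \<nu> (\<phi> h -` {y}) \<partial>step n)"
      using set_step by (intro nn_integral_cong_AE AE_pmfI) (auto simp: e subset_eq)
    also have "\<dots> = emeasure \<nu> {y}" by (rule emeasure_stat_step[OF singleton_\<nu>])
    also have "\<dots> = ennreal m" using y by (simp add: \<eta>.emeasure_eq_measure F_def)
    finally have "(\<integral>\<^sup>+h. ennreal m - ennreal (measure \<nu> {\<phi> (inv h) y}) \<partial>step n) = 0" by simp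
    then have "AE h in step n. ennreal m - ennreal (measure \<nu> {\<phi> (inv h) y}) = 0"
      by (subst (asm) nn_integral_0_iff_AE) auto
    then have "ennreal m - ennreal (measure \<nu> {\<phi> (inv g) y}) = 0"
      using n by (simp add: AE_measure_pmf_iff)
    then have "m \<le> measure \<nu> {\<phi> (inv g) y}"
      by (simp add: diff_eq_0_iff_ennreal m0)
    with le_m show ?thesis by (auto simp: F_def intro: antisym)
  qed
  have "\<phi> g y \<in> F" if "g \<in> carrier G" "y \<in> F" for g y
    using inv[of "inv g" y] that by simp
  then have "invariant_set G \<phi> F"
    unfolding invariant_set_def by auto
  moreover have "closed F" using \<open>finite F\<close> by (rule finite_imp_closed)
  moreover have "F \<noteq> {}" using z by (auto simp: F_def)
  ultimately have "F = UNIV" using minimal unfolding minimal_action_def by blast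
  with \<open>finite F\<close> infinite_space show False by simp
qed

text \<open>Uniform nonatomicity, by compactness: centres of ever smaller balls of mass at least e
  would accumulate at some l, every closed ball around l would have mass at least e, and l would be
  an atom.\<close>

lemma small_balls:
  assumes e: "e > 0"
  obtains d where "d > 0" "\<And>y. measure \<nu> (ball y d) < e"
proof (rule ccontr)
  assume not: "\<not> thesis"
  have "\<exists>y. measure \<nu> (ball y (inverse (real (Suc n)))) \<ge> e" for n
  proof (rule ccontr)
    assume "\<not> ?thesis"
    then have "measure \<nu> (ball y (inverse (real (Suc n)))) < e" for y by (auto simp: not_le)
    with that[of "inverse (real (Suc n))"] not show False by simp
  qed
  then have "\<forall>n. \<exists>y. measure \<nu> (ball y (inverse (real (Suc n)))) \<ge> e" by blast
  from choice[OF this] obtain y where y: "\<And>n. measure \<nu> (ball (y n) (inverse (real (Suc n)))) \<ge> e" by blast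
  obtain l r where r: "strict_mono (r :: nat \<Rightarrow> nat)" and lim: "(y \<circ> r) \<longlonglongrightarrow> l"
    using compact_space[unfolded compact_def, rule_format, of y] by auto
  have cb: "cball l \<delta> \<in> sets \<nu>" for \<delta> by (simp add: sets_\<nu>)
  have big: "e \<le> measure \<nu> (cball l \<delta>)" if \<delta>: "\<delta> > 0" for \<delta>
  proof -
    have "\<forall>\<^sub>F n in sequentially. dist (y (r n)) l < \<delta> / 2"
      using lim \<delta> tendstoD[of "y \<circ> r" l sequentially "\<delta> / 2"] by simp
    moreover have "\<forall>\<^sub>F n in sequentially. inverse (real (Suc n)) < \<delta> / 2"
      using LIMSEQ_inverse_real_of_nat \<delta> order_tendstoD(2)[of _ 0 sequentially "\<delta> / 2"] by simp
    ultimately have "\<forall>\<^sub>F n in sequentially. dist (y (r n)) l < \<delta> / 2 \<and> inverse (real (Suc n)) < \<delta> / 2"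
      by (rule eventually_conj)
    then obtain n where n: "dist (y (r n)) l < \<delta> / 2" "inverse (real (Suc n)) < \<delta> / 2"
      by (auto simp: eventually_sequentially)
    have "inverse (real (Suc (r n))) \<le> inverse (real (Suc n))"
      using seq_suble[OF r, of n] by (simp add: field_simps)
    then have "ball (y (r n)) (inverse (real (Suc (r n)))) \<subseteq> cball l \<delta>"
    proof (intro subsetI)
      fix z assume le: "inverse (real (Suc (r n))) \<le> inverse (real (Suc n))"
        and z: "z \<in> ball (y (r n)) (inverse (real (Suc (r n))))"
      have "dist (y (r n)) z < inverse (real (Suc (r n)))" using z by (simp only: mem_ball)
      then have "dist (y (r n)) z < \<delta> / 2" using n(2) le by linarith
      then have "dist l z \<le> \<delta>"
        using n(1) dist_triangle[of l z "y (r n)"] by (simp add: dist_commute)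
      then show "z \<in> cball l \<delta>" by simp
    qed
    then have "measure \<nu> (ball (y (r n)) (inverse (real (Suc (r n))))) \<le> measure \<nu> (cball l \<delta>)"
      by (intro \<eta>.finite_measure_mono cb)
    with y[of "r n"] show ?thesis by linarith
  qed
  have "(\<lambda>n. measure \<nu> (cball l (inverse (real (Suc n))))) \<longlonglongrightarrow> measure \<nu> (\<Inter>n. cball l (inverse (real (Suc n))))"
  proof (rule \<eta>.finite_Lim_measure_decseq)
    show "range (\<lambda>n. cball l (inverse (real (Suc n)))) \<subseteq> sets \<nu>" using cb by auto
    show "decseq (\<lambda>n. cball l (inverse (real (Suc n))))"
      by (intro decseq_SucI subset_cball le_imp_inverse_le) auto
  qed
  also have "(\<Inter>n. cball l (inverse (real (Suc n)))) = {l}"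
  proof (intro equalityI subsetI)
    fix x assume x: "x \<in> (\<Inter>n. cball l (inverse (real (Suc n))))"
    have "dist l x \<le> 0"
      by (rule LIMSEQ_le_const[OF LIMSEQ_inverse_real_of_nat]) (use x in auto)
    then show "x \<in> {l}" by simp
  qed auto
  finally have "(\<lambda>n. measure \<nu> (cball l (inverse (real (Suc n))))) \<longlonglongrightarrow> 0" by (simp add: nonatomic)
  then have "e \<le> 0"
  proof (rule LIMSEQ_le_const, intro exI[of _ 0] allI impI)
    show "e \<le> measure \<nu> (cball l (inverse (real (Suc n))))" for n by (rule big) simp
  qed
  with e show False by simp
qed

lemma null_translate: "AE x in \<nu>. x \<noteq> a"
proof (rule AE_I[of _ _ "{a}"])
  show "emeasure \<nu> {a} = 0" using nonatomic[of a] by (simp add: \<eta>.emeasure_eq_measure)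
qed (auto simp: singleton_\<nu>)

lemma measurable_continuous:
  assumes "continuous_on UNIV f" "g \<in> carrier G" shows "(\<lambda>x. f (\<phi> g x)) \<in> borel_measurable \<nu>"
proof -
  have "f \<in> borel_measurable \<nu>"
    using borel_measurable_continuous_onI[OF assms(1)] by (simp add: measurable_cong_sets[OF sets_\<nu> refl])
  then show ?thesis using meas[OF assms(2)] by measurable
qed

text \<open>The exceptional point a has measure 0, so almost every point is moved towards b and
  dominated convergence applies.\<close>

lemma subsequence_limit:
  fixes s :: "nat \<Rightarrow> 'g"
  assumes "inj s" "range s \<subseteq> carrier G"
  obtains r b where "strict_mono (r :: nat \<Rightarrow> nat)"
    and "\<And>f :: 'm \<Rightarrow> real. continuous_on UNIV f \<Longrightarrow> bounded (range f) \<Longrightarrow> (\<lambda>k. \<integral>x. f (\<phi> (s (r k)) x) \<partial>\<nu>) \<longlonglongrightarrow> f b"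
proof -
  obtain r a b where r: "strict_mono (r :: nat \<Rightarrow> nat)"
    and d: "\<And>K U. compact K \<Longrightarrow> a \<notin> K \<Longrightarrow> open U \<Longrightarrow> b \<in> U \<Longrightarrow> \<forall>\<^sub>F k in sequentially. \<phi> (s (r k)) ` K \<subseteq> U"
    by (rule dynamics[OF assms]) blast
  have "(\<lambda>k. \<integral>x. f (\<phi> (s (r k)) x) \<partial>\<nu>) \<longlonglongrightarrow> f b"
    if c: "continuous_on UNIV f" and bd: "bounded (range f)" for f :: "'m \<Rightarrow> real"
  proof -
    obtain B where B: "\<And>x. \<bar>f x\<bar> \<le> B" using bd by (auto simp: bounded_iff)
    have "(\<lambda>k. \<integral>x. f (\<phi> (s (r k)) x) \<partial>\<nu>) \<longlonglongrightarrow> (\<integral>x. f b \<partial>\<nu>)"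
    proof (rule integral_dominated_convergence[where w = "\<lambda>_. B"])
      show "(\<lambda>x. f (\<phi> (s (r k)) x)) \<in> borel_measurable \<nu>" for k
        using assms(2) by (intro measurable_continuous c) auto
      show "AE x in \<nu>. (\<lambda>k. f (\<phi> (s (r k)) x)) \<longlonglongrightarrow> f b"
        using null_translate[of a]
      proof eventually_elim
        case (elim x)
        have "(\<lambda>k. \<phi> (s (r k)) x) \<longlonglongrightarrow> b"
        proof (rule topological_tendstoI)
          fix U :: "'m set" assume "open U" "b \<in> U"
          then show "\<forall>\<^sub>F k in sequentially. \<phi> (s (r k)) x \<in> U"
            using d[of "{x}" U] elim by simp
        qed
        then show ?case
          using isCont_tendsto_compose[of b f] c by (simp add: continuous_on_eq_continuous_at)
      qed
    qed (use B in auto)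
    then show ?thesis using \<eta>.prob_space by simp
  qed
  with r that show thesis by blast
qed

end

section \<open>Almost sure convergence of the walk in M\<close>

context convergence_walk begin

text \<open>The union of finite nets of all scales 1/(n+1). Countability matters because almost sure
  statements can be collected for countably many test functions only.\<close>

lemma countable_separating:
  obtains C :: "'m set" where "countable C" "\<And>b c. (\<And>p. p \<in> C \<Longrightarrow> dist p b = dist p c) \<Longrightarrow> b = c"
proof -
  have "\<forall>n. \<exists>k. finite k \<and> (UNIV :: 'm set) \<subseteq> (\<Union>x\<in>k. ball x (inverse (real (Suc n))))"
    using compact_space unfolding compact_eq_totally_bounded by simp
  from choice[OF this] obtain k where k: "\<And>n. finite (k n)" "\<And>n. (UNIV :: 'm set) \<subseteq> (\<Union>x\<in>k n. ball x (inverse (real (Suc n))))"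
    by blast
  show thesis
  proof (rule that[of "\<Union>n. k n"])
    show "countable (\<Union>n. k n)" using k(1) by (auto intro: countable_finite)
    fix b c :: 'm assume eq: "\<And>p. p \<in> (\<Union>n. k n) \<Longrightarrow> dist p b = dist p c"
    have le: "dist b c \<le> 2 * inverse (real (Suc n))" for n
    proof -
      have "b \<in> (\<Union>x\<in>k n. ball x (inverse (real (Suc n))))" using k(2)[of n] by blast
      then obtain p where p: "p \<in> k n" "dist p b < inverse (real (Suc n))" by auto
      moreover have "dist p b = dist p c" using p(1) by (intro eq) blast
      ultimately have "dist p c < inverse (real (Suc n))" by simp
      with p(2) dist_triangle2[of b c p] show ?thesis by (simp add: dist_commute)
    qed
    have "(\<lambda>n. 2 * inverse (real (Suc n))) \<longlonglongrightarrow> 2 * 0"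
      by (intro tendsto_intros LIMSEQ_inverse_real_of_nat)
    then have "dist b c \<le> 2 * 0" by (rule LIMSEQ_le_const) (use le in blast)
    then show "b = c" by simp
  qed
qed

lemma bounded_range_continuous:
  fixes f :: "'m \<Rightarrow> real"
  assumes "continuous_on UNIV f" shows "bounded (range f)"
  using compact_continuous_image[OF assms compact_space] by (rule compact_imp_bounded)

text \<open>Along times with distinct values the translates of \<nu> accumulate only at point
  masses, and the convergent integrals of distances to C force all these to sit at one point b. The
  remaining danger is that some element recurs infinitely often; the squared distances are there to
  exclude it.\<close>

lemma limit_of_walk:
  fixes w :: "nat \<Rightarrow> 'g"
  assumes w: "\<And>n. w n \<in> carrier G" and inf: "infinite (range w)"
    and sep: "\<And>b c. (\<And>p. p \<in> C \<Longrightarrow> dist p b = dist p c) \<Longrightarrow> b = c" and C: "countable C"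
    and lim1: "\<And>p. p \<in> C \<Longrightarrow> convergent (\<lambda>n. \<integral>x. dist p (\<phi> (w n) x) \<partial>\<nu>)"
    and lim2: "\<And>p. p \<in> C \<Longrightarrow> convergent (\<lambda>n. \<integral>x. (dist p (\<phi> (w n) x))\<^sup>2 \<partial>\<nu>)"
  shows "\<exists>b. \<forall>f::'m \<Rightarrow> real. continuous_on UNIV f \<longrightarrow> (\<lambda>n. \<integral>x. f (\<phi> (w n) x) \<partial>\<nu>) \<longlonglongrightarrow> f b"
proof -
  have cd: "continuous_on UNIV (\<lambda>x. dist p x)" "continuous_on UNIV (\<lambda>x. (dist p x)\<^sup>2)" for p :: 'm
    by (intro continuous_intros)+
  have sub: "\<exists>r' b. strict_mono (r' :: nat \<Rightarrow> nat) \<and> (\<forall>f::'m \<Rightarrow> real. continuous_on UNIV f \<longrightarrow>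
      (\<lambda>n. \<integral>x. f (\<phi> (w (r (r' n))) x) \<partial>\<nu>) \<longlonglongrightarrow> f b)"
    if inf_r: "infinite (range (w \<circ> r))" for r
  proof -
    obtain r1 where r1: "strict_mono (r1 :: nat \<Rightarrow> nat)" "inj ((w \<circ> r) \<circ> r1)" by (rule infinite_range_subseq[OF inf_r]) blast
    have "range ((w \<circ> r) \<circ> r1) \<subseteq> carrier G" using w by auto
    then obtain r2 b where r2: "strict_mono (r2 :: nat \<Rightarrow> nat)"
      and b: "\<And>f :: 'm \<Rightarrow> real. continuous_on UNIV f \<Longrightarrow> bounded (range f) \<Longrightarrow>
        (\<lambda>k. \<integral>x. f (\<phi> (((w \<circ> r) \<circ> r1) (r2 k)) x) \<partial>\<nu>) \<longlonglongrightarrow> f b"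
      by (rule subsequence_limit[OF r1(2)]) blast
    have "strict_mono (r1 \<circ> r2)" by (rule strict_mono_o[OF r1(1) r2])
    moreover have "\<forall>f::'m \<Rightarrow> real. continuous_on UNIV f \<longrightarrow> (\<lambda>n. \<integral>x. f (\<phi> (w (r ((r1 \<circ> r2) n))) x) \<partial>\<nu>) \<longlonglongrightarrow> f b"
      using b bounded_range_continuous by simp
    ultimately show ?thesis by blast
  qed
  obtain r0 b where r0: "strict_mono (r0 :: nat \<Rightarrow> nat)"
    and b: "\<And>f::'m \<Rightarrow> real. continuous_on UNIV f \<Longrightarrow> (\<lambda>n. \<integral>x. f (\<phi> (w (r0 n)) x) \<partial>\<nu>) \<longlonglongrightarrow> f b"
  proof -
    have "infinite (range (w \<circ> id))" using inf by simp
    from sub[OF this] show thesis using that by auto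
  qed
  have full: "(\<lambda>n. \<integral>x. f (\<phi> (w n) x) \<partial>\<nu>) \<longlonglongrightarrow> f b"
    if conv: "convergent (\<lambda>n. \<integral>x. f (\<phi> (w n) x) \<partial>\<nu>)" and c: "continuous_on UNIV f" for f :: "'m \<Rightarrow> real"
  proof -
    obtain l where l: "(\<lambda>n. \<integral>x. f (\<phi> (w n) x) \<partial>\<nu>) \<longlonglongrightarrow> l" using conv by (auto simp: convergent_def)
    have "(\<lambda>n. \<integral>x. f (\<phi> (w (r0 n)) x) \<partial>\<nu>) \<longlonglongrightarrow> l"
      using LIMSEQ_subseq_LIMSEQ[OF l r0] by (simp add: comp_def)
    then have "l = f b" using b[OF c] LIMSEQ_unique by blast
    with l show ?thesis by simp
  qed
  have l1: "(\<lambda>n. \<integral>x. dist p (\<phi> (w n) x) \<partial>\<nu>) \<longlonglongrightarrow> dist p b" if "p \<in> C" for p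
    by (rule full[OF lim1[OF that] cd(1)])
  have l2: "(\<lambda>n. \<integral>x. (dist p (\<phi> (w n) x))\<^sup>2 \<partial>\<nu>) \<longlonglongrightarrow> (dist p b)\<^sup>2" if "p \<in> C" for p
    by (rule full[OF lim2[OF that] cd(2)])
  \<comment> \<open>If g recurred infinitely often, the first two moments of the distance from p to
    \<open>\<phi> g x\<close> would equal their limits and the variance would be 0. Then
    \<open>\<phi> g x\<close> has the same distances to C as b, so it equals b for almost all x,
    against nonatomicity.\<close>
  have no_return: "infinite (range (w \<circ> r))" if r: "strict_mono (r :: nat \<Rightarrow> nat)" for r
  proof
    assume "finite (range (w \<circ> r))"
    then obtain g where inf_g: "infinite {n. (w \<circ> r) n = g}"
      using pigeonhole_infinite[of "UNIV :: nat set" "w \<circ> r"] by auto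
    define s where "s = enumerate {n. (w \<circ> r) n = g}"
    have s: "strict_mono s" "\<And>n. s n \<in> {n. (w \<circ> r) n = g}"
      unfolding s_def using inf_g by (rule strict_mono_enumerate, rule enumerate_in_set)
    then have wg: "w (r (s n)) = g" for n by simp
    have g: "g \<in> carrier G" using w wg by metis
    have "strict_mono (r \<circ> s)" by (rule strict_mono_o[OF r s(1)])
    note ss = LIMSEQ_subseq_LIMSEQ[OF _ this]
    have "AE x in \<nu>. dist p (\<phi> g x) = dist p b" if p: "p \<in> C" for p
    proof -
      have 1: "(\<integral>x. dist p (\<phi> g x) \<partial>\<nu>) = dist p b"
        using ss[OF l1[OF p]] by (simp add: comp_def wg LIMSEQ_const_iff)
      have 2: "(\<integral>x. (dist p (\<phi> g x))\<^sup>2 \<partial>\<nu>) = (dist p b)\<^sup>2"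
        using ss[OF l2[OF p]] by (simp add: comp_def wg LIMSEQ_const_iff)
      have int: "integrable \<nu> (\<lambda>x. f (\<phi> g x))" if c: "continuous_on UNIV f" for f :: "'m \<Rightarrow> real"
      proof -
        obtain B where B: "\<And>x. \<bar>f x\<bar> \<le> B" using bounded_range_continuous[OF c] by (auto simp: bounded_iff)
        show ?thesis
          by (rule \<eta>.integrable_const_bound[where B = B]) (use B measurable_continuous[OF c g] in auto)
      qed
      note i1 = int[OF cd(1)[of p]] and i2 = int[OF cd(2)[of p]]
      have i3: "integrable \<nu> (\<lambda>x. (dist p (\<phi> g x) - dist p b)\<^sup>2)"
        by (rule int) (intro continuous_intros)
      have "(\<integral>x. (dist p (\<phi> g x) - dist p b)\<^sup>2 \<partial>\<nu>) =
          (\<integral>x. (dist p (\<phi> g x))\<^sup>2 - 2 * dist p b * dist p (\<phi> g x) + (dist p b)\<^sup>2 \<partial>\<nu>)"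
        by (intro Bochner_Integration.integral_cong) (auto simp: power2_eq_square algebra_simps)
      also have "\<dots> = (\<integral>x. (dist p (\<phi> g x))\<^sup>2 \<partial>\<nu>) - 2 * dist p b * (\<integral>x. dist p (\<phi> g x) \<partial>\<nu>) + (dist p b)\<^sup>2"
        using i1 i2 \<eta>.prob_space by simp
      also have "\<dots> = 0" unfolding 1 2 by (simp add: power2_eq_square)
      finally have "AE x in \<nu>. (dist p (\<phi> g x) - dist p b)\<^sup>2 = 0"
        using integral_nonneg_eq_0_iff_AE[OF i3] by simp
      then show ?thesis by eventually_elim simp
    qed
    then have "AE x in \<nu>. \<forall>p\<in>C. dist p (\<phi> g x) = dist p b"
      by (subst AE_ball_countable[OF C]) blast
    then have "AE x in \<nu>. x = \<phi> (inv g) b"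
    proof eventually_elim
      case (elim x)
      then have "\<phi> g x = b" by (intro sep) auto
      then show ?case using act_inv(1)[OF g, of x] by simp
    qed
    with null_translate[of "\<phi> (inv g) b"] have "AE x in \<nu>. False" by eventually_elim simp
    then show False by (simp add: \<eta>.AE_False)
  qed
  have "(\<lambda>n. \<integral>x. f (\<phi> (w n) x) \<partial>\<nu>) \<longlonglongrightarrow> f b" if c: "continuous_on UNIV f" for f :: "'m \<Rightarrow> real"
  proof (rule ccontr)
    assume "\<not> ?thesis"
    then obtain e where e: "e > 0" and freq: "\<forall>N. \<exists>n\<ge>N. \<not> dist (\<integral>x. f (\<phi> (w n) x) \<partial>\<nu>) (f b) < e"
      unfolding lim_sequentially by auto
    \<comment> \<open>Bad times would have, by \<open>no_return\<close>, a subsequence with limit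
      b', and the distances to C identify b' with b.\<close>
    define A where "A = {n. \<not> dist (\<integral>x. f (\<phi> (w n) x) \<partial>\<nu>) (f b) < e}"
    have "infinite A" unfolding infinite_nat_iff_unbounded_le A_def using freq by auto
    define r where "r = enumerate A"
    have r: "strict_mono r" "\<And>n. r n \<in> A"
      unfolding r_def using \<open>infinite A\<close> by (rule strict_mono_enumerate, rule enumerate_in_set)
    obtain r' b' where r': "strict_mono (r' :: nat \<Rightarrow> nat)"
      and b': "\<And>f::'m \<Rightarrow> real. continuous_on UNIV f \<Longrightarrow> (\<lambda>n. \<integral>x. f (\<phi> (w (r (r' n))) x) \<partial>\<nu>) \<longlonglongrightarrow> f b'"
      using sub[OF no_return[OF r(1)]] by blast
    have "b' = b"
    proof (rule sep)
      fix p assume p: "p \<in> C"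
      have "(\<lambda>n. \<integral>x. dist p (\<phi> (w (r (r' n))) x) \<partial>\<nu>) \<longlonglongrightarrow> dist p b"
        using LIMSEQ_subseq_LIMSEQ[OF l1[OF p] strict_mono_o[OF r(1) r']] by (simp add: comp_def)
      then show "dist p b' = dist p b" using b'[OF cd(1)] LIMSEQ_unique by blast
    qed
    then have "(\<lambda>n. \<integral>x. f (\<phi> (w (r (r' n))) x) \<partial>\<nu>) \<longlonglongrightarrow> f b" using b'[OF c] by simp
    then obtain n where "dist (\<integral>x. f (\<phi> (w (r (r' n))) x) \<partial>\<nu>) (f b) < e"
      using e unfolding lim_sequentially by blast
    with r(2)[of "r' n"] show False by (simp add: A_def)
  qed
  then show ?thesis by blast
qed

text \<open>Martingale convergence settles the distances to C and their squares for almost every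
  path, and almost every path has infinite range; the rest is deterministic.\<close>

lemma AE_limit_of_walk:
  "AE \<omega> in P. \<exists>b. \<forall>f::'m \<Rightarrow> real. continuous_on UNIV f \<longrightarrow> (\<lambda>n. \<integral>x. f (\<phi> (W n \<omega>) x) \<partial>\<nu>) \<longlonglongrightarrow> f b"
proof -
  obtain C :: "'m set" where C: "countable C"
    and sep: "\<And>b c. (\<And>p. p \<in> C \<Longrightarrow> dist p b = dist p c) \<Longrightarrow> b = c"
    by (rule countable_separating) blast
  have conv: "AE \<omega> in P. convergent (\<lambda>n. \<integral>x. f (\<phi> (W n \<omega>) x) \<partial>\<nu>)"
    if c: "continuous_on UNIV f" and nn: "\<And>x. 0 \<le> f x" for f :: "'m \<Rightarrow> real"
  proof -
    obtain B where B: "\<And>x. \<bar>f x\<bar> \<le> B" using bounded_range_continuous[OF c] by (auto simp: bounded_iff)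
    have B': "f x \<le> B" for x using B[of x] by simp
    have m: "f \<in> borel_measurable \<nu>"
      using borel_measurable_continuous_onI[OF c] by (simp add: measurable_cong_sets[OF sets_\<nu> refl])
    show ?thesis by (rule harmonic_convergent[OF harmonic_integral[OF m nn B']])
  qed
  have "AE \<omega> in P. \<forall>p\<in>C. convergent (\<lambda>n. \<integral>x. dist p (\<phi> (W n \<omega>) x) \<partial>\<nu>)"
    by (subst AE_ball_countable[OF C]) (auto intro!: conv continuous_intros)
  moreover have "AE \<omega> in P. \<forall>p\<in>C. convergent (\<lambda>n. \<integral>x. (dist p (\<phi> (W n \<omega>) x))\<^sup>2 \<partial>\<nu>)"
    by (subst AE_ball_countable[OF C]) (auto intro!: conv continuous_intros)
  ultimately show ?thesis using AE_infinite_range[OF infinite_group]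
  proof eventually_elim
    case (elim \<omega>)
    then show ?case by (intro limit_of_walk[OF W_closed _ sep C]) auto
  qed
qed

sublocale boundary_action G \<mu> \<phi> \<nu>
proof
  show "sets \<nu> = sets borel" by (rule sets_\<nu>)
  show "AE \<omega> in P. \<exists>b. \<forall>f::'m \<Rightarrow> real. continuous_on UNIV f \<and> bounded (range f) \<longrightarrow>
        (\<lambda>n. \<integral>y. f (\<phi> (W n \<omega>) y) \<partial>\<nu>) \<longlonglongrightarrow> f b"
    using AE_limit_of_walk by eventually_elim blast
qed

end

subsection \<open>Linear growth of strips\<close>

context group begin

definition word_ball :: "'a set \<Rightarrow> nat \<Rightarrow> 'a set" where
  "word_ball S k = {word_prod G xs | xs. length xs \<le> k \<and> set xs \<subseteq> S \<union> (\<lambda>s. inv s) ` S}"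

lemma finite_word_ball: "finite S \<Longrightarrow> finite (word_ball S k)"
proof -
  assume "finite S"
  then have "finite {xs. set xs \<subseteq> S \<union> (\<lambda>s. inv s) ` S \<and> length xs \<le> k}"
    by (intro finite_lists_length_le) simp
  then have "finite (word_prod G ` {xs. set xs \<subseteq> S \<union> (\<lambda>s. inv s) ` S \<and> length xs \<le> k})" by simp
  then show ?thesis by (rule finite_subset[rotated]) (auto simp: word_ball_def)
qed

lemma symmetric_closed: "S \<subseteq> carrier G \<Longrightarrow> S \<union> (\<lambda>s. inv s) ` S \<subseteq> carrier G"
  by auto

lemma word_ball_closed: "S \<subseteq> carrier G \<Longrightarrow> word_ball S k \<subseteq> carrier G"
proof
  fix g assume S: "S \<subseteq> carrier G" and "g \<in> word_ball S k"
  then obtain xs where "g = word_prod G xs" "set xs \<subseteq> S \<union> (\<lambda>s. inv s) ` S"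
    unfolding word_ball_def by blast
  with symmetric_closed[OF S] show "g \<in> carrier G" by (metis subset_trans word_prod_closed)
qed

lemma word_ball_mult:
  assumes S: "S \<subseteq> carrier G" and "g \<in> word_ball S k" "h \<in> word_ball S l"
  shows "g \<otimes> h \<in> word_ball S (k + l)"
proof -
  obtain xs where xs: "g = word_prod G xs" "length xs \<le> k" "set xs \<subseteq> S \<union> (\<lambda>s. inv s) ` S"
    using assms(2) unfolding word_ball_def by blast
  obtain ys where ys: "h = word_prod G ys" "length ys \<le> l" "set ys \<subseteq> S \<union> (\<lambda>s. inv s) ` S"
    using assms(3) unfolding word_ball_def by blast
  have "g \<otimes> h = word_prod G (xs @ ys)"
    unfolding xs(1) ys(1)
    by (rule word_prod_append[symmetric]) (use xs(3) ys(3) symmetric_closed[OF S] in blast)+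
  moreover have "length (xs @ ys) \<le> k + l" "set (xs @ ys) \<subseteq> S \<union> (\<lambda>s. inv s) ` S"
    using xs ys by auto
  ultimately show ?thesis unfolding word_ball_def by blast
qed

lemma word_ball_inv:
  assumes S: "S \<subseteq> carrier G" and g: "g \<in> word_ball S k"
  shows "inv g \<in> word_ball S k"
proof -
  let ?T = "S \<union> (\<lambda>s. inv s) ` S"
  obtain xs where xs: "g = word_prod G xs" "length xs \<le> k" "set xs \<subseteq> ?T"
    using g unfolding word_ball_def by blast
  have inv_T: "inv s \<in> ?T" if "s \<in> ?T" for s using that S by auto
  have "inv (word_prod G xs) = word_prod G (rev (map (\<lambda>s. inv s) xs))" if "set xs \<subseteq> carrier G" for xs
    using that
  proof (induction xs)
    case (Cons x xs)
    then have "inv (word_prod G (x # xs)) = inv (word_prod G xs) \<otimes> inv x"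
      by (simp add: inv_mult_group word_prod_closed)
    also have "\<dots> = word_prod G (rev (map (\<lambda>s. inv s) xs) @ [inv x])"
      using Cons by (subst word_prod_append) auto
    finally show ?case by simp
  qed simp
  then have "inv g = word_prod G (rev (map (\<lambda>s. inv s) xs))"
    using xs symmetric_closed[OF S] by blast
  moreover have "set (rev (map (\<lambda>s. inv s) xs)) \<subseteq> ?T" using xs(3) inv_T by (simp add: subset_eq)
  ultimately show ?thesis unfolding word_ball_def using xs(2) by (intro CollectI exI[of _ "rev (map (\<lambda>s. inv s) xs)"]) auto
qed

text \<open>A discrete intermediate value property along the prefixes of a word.\<close>

lemma crossing:
  assumes "\<not> R (word_prod G [])" and "R (word_prod G xs)"
  shows "\<exists>j<length xs. \<not> R (word_prod G (take j xs)) \<and> R (word_prod G (take (Suc j) xs))"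
proof (rule ccontr)
  assume *: "\<not> ?thesis"
  have "\<not> R (word_prod G (take j xs))" if "j \<le> length xs" for j
    using that
  proof (induction j)
    case (Suc j)
    then have "j < length xs" and j: "\<not> R (word_prod G (take j xs))" by simp_all
    with * show ?case by blast
  qed (use assms in simp)
  from this[of "length xs"] assms(2) show False by simp
qed

text \<open>Take p minimal and q maximal in the finite partial order. An element not strictly
  between them equals or is incomparable to one of the two, so it is p or q times an element of F
  with the identity added.\<close>

lemma almost_extremal:
  assumes T: "finite T" "T \<noteq> {}" "T \<subseteq> carrier G" and F: "finite F"
    and irrefl: "\<And>g. g \<in> T \<Longrightarrow> \<not> R g g"
    and trans: "\<And>g h k. g \<in> T \<Longrightarrow> h \<in> T \<Longrightarrow> k \<in> T \<Longrightarrow> R g h \<Longrightarrow> R h k \<Longrightarrow> R g k"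
    and comp: "\<And>g h. g \<in> T \<Longrightarrow> h \<in> T \<Longrightarrow> inv g \<otimes> h \<in> F \<or> R g h \<or> R h g"
  obtains p q where "p \<in> T" "q \<in> T" "card {h\<in>T. \<not> (R p h \<and> R h q)} \<le> 2 * Suc (card F)"
proof -
  have "asymp_on T R" using irrefl trans by (intro asymp_onI) blast
  moreover have "transp_on T R" using trans by (intro transp_onI) blast
  ultimately obtain p q where p: "p \<in> T" "\<forall>x\<in>T. x \<noteq> p \<longrightarrow> \<not> R x p" and q: "q \<in> T" "\<forall>x\<in>T. x \<noteq> q \<longrightarrow> \<not> R q x"
    using Finite_Set.bex_min_element[OF T(1) _ _ T(2), of R] Finite_Set.bex_max_element[OF T(1) _ _ T(2), of R] by blast
  have mem: "h \<in> (\<lambda>u. g \<otimes> u) ` insert \<one> F" if "g \<in> T" "h \<in> T" "inv g \<otimes> h \<in> F \<or> h = g" for g h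
  proof -
    have "g \<in> carrier G" "h \<in> carrier G" using that T by auto
    then have "h = g \<otimes> (inv g \<otimes> h)" by (simp add: m_assoc[symmetric])
    moreover have "inv g \<otimes> h \<in> insert \<one> F" using that \<open>g \<in> carrier G\<close> by auto
    ultimately show ?thesis by blast
  qed
  have "{h\<in>T. \<not> (R p h \<and> R h q)} \<subseteq> (\<lambda>u. p \<otimes> u) ` insert \<one> F \<union> (\<lambda>u. q \<otimes> u) ` insert \<one> F"
  proof
    fix h assume "h \<in> {h\<in>T. \<not> (R p h \<and> R h q)}"
    then consider "h \<in> T" "\<not> R p h" | "h \<in> T" "\<not> R h q" by blast
    then show "h \<in> (\<lambda>u. p \<otimes> u) ` insert \<one> F \<union> (\<lambda>u. q \<otimes> u) ` insert \<one> F"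
    proof cases
      case 1
      then have "inv p \<otimes> h \<in> F \<or> h = p" using p comp[of p h] by blast
      then show ?thesis using mem[of p h] 1 p(1) by blast
    next
      case 2
      then have "inv q \<otimes> h \<in> F \<or> h = q" using q comp[of q h] by blast
      then show ?thesis using mem[of q h] 2 q(1) by blast
    qed
  qed
  then have "card {h\<in>T. \<not> (R p h \<and> R h q)} \<le> card ((\<lambda>u. p \<otimes> u) ` insert \<one> F \<union> (\<lambda>u. q \<otimes> u) ` insert \<one> F)"
    using F by (intro card_mono) auto
  also have "\<dots> \<le> card ((\<lambda>u. p \<otimes> u) ` insert \<one> F) + card ((\<lambda>u. q \<otimes> u) ` insert \<one> F)"
    by (rule card_Un_le)
  also have "\<dots> \<le> card (insert \<one> F) + card (insert \<one> F)"
    using F by (intro add_mono card_image_le) auto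
  also have "\<dots> \<le> 2 * Suc (card F)" using F by (simp add: card_insert_if)
  finally show thesis using that p(1) q(1) by blast
qed

end

section \<open>Finiteness by dynamics, and counting in a strip\<close>

context convergence_walk begin

lemma image_sets: "g \<in> carrier G \<Longrightarrow> open U \<Longrightarrow> \<phi> g ` U \<in> sets \<nu>"
  using open_image by (simp add: sets_\<nu>)

text \<open>Along infinitely many distinct u the dynamics contracts the complement of every
  neighbourhood of some a to a point b. As K1 and K2 are disjoint, one of them misses a, and the
  corresponding image falls into a ball of mass below 1/2.\<close>

lemma finite_crossing_set:
  assumes K: "closed K1" "closed K2" "K1 \<inter> K2 = {}" and U: "open U1" "open U2" "U1 \<subseteq> K1" "U2 \<subseteq> K2"
    and s: "s \<in> carrier G"
  shows "finite {u \<in> carrier G. 1/2 \<le> measure \<nu> (\<phi> u ` U1) \<and> 1/2 \<le> measure \<nu> (\<phi> (s \<otimes> u) ` U2)}" (is "finite ?F")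
proof (rule ccontr)
  assume "infinite ?F"
  then obtain t :: "nat \<Rightarrow> 'g" where t: "inj t" "range t \<subseteq> ?F" by (rule infinite_sequence)
  then have tc: "range t \<subseteq> carrier G" by auto
  obtain r a b where r: "strict_mono (r :: nat \<Rightarrow> nat)"
    and d: "\<And>K U. compact K \<Longrightarrow> a \<notin> K \<Longrightarrow> open U \<Longrightarrow> b \<in> U \<Longrightarrow> \<forall>\<^sub>F k in sequentially. \<phi> (t (r k)) ` K \<subseteq> U"
    by (rule dynamics[OF t(1) tc]) blast
  obtain e where e: "e > 0" "\<And>y. measure \<nu> (ball y e) < 1/2" by (rule small_balls[of "1/2"]) auto
  have cK: "compact K1" "compact K2" using K compact_space by (metis compact_Int_closed Int_UNIV_left)+
  have tF: "t k \<in> ?F" for k using t(2) by blast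
  consider "a \<notin> K1" | "a \<notin> K2" using K(3) by blast
  then show False
  proof cases
    case 1
    have "\<forall>\<^sub>F k in sequentially. \<phi> (t (r k)) ` K1 \<subseteq> ball b e"
      using d[OF cK(1) 1] e(1) by simp
    then obtain k where k: "\<phi> (t (r k)) ` K1 \<subseteq> ball b e" by (auto simp: eventually_sequentially)
    have "measure \<nu> (\<phi> (t (r k)) ` U1) \<le> measure \<nu> (ball b e)"
      using k U(3) by (intro \<eta>.finite_measure_mono) (auto simp: sets_\<nu>)
    with e(2)[of b] tF[of "r k"] show False by auto
  next
    case 2
    \<comment> \<open>The ball is placed around the image of b under s and pulled back, so that
      applying s afterwards still lands in a small ball.\<close>
    define V where "V = \<phi> (inv s) ` ball (\<phi> s b) e"
    have "open V" unfolding V_def using s by (intro open_image) auto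
    moreover have "b \<in> V" unfolding V_def using act_inv(1)[OF s, of b] e(1) by (metis centre_in_ball image_eqI)
    ultimately have "\<forall>\<^sub>F k in sequentially. \<phi> (t (r k)) ` K2 \<subseteq> V"
      using d[OF cK(2) 2] by simp
    then obtain k where k: "\<phi> (t (r k)) ` K2 \<subseteq> V" by (auto simp: eventually_sequentially)
    have tk: "t (r k) \<in> carrier G" using tF by auto
    have "\<phi> (s \<otimes> t (r k)) ` U2 \<subseteq> \<phi> s ` V"
      unfolding image_mult[OF s tk] using k U(4) by (intro image_mono) blast
    also have "\<phi> s ` V = ball (\<phi> s b) e"
      unfolding V_def using image_mult[of s "inv s"] s by (simp add: r_inv image_def)
    finally have "measure \<nu> (\<phi> (s \<otimes> t (r k)) ` U2) \<le> measure \<nu> (ball (\<phi> s b) e)"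
      by (intro \<eta>.finite_measure_mono) (auto simp: sets_\<nu>)
    with e(2)[of "\<phi> s b"] tF[of "r k"] show False by auto
  qed
qed

text \<open>Along infinitely many distinct u with repelling point a and attracting point b, a set Ai
  that misses a must contain b, since it meets its images. As A1 and A2 are disjoint, a lies in one
  and b in the other, and then the complement of the open set around a is eventually moved into the
  open set around b.\<close>

lemma finite_incomparable_set:
  assumes A: "closed A1" "closed A2" "A1 \<inter> A2 = {}" and U: "open U1" "open U2" "A1 \<subseteq> U1" "A2 \<subseteq> U2"
  shows "finite {u \<in> carrier G. \<phi> u ` A1 \<inter> A1 \<noteq> {} \<and> \<phi> u ` A2 \<inter> A2 \<noteq> {} \<and>
    \<not> \<phi> u ` (- U2) \<subseteq> U1 \<and> \<not> \<phi> u ` (- U1) \<subseteq> U2}" (is "finite ?F")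
proof (rule ccontr)
  assume "infinite ?F"
  then obtain t :: "nat \<Rightarrow> 'g" where t: "inj t" "range t \<subseteq> ?F" by (rule infinite_sequence)
  then have tc: "range t \<subseteq> carrier G" by auto
  obtain r a b where r: "strict_mono (r :: nat \<Rightarrow> nat)"
    and d: "\<And>K U. compact K \<Longrightarrow> a \<notin> K \<Longrightarrow> open U \<Longrightarrow> b \<in> U \<Longrightarrow> \<forall>\<^sub>F k in sequentially. \<phi> (t (r k)) ` K \<subseteq> U"
    by (rule dynamics[OF t(1) tc]) blast
  have tF: "t k \<in> ?F" for k using t(2) by blast
  have cpt: "compact K" if "closed K" for K :: "'m set"
    using compact_Int_closed[OF compact_space that] by simp
  have bA: "b \<in> A" if A: "closed A" "a \<notin> A" and meets: "\<And>k. \<phi> (t k) ` A \<inter> A \<noteq> {}" for A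
  proof (rule ccontr)
    assume "b \<notin> A"
    then have "\<forall>\<^sub>F k in sequentially. \<phi> (t (r k)) ` A \<subseteq> - A"
      using A by (intro d[OF cpt[OF A(1)] A(2)]) auto
    then obtain k where "\<phi> (t (r k)) ` A \<subseteq> - A" by (auto simp: eventually_sequentially)
    with meets[of "r k"] show False by blast
  qed
  have bA1: "b \<in> A1" if "a \<notin> A1" using A(1) that tF by (intro bA) auto
  have bA2: "b \<in> A2" if "a \<notin> A2" using A(2) that tF by (intro bA) auto
  show False
  proof (cases "a \<in> A1")
    case True
    then have "b \<in> A2" using bA2 A(3) by blast
    have "\<forall>\<^sub>F k in sequentially. \<phi> (t (r k)) ` (- U1) \<subseteq> U2"
      using True U \<open>b \<in> A2\<close> by (intro d cpt) auto
    then obtain k where "\<phi> (t (r k)) ` (- U1) \<subseteq> U2" by (auto simp: eventually_sequentially)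
    with tF[of "r k"] show False by blast
  next
    case False
    then have "b \<in> A1" by (rule bA1)
    then have "a \<in> A2" using bA2 A(3) by blast
    have "\<forall>\<^sub>F k in sequentially. \<phi> (t (r k)) ` (- U2) \<subseteq> U1"
      using \<open>a \<in> A2\<close> U \<open>b \<in> A1\<close> by (intro d cpt) auto
    then obtain k where "\<phi> (t (r k)) ` (- U2) \<subseteq> U1" by (auto simp: eventually_sequentially)
    with tF[of "r k"] show False by blast
  qed
qed

text \<open>The elements of a strip are almost linearly ordered by pushing \<open>U2\<close> deeper into itself; a path
  in the Cayley graph from one end to the other crosses each of them, but a single step
  crosses only boundedly many.\<close>

lemma strip_linear_growth:
  assumes S: "finite S" "S \<subseteq> carrier G"
    and A: "closed A1" "closed A2" and U: "open U1" "open U2" "A1 \<subseteq> U1" "A2 \<subseteq> U2"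
    and K: "closed K1" "closed K2" "U1 \<subseteq> K1" "U2 \<subseteq> K2" "K1 \<inter> K2 = {}"
    and small: "measure \<nu> U1 < 1/2" "measure \<nu> U2 < 1/2"
  obtains C where "\<And>x y k. card {g \<in> word_ball S k. \<phi> (inv g) x \<in> A1 \<and> \<phi> (inv g) y \<in> A2} \<le> C * Suc k"
proof -
  let ?S = "S \<union> (\<lambda>s. inv s) ` S"
  have Sc: "?S \<subseteq> carrier G" by (rule symmetric_closed[OF S(2)])
  have disjA: "A1 \<inter> A2 = {}" and disj: "U1 \<inter> U2 = {}" using U K by blast+
  define F where "F = {u \<in> carrier G. \<phi> u ` A1 \<inter> A1 \<noteq> {} \<and> \<phi> u ` A2 \<inter> A2 \<noteq> {} \<and>
    \<not> \<phi> u ` (- U2) \<subseteq> U1 \<and> \<not> \<phi> u ` (- U1) \<subseteq> U2}"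
  have F: "finite F" unfolding F_def by (rule finite_incomparable_set[OF A disjA U])
  define F' where "F' s = {u \<in> carrier G. 1/2 \<le> measure \<nu> (\<phi> u ` U1) \<and> 1/2 \<le> measure \<nu> (\<phi> (inv s \<otimes> u) ` U2)}" for s
  have F': "finite (F' s)" if "s \<in> ?S" for s
    unfolding F'_def using that Sc
    by (intro finite_crossing_set[OF K(1,2,5) U(1,2) K(3,4)]) auto
  define f where "f = Suc (card F)"
  define f' where "f' = (\<Sum>s\<in>?S. card (F' s))"
  have f': "card (F' s) \<le> f'" if "s \<in> ?S" for s
    unfolding f'_def using S that by (intro member_le_sum) auto
  \<comment> \<open>Since U1 and U2 are disjoint, this yields that gU1 lies in hU1 and hU2 lies in
    gU2: elements that are later in the order push U2 deeper.\<close>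
  define R where "R g h \<longleftrightarrow> - \<phi> g ` U2 \<subseteq> \<phi> h ` U1" for g h
  have U_sets: "\<phi> g ` U1 \<in> sets \<nu>" "\<phi> g ` U2 \<in> sets \<nu>" if "g \<in> carrier G" for g
    using that U by (auto intro: image_sets)
  have disj_g: "\<phi> g ` U1 \<inter> \<phi> g ` U2 = {}" if "g \<in> carrier G" for g
  proof -
    have "\<phi> g ` (U1 \<inter> U2) = \<phi> g ` U1 \<inter> \<phi> g ` U2" by (rule image_Int[OF inj_\<phi>[OF that]])
    then show ?thesis by (simp only: disj image_empty)
  qed
  \<comment> \<open>U1 and U2 would cover M, although each has mass below 1/2.\<close>
  have irrefl: "\<not> R g g" if g: "g \<in> carrier G" for g
  proof
    assume "R g g"
    then have "\<phi> g ` (U1 \<union> U2) = UNIV" unfolding R_def by blast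
    then have "\<phi> (inv g) ` \<phi> g ` (U1 \<union> U2) = \<phi> (inv g) ` UNIV" by simp
    also have "\<phi> (inv g) ` UNIV = UNIV" using g by (simp add: \<phi>_vimage)
    finally have "U1 \<union> U2 = UNIV" using act_inv(1)[OF g] by (simp add: image_image)
    then have "1 \<le> measure \<nu> U1 + measure \<nu> U2"
      using \<eta>.prob_space measure_Un_le[of U1 \<nu> U2] U by (simp add: sets_\<nu>)
    with small show False by linarith
  qed
  have trans: "R g k" if "g \<in> carrier G" "h \<in> carrier G" "R g h" "R h k" for g h k
  proof -
    note that(3)[unfolded R_def]
    also have "\<phi> h ` U1 \<subseteq> - \<phi> h ` U2" using disj_g[OF that(2)] by blast
    also note that(4)[unfolded R_def]
    finally show ?thesis unfolding R_def .
  qed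
  \<comment> \<open>A vertex y counts as being on the U2 side of g when y\<nu> gives gU2 at least
    half of its mass; \<open>?Q\<close> collects the g that are crossed on the edge from y to
    \<open>y \<otimes> s\<close>. If g lies between two such elements p and q, nesting shows that
    y\<nu> gives gU1 at least half as well, and this puts \<open>inv y \<otimes> g\<close> into the
    finite set \<open>F' s\<close>. All but boundedly many elements of \<open>?Q\<close> lie
    so.\<close>
  have step_bound: "card {g\<in>T. measure \<nu> (\<phi> (inv y \<otimes> g) ` U2) < 1/2 \<and> 1/2 \<le> measure \<nu> (\<phi> (inv (y \<otimes> s) \<otimes> g) ` U2)}
      \<le> 2 * f + f'" (is "card ?Q \<le> _")
    if T: "finite T" "T \<subseteq> carrier G" and comp: "\<And>g h. g \<in> T \<Longrightarrow> h \<in> T \<Longrightarrow> inv g \<otimes> h \<in> F \<or> R g h \<or> R h g"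
      and y: "y \<in> carrier G" and s: "s \<in> ?S" for T y s
  proof (cases "?Q = {}")
    case False
    have sc: "s \<in> carrier G" using s Sc by blast
    have Q: "finite ?Q" "?Q \<subseteq> carrier G" using T by auto
    obtain p q where p: "p \<in> ?Q" and q: "q \<in> ?Q" and pq: "card {h\<in>?Q. \<not> (R p h \<and> R h q)} \<le> 2 * Suc (card F)"
    proof (rule almost_extremal[OF Q(1) False Q(2) F, of R])
      show "\<not> R g g" if "g \<in> ?Q" for g using that Q irrefl by blast
      show "R g k" if "g \<in> ?Q" "h \<in> ?Q" "k \<in> ?Q" "R g h" "R h k" for g h k
        using that Q trans by blast
      show "inv g \<otimes> h \<in> F \<or> R g h \<or> R h g" if "g \<in> ?Q" "h \<in> ?Q" for g h
        using that by (intro comp) auto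
    qed blast
    have pc: "p \<in> carrier G" and qc: "q \<in> carrier G" using p q Q by auto
    have "?Q \<subseteq> {h\<in>?Q. \<not> (R p h \<and> R h q)} \<union> (\<lambda>u. y \<otimes> u) ` F' s"
    proof
      fix g assume g: "g \<in> ?Q"
      then have gc: "g \<in> carrier G" using Q by auto
      show "g \<in> {h\<in>?Q. \<not> (R p h \<and> R h q)} \<union> (\<lambda>u. y \<otimes> u) ` F' s"
      proof (cases "R p g \<and> R g q")
        case True
        have yg: "inv y \<otimes> g \<in> carrier G" "inv y \<otimes> p \<in> carrier G" using y gc pc by auto
        have "- \<phi> p ` U2 \<subseteq> \<phi> g ` U1" using True unfolding R_def by blast
        then have "\<phi> (inv y) ` (- \<phi> p ` U2) \<subseteq> \<phi> (inv y) ` \<phi> g ` U1" by (rule image_mono)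
        then have "- \<phi> (inv y \<otimes> p) ` U2 \<subseteq> \<phi> (inv y \<otimes> g) ` U1"
          using y pc gc by (simp add: \<phi>_Compl image_mult)
        then have "measure \<nu> (- \<phi> (inv y \<otimes> p) ` U2) \<le> measure \<nu> (\<phi> (inv y \<otimes> g) ` U1)"
          using U_sets[OF yg(1)] by (intro \<eta>.finite_measure_mono)
        moreover have "measure \<nu> (- \<phi> (inv y \<otimes> p) ` U2) = 1 - measure \<nu> (\<phi> (inv y \<otimes> p) ` U2)"
          using \<eta>.prob_compl[OF U_sets(2)[OF yg(2)]] by (simp add: Compl_eq_Diff_UNIV)
        ultimately have 1: "1/2 \<le> measure \<nu> (\<phi> (inv y \<otimes> g) ` U1)" using p by auto
        have ysg: "inv (y \<otimes> s) \<otimes> g \<in> carrier G" using y sc gc by auto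
        have "\<phi> q ` U2 \<subseteq> \<phi> g ` U2" using True disj_g[OF qc] unfolding R_def by blast
        then have "\<phi> (inv (y \<otimes> s)) ` \<phi> q ` U2 \<subseteq> \<phi> (inv (y \<otimes> s)) ` \<phi> g ` U2" by (rule image_mono)
        then have "\<phi> (inv (y \<otimes> s) \<otimes> q) ` U2 \<subseteq> \<phi> (inv (y \<otimes> s) \<otimes> g) ` U2"
          using y sc gc qc by (simp add: image_mult)
        then have "measure \<nu> (\<phi> (inv (y \<otimes> s) \<otimes> q) ` U2) \<le> measure \<nu> (\<phi> (inv (y \<otimes> s) \<otimes> g) ` U2)"
          using U_sets[OF ysg] by (intro \<eta>.finite_measure_mono)
        then have "1/2 \<le> measure \<nu> (\<phi> (inv (y \<otimes> s) \<otimes> g) ` U2)" using q by auto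
        moreover have "inv (y \<otimes> s) \<otimes> g = inv s \<otimes> (inv y \<otimes> g)"
          using y sc gc by (simp add: inv_mult_group m_assoc)
        ultimately have "inv y \<otimes> g \<in> F' s" using 1 yg by (simp add: F'_def)
        moreover have "g = y \<otimes> (inv y \<otimes> g)" using y gc by (simp add: m_assoc[symmetric])
        ultimately show ?thesis by blast
      qed (use g in blast)
    qed
    then have "card ?Q \<le> card ({h\<in>?Q. \<not> (R p h \<and> R h q)} \<union> (\<lambda>u. y \<otimes> u) ` F' s)"
    proof (rule card_mono[rotated])
      show "finite ({h\<in>?Q. \<not> (R p h \<and> R h q)} \<union> (\<lambda>u. y \<otimes> u) ` F' s)"
        using finite_subset[OF _ Q(1), of "{h\<in>?Q. \<not> (R p h \<and> R h q)}"] F'[OF s] by blast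
    qed
    also have "\<dots> \<le> card {h\<in>?Q. \<not> (R p h \<and> R h q)} + card ((\<lambda>u. y \<otimes> u) ` F' s)" by (rule card_Un_le)
    also have "\<dots> \<le> 2 * f + f'"
      using pq card_image_le[OF F'[OF s], of "\<lambda>u. y \<otimes> u"] f'[OF s] unfolding f_def by linarith
    finally show ?thesis .
  next
    case True
    show ?thesis unfolding True by simp
  qed
  \<comment> \<open>The elements not between the extremes number at most \<open>2 * f\<close>, and
    each of at most \<open>2 * k\<close> edges crosses at most \<open>2 * f + f'\<close>
    others.\<close>
  define C where "C = 2 * (2 * f + f')"
  have "card {g \<in> word_ball S k. \<phi> (inv g) x \<in> A1 \<and> \<phi> (inv g) y \<in> A2} \<le> C * Suc k" for x y k
  proof -
    define T where "T = {g \<in> word_ball S k. \<phi> (inv g) x \<in> A1 \<and> \<phi> (inv g) y \<in> A2}"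
    have T: "finite T" "T \<subseteq> carrier G"
      unfolding T_def using finite_word_ball[OF S(1)] word_ball_closed[OF S(2)] by auto
    \<comment> \<open>The element u carries the inverse images of x and y under h to those under g,
      so A1 and A2 both meet their images under u. Unless u is in F, one of the two inclusions holds
      for u, and translating it by g makes g and h comparable.\<close>
    have comp: "inv g \<otimes> h \<in> F \<or> R g h \<or> R h g" if g: "g \<in> T" and h: "h \<in> T" for g h
    proof (rule ccontr)
      assume not: "\<not> ?thesis"
      have gc: "g \<in> carrier G" and hc: "h \<in> carrier G" using g h T by auto
      define u where "u = inv g \<otimes> h"
      have uc: "u \<in> carrier G" using gc hc by (simp add: u_def)
      have u: "\<phi> u (\<phi> (inv h) z) = \<phi> (inv g) z" for z
        unfolding u_def using gc hc by (simp add: act_mult act_inv)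
      have gu: "g \<otimes> u = h" using gc hc by (simp add: u_def m_assoc[symmetric])
      have gu_image: "\<phi> g ` \<phi> u ` (- V) = - \<phi> h ` V" for V
        using image_mult[OF gc uc, of "- V"] \<phi>_Compl[OF hc, of V] by (simp only: gu)
      have "\<phi> u (\<phi> (inv h) x) \<in> A1" "\<phi> (inv h) x \<in> A1" "\<phi> u (\<phi> (inv h) y) \<in> A2" "\<phi> (inv h) y \<in> A2"
        using g h by (simp_all add: T_def u)
      then have "\<phi> u ` A1 \<inter> A1 \<noteq> {}" "\<phi> u ` A2 \<inter> A2 \<noteq> {}" by blast+
      moreover have "\<not> \<phi> u ` (- U2) \<subseteq> U1"
      proof
        assume "\<phi> u ` (- U2) \<subseteq> U1"
        then have "\<phi> g ` \<phi> u ` (- U2) \<subseteq> \<phi> g ` U1" by (rule image_mono)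
        then have "R h g" unfolding R_def gu_image by blast
        with not show False by blast
      qed
      moreover have "\<not> \<phi> u ` (- U1) \<subseteq> U2"
      proof
        assume "\<phi> u ` (- U1) \<subseteq> U2"
        then have "\<phi> g ` \<phi> u ` (- U1) \<subseteq> \<phi> g ` U2" by (rule image_mono)
        then have "R g h" unfolding R_def gu_image by blast
        with not show False by blast
      qed
      ultimately have "u \<in> F" using uc by (simp add: F_def)
      with not show False by (simp add: u_def)
    qed
    have "card T \<le> C * Suc k"
    proof (cases "T = {}")
      case False
      obtain p q where p: "p \<in> T" and q: "q \<in> T" and pq: "card {h\<in>T. \<not> (R p h \<and> R h q)} \<le> 2 * Suc (card F)"
      proof (rule almost_extremal[OF T(1) False T(2) F, of R])
        show "\<not> R g g" if "g \<in> T" for g using that T irrefl by blast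
        show "R g k" if "g \<in> T" "h \<in> T" "k \<in> T" "R g h" "R h k" for g h k
          using that T trans by blast
      qed (use comp in blast)+
      have pc: "p \<in> carrier G" and qc: "q \<in> carrier G" using p q T by auto
      have "inv p \<otimes> q \<in> word_ball S (k + k)"
        using p q by (intro word_ball_mult[OF S(2)] word_ball_inv[OF S(2)]) (auto simp: T_def)
      then obtain xs where xs: "inv p \<otimes> q = word_prod G xs" "length xs \<le> 2 * k" "set xs \<subseteq> ?S"
        unfolding word_ball_def by (auto simp: mult_2)
      have xsc: "set xs \<subseteq> carrier G" using xs(3) Sc by blast
      \<comment> \<open>The vertices of a path from p to q; both ends lie in the ball of radius k,
        so it has at most 2k edges.\<close>
      define z where "z j = p \<otimes> word_prod G (take j xs)" for j
      have takec: "word_prod G (take j xs) \<in> carrier G" for j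
        using xsc set_take_subset[of j xs] by (intro word_prod_closed) blast
      have zc: "z j \<in> carrier G" for j using takec pc by (simp add: z_def)
      have z_Suc: "z (Suc j) = z j \<otimes> xs ! j" if j: "j < length xs" for j
      proof -
        have "set (take j xs) \<subseteq> carrier G" "set [xs ! j] \<subseteq> carrier G"
          using xsc set_take_subset[of j xs] nth_mem[OF j] by auto
        then have "word_prod G (take (Suc j) xs) = word_prod G (take j xs) \<otimes> word_prod G [xs ! j]"
          unfolding take_Suc_conv_app_nth[OF j] by (rule word_prod_append)
        then show ?thesis using pc takec xsc nth_mem[OF j] by (auto simp: z_def m_assoc)
      qed
      define Q where "Q j = {g\<in>T. measure \<nu> (\<phi> (inv (z j) \<otimes> g) ` U2) < 1/2 \<and>
          1/2 \<le> measure \<nu> (\<phi> (inv (z j \<otimes> xs ! j) \<otimes> g) ` U2)}" for j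
      have cQ: "card (Q j) \<le> 2 * f + f'" if "j < length xs" for j
        unfolding Q_def using xs(3) nth_mem[OF that] by (intro step_bound T comp zc) auto
      have "T \<subseteq> {h\<in>T. \<not> (R p h \<and> R h q)} \<union> (\<Union>j<length xs. Q j)"
      proof
        fix g assume g: "g \<in> T"
        then have gc: "g \<in> carrier G" using T by auto
        show "g \<in> {h\<in>T. \<not> (R p h \<and> R h q)} \<union> (\<Union>j<length xs. Q j)"
        proof (cases "R p g \<and> R g q")
          case True
          have "\<phi> g ` U2 \<subseteq> \<phi> p ` U2" using True disj_g[OF gc] unfolding R_def by blast
          then have "\<phi> (inv p) ` \<phi> g ` U2 \<subseteq> \<phi> (inv p) ` \<phi> p ` U2" by (rule image_mono)
          also have "\<phi> (inv p) ` \<phi> p ` U2 = U2" using act_inv(1)[OF pc] by (simp add: image_image)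
          finally have "measure \<nu> (\<phi> (inv p \<otimes> g) ` U2) \<le> measure \<nu> U2"
            using pc gc U by (intro \<eta>.finite_measure_mono) (auto simp: image_mult sets_\<nu>)
          then have start: "measure \<nu> (\<phi> (inv p \<otimes> g) ` U2) < 1/2" using small by linarith
          have qg: "inv q \<otimes> g \<in> carrier G" using qc gc by auto
          have "- \<phi> g ` U2 \<subseteq> \<phi> q ` U1" using True unfolding R_def by blast
          then have "\<phi> (inv q) ` (- \<phi> g ` U2) \<subseteq> \<phi> (inv q) ` \<phi> q ` U1" by (rule image_mono)
          also have "\<phi> (inv q) ` \<phi> q ` U1 = U1" using act_inv(1)[OF qc] by (simp add: image_image)
          also have "\<phi> (inv q) ` (- \<phi> g ` U2) = - \<phi> (inv q \<otimes> g) ` U2"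
            using qc gc by (simp add: \<phi>_Compl image_mult)
          finally have "measure \<nu> (- \<phi> (inv q \<otimes> g) ` U2) \<le> measure \<nu> U1"
            using U by (intro \<eta>.finite_measure_mono) (auto simp: sets_\<nu>)
          moreover have "measure \<nu> (- \<phi> (inv q \<otimes> g) ` U2) = 1 - measure \<nu> (\<phi> (inv q \<otimes> g) ` U2)"
            using \<eta>.prob_compl[OF U_sets(2)[OF qg]] by (simp add: Compl_eq_Diff_UNIV)
          ultimately have fin: "1/2 \<le> measure \<nu> (\<phi> (inv q \<otimes> g) ` U2)" using small by linarith
          \<comment> \<open>The vertex p is not on the U2 side of g because gU2 lies in pU2; the
            vertex q is, because the complement of gU2 lies in qU1. Hence every g between p and q is
            crossed on some edge.\<close>
          define R' where "R' v \<longleftrightarrow> 1/2 \<le> measure \<nu> (\<phi> (inv (p \<otimes> v) \<otimes> g) ` U2)" for v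
          have "p \<otimes> word_prod G xs = q" using pc qc by (simp add: xs(1)[symmetric] m_assoc[symmetric])
          then have "R' (word_prod G xs)" using fin by (simp add: R'_def)
          moreover have "\<not> R' (word_prod G [])" using start pc by (simp add: R'_def)
          ultimately obtain j where j: "j < length xs" "\<not> R' (word_prod G (take j xs))" "R' (word_prod G (take (Suc j) xs))"
            using crossing[of R' xs] by blast
          then have "g \<in> Q j" using g z_Suc[OF j(1)] by (simp add: Q_def R'_def z_def not_le)
          with j(1) show ?thesis by blast
        qed (use g in blast)
      qed
      then have "card T \<le> card ({h\<in>T. \<not> (R p h \<and> R h q)} \<union> (\<Union>j<length xs. Q j))"
        using T(1) by (intro card_mono) (auto simp: Q_def)
      also have "\<dots> \<le> card {h\<in>T. \<not> (R p h \<and> R h q)} + card (\<Union>j<length xs. Q j)" by (rule card_Un_le)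
      also have "card (\<Union>j<length xs. Q j) \<le> (\<Sum>j<length xs. card (Q j))" by (rule card_UN_le) simp
      also have "\<dots> \<le> (\<Sum>j<length xs. 2 * f + f')" by (intro sum_mono cQ) simp
      also have "\<dots> \<le> 2 * k * (2 * f + f')" using xs(2) by simp
      also have "card {h\<in>T. \<not> (R p h \<and> R h q)} \<le> 2 * f" using pq by (simp add: f_def)
      finally have "card T \<le> 2 * f + 2 * k * (2 * f + f')" by simp
      also have "\<dots> \<le> C * Suc k" by (simp add: C_def algebra_simps)
      finally show ?thesis .
    qed simp
    then show ?thesis by (simp add: T_def)
  qed
  with that show thesis by blast
qed

end

subsection \<open>Comparison of entropies\<close>

context group begin

lemma generate_word:
  assumes S: "S \<subseteq> carrier G" and g: "g \<in> generate G S"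
  obtains k where "g \<in> word_ball S k"
proof -
  have "\<exists>k. g \<in> word_ball S k"
    using g
  proof (induction rule: generate.induct)
    case one
    have "\<one> \<in> word_ball S 0" unfolding word_ball_def by auto
    then show ?case by blast
  next
    case (incl h)
    then have "h = word_prod G [h]" "set [h] \<subseteq> S \<union> (\<lambda>s. inv s) ` S" using S by auto
    then have "h \<in> word_ball S 1" unfolding word_ball_def by (intro CollectI exI[of _ "[h]"]) auto
    then show ?case by blast
  next
    case (inv h)
    then have "inv h = word_prod G [inv h]" "set [inv h] \<subseteq> S \<union> (\<lambda>s. inv s) ` S" using S by auto
    then have "inv h \<in> word_ball S 1" unfolding word_ball_def by (intro CollectI exI[of _ "[inv h]"]) auto
    then show ?case by blast
  next
    case (eng h1 h2)
    then show ?case using word_ball_mult[OF S] by blast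
  qed
  then show thesis using that by blast
qed

text \<open>As g is generated by S, some word represents it, so the least length is attained by a
  word.\<close>

lemma word_metric_ball:
  assumes S: "S \<subseteq> carrier G" and g: "g \<in> generate G S" and le: "word_metric G S \<one> g \<le> r"
  shows "g \<in> word_ball S r"
proof -
  have gc: "g \<in> carrier G" using generate_incl[OF S] g by blast
  let ?P = "\<lambda>n. \<exists>xs. length xs = n \<and> set xs \<subseteq> S \<union> (\<lambda>s. inv s) ` S \<and> word_prod G xs = inv \<one> \<otimes> g"
  obtain k where "g \<in> word_ball S k" by (rule generate_word[OF S g])
  then obtain xs where "length xs \<le> k" "set xs \<subseteq> S \<union> (\<lambda>s. inv s) ` S" "g = word_prod G xs"
    unfolding word_ball_def by blast
  then have "?P (length xs)" using gc by auto
  then have "?P (LEAST n. ?P n)" by (rule LeastI)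
  then obtain ys where "length ys = word_metric G S \<one> g" "set ys \<subseteq> S \<union> (\<lambda>s. inv s) ` S" "word_prod G ys = g"
    using gc unfolding word_metric_def by auto
  then show ?thesis unfolding word_ball_def using le by (intro CollectI exI[of _ ys]) auto
qed

lemma word_prod_ball:
  assumes S: "S \<subseteq> carrier G" and "set xs \<subseteq> word_ball S r"
  shows "word_prod G xs \<in> word_ball S (length xs * r)"
  using assms(2)
proof (induction xs)
  case Nil
  have "\<one> \<in> word_ball S 0" unfolding word_ball_def by auto
  then show ?case by simp
next
  case (Cons x xs)
  then have "x \<otimes> word_prod G xs \<in> word_ball S (r + length xs * r)"
    by (intro word_ball_mult[OF S]) auto
  then show ?case by simp
qed

end

lemma nn_integral_replicate_pmf_sum:
  fixes f :: "'a \<Rightarrow> ennreal"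
  shows "(\<integral>\<^sup>+xs. (\<Sum>x\<leftarrow>xs. f x) \<partial>replicate_pmf n p) = of_nat n * (\<integral>\<^sup>+x. f x \<partial>p)"
proof (induction n)
  case (Suc n)
  have "(\<integral>\<^sup>+xs. (\<Sum>x\<leftarrow>xs. f x) \<partial>replicate_pmf (Suc n) p) =
      (\<integral>\<^sup>+x. \<integral>\<^sup>+xs. f x + (\<Sum>x\<leftarrow>xs. f x) \<partial>replicate_pmf n p \<partial>p)"
    by simp
  also have "\<dots> = (\<integral>\<^sup>+x. f x \<partial>p) + of_nat n * (\<integral>\<^sup>+x. f x \<partial>p)"
    by (simp add: nn_integral_add Suc measure_pmf.emeasure_space_1)
  finally show ?case by (simp add: distrib_right)
qed simp

context walk begin

text \<open>The walk reaches the product at least with the probability of this one sequence of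
  increments. Positivity runs along in the induction because \<open>ln 0 = 0\<close> would
  invalidate the product rule.\<close>

lemma neg_ln_step_le:
  assumes "set xs \<subseteq> set_pmf \<mu>"
  shows "ennreal (- ln (pmf (step (length xs)) (word_prod G xs))) \<le> (\<Sum>x\<leftarrow>xs. ennreal (- ln (pmf \<mu> x)))"
    and "0 < pmf (step (length xs)) (word_prod G xs)"
  using assms
proof (induction xs)
  case (Cons x xs)
  { case 1
    have x: "0 < pmf \<mu> x" "pmf \<mu> x \<le> 1" using 1 by (auto simp: pmf_positive_iff pmf_le_1)
    have w: "0 < pmf (step (length xs)) (word_prod G xs)" using Cons.IH(2) 1 by simp
    have "ln (pmf \<mu> x) + ln (pmf (step (length xs)) (word_prod G xs)) = ln (pmf \<mu> x * pmf (step (length xs)) (word_prod G xs))"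
      using x w by (simp add: ln_mult)
    also have "\<dots> \<le> ln (pmf (step (Suc (length xs))) (x \<otimes> word_prod G xs))"
      using x w pmf_step_Suc[of x "length xs" "word_prod G xs"] by (intro ln_mono) auto
    finally have "- ln (pmf (step (length (x # xs))) (word_prod G (x # xs))) \<le>
        - ln (pmf \<mu> x) + - ln (pmf (step (length xs)) (word_prod G xs))" by simp
    then have "ennreal (- ln (pmf (step (length (x # xs))) (word_prod G (x # xs)))) \<le>
        ennreal (- ln (pmf \<mu> x) + - ln (pmf (step (length xs)) (word_prod G xs)))" by (rule ennreal_leI)
    also have "\<dots> = ennreal (- ln (pmf \<mu> x)) + ennreal (- ln (pmf (step (length xs)) (word_prod G xs)))"
      using x w by (intro ennreal_plus) (auto simp: pmf_le_1)
    also have "\<dots> \<le> ennreal (- ln (pmf \<mu> x)) + (\<Sum>x\<leftarrow>xs. ennreal (- ln (pmf \<mu> x)))"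
      using Cons.IH(1) 1 by (intro add_left_mono) simp
    finally show ?case by simp
  next
    case 2
    then have "0 < pmf \<mu> x * pmf (step (length xs)) (word_prod G xs)"
      using Cons.IH(2) by (auto simp: pmf_positive_iff)
    also have "\<dots> \<le> pmf (step (Suc (length xs))) (x \<otimes> word_prod G xs)" by (rule pmf_step_Suc)
    finally show ?case by simp
  }
qed auto

end

context convergence_walk begin

text \<open>Reduction to fixed pairs of balls. Points at distance at least d have centres in a
  d/8-net at distance at least 3d/4, and this exceeds the d/2 needed for the closed d/4-balls to be
  disjoint. There are finitely many pairs of centres.\<close>

lemma strip_growth:
  assumes S: "finite S" "S \<subseteq> carrier G" and d: "d > 0" and small: "\<And>y. measure \<nu> (ball y d) < 1/2"
  obtains C where "\<And>x y k. card {g \<in> word_ball S k. d \<le> dist (\<phi> (inv g) x) (\<phi> (inv g) y)} \<le> C * Suc k"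
proof -
  obtain N where N: "finite N" "(UNIV :: 'm set) \<subseteq> (\<Union>x\<in>N. ball x (d / 8))"
    using compact_space d unfolding compact_eq_totally_bounded by (metis zero_less_divide_iff zero_less_numeral)
  define I where "I = {(p, q). p \<in> N \<and> q \<in> N \<and> 3/4 * d \<le> dist p q}"
  have "I \<subseteq> N \<times> N" by (auto simp: I_def)
  then have I: "finite I" using N(1) finite_subset by blast
  have "\<exists>C. \<forall>x y k. card {g \<in> word_ball S k. \<phi> (inv g) x \<in> cball p (d/8) \<and> \<phi> (inv g) y \<in> cball q (d/8)} \<le> C * Suc k"
    if pq: "(p, q) \<in> I" for p q
  proof -
    have disj: "cball p (d/4) \<inter> cball q (d/4) = {}"
    proof (rule ccontr)
      assume "\<not> ?thesis"
      then obtain z where "dist p z \<le> d/4" "dist q z \<le> d/4" by auto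
      then have "dist p q \<le> d/2" using dist_triangle2[of p q z] by linarith
      with pq d show False by (auto simp: I_def)
    qed
    have sm: "measure \<nu> (ball p (d/4)) < 1/2" for p
    proof -
      have "measure \<nu> (ball p (d/4)) \<le> measure \<nu> (ball p d)"
        using d by (intro \<eta>.finite_measure_mono subset_ball) (auto simp: sets_\<nu>)
      with small[of p] show ?thesis by linarith
    qed
    obtain C where "\<And>x y k. card {g \<in> word_ball S k. \<phi> (inv g) x \<in> cball p (d/8) \<and> \<phi> (inv g) y \<in> cball q (d/8)} \<le> C * Suc k"
    proof (rule strip_linear_growth[OF S closed_cball closed_cball open_ball open_ball _ _ closed_cball closed_cball _ _ disj sm sm])
      show "cball p (d/8) \<subseteq> ball p (d/4)" "cball q (d/8) \<subseteq> ball q (d/4)" using d by (auto simp: subset_eq)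
      show "ball p (d/4) \<subseteq> cball p (d/4)" "ball q (d/4) \<subseteq> cball q (d/4)" by (auto simp: subset_eq)
    qed blast
    then show ?thesis by blast
  qed
  then have "\<forall>pq\<in>I. \<exists>C. \<forall>x y k. card {g \<in> word_ball S k. \<phi> (inv g) x \<in> cball (fst pq) (d/8) \<and> \<phi> (inv g) y \<in> cball (snd pq) (d/8)} \<le> C * Suc k"
    by auto
  from bchoice[OF this] obtain C where C: "\<And>p q x y k. (p, q) \<in> I \<Longrightarrow>
      card {g \<in> word_ball S k. \<phi> (inv g) x \<in> cball p (d/8) \<and> \<phi> (inv g) y \<in> cball q (d/8)} \<le> C (p, q) * Suc k"
    by force
  have "card {g \<in> word_ball S k. d \<le> dist (\<phi> (inv g) x) (\<phi> (inv g) y)} \<le> (\<Sum>pq\<in>I. C pq) * Suc k" for x y k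
  proof -
    define B where "B pq = {g \<in> word_ball S k. \<phi> (inv g) x \<in> cball (fst pq) (d/8) \<and> \<phi> (inv g) y \<in> cball (snd pq) (d/8)}" for pq
    have finB: "finite (B pq)" for pq unfolding B_def using finite_word_ball[OF S(1)] by simp
    have "{g \<in> word_ball S k. d \<le> dist (\<phi> (inv g) x) (\<phi> (inv g) y)} \<subseteq> (\<Union>pq\<in>I. B pq)"
    proof
      fix g assume g: "g \<in> {g \<in> word_ball S k. d \<le> dist (\<phi> (inv g) x) (\<phi> (inv g) y)}"
      obtain p q where p: "p \<in> N" "dist p (\<phi> (inv g) x) < d/8" and q: "q \<in> N" "dist q (\<phi> (inv g) y) < d/8"
      proof -
        have "\<phi> (inv g) x \<in> (\<Union>x\<in>N. ball x (d / 8))" "\<phi> (inv g) y \<in> (\<Union>x\<in>N. ball x (d / 8))" using N(2) by blast+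
        then show thesis using that by auto
      qed
      have "d \<le> dist (\<phi> (inv g) x) (\<phi> (inv g) y)" using g by simp
      also have "\<dots> \<le> dist p (\<phi> (inv g) x) + dist p q + dist q (\<phi> (inv g) y)"
        using dist_triangle[of "\<phi> (inv g) x" "\<phi> (inv g) y" p] dist_triangle[of p "\<phi> (inv g) y" q]
        by (simp add: dist_commute)
      finally have "3/4 * d \<le> dist p q" using p(2) q(2) by linarith
      then have "(p, q) \<in> I" using p q by (simp add: I_def)
      moreover have "g \<in> B (p, q)" using g p q by (simp add: B_def)
      ultimately show "g \<in> (\<Union>pq\<in>I. B pq)" by blast
    qed
    then have "card {g \<in> word_ball S k. d \<le> dist (\<phi> (inv g) x) (\<phi> (inv g) y)} \<le> card (\<Union>pq\<in>I. B pq)"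
      using I finB by (intro card_mono) auto
    also have "\<dots> \<le> (\<Sum>pq\<in>I. card (B pq))" by (rule card_UN_le[OF I])
    also have "\<dots> \<le> (\<Sum>pq\<in>I. C pq * Suc k)"
      using C by (intro sum_mono) (auto simp: B_def)
    finally show ?thesis by (simp only: sum_distrib_right)
  qed
  with that show thesis by blast
qed

text \<open>The conditional law of \<open>w_n\<close> given its limit \<open>y\<close> is compared with the uniform law on the strip
  between \<open>y\<close> and a fixed base point.  As \<open>w_n\<close> is independent of \<open>w_n\<inverse> y\<close>, which has the
  nonatomic law \<open>\<nu>\<close>, it lies in the strip with probability close to 1.\<close>

lemma entropy_step_strip:
  assumes S: "finite S" "S \<subseteq> carrier G" and d: "d > 0" and s: "\<And>y. measure \<nu> (ball y d) \<le> s"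
    and C: "C \<ge> 1" "\<And>x y k. card {g \<in> word_ball S k. d \<le> dist (\<phi> (inv g) x) (\<phi> (inv g) y)} \<le> C * Suc k"
  shows "(\<integral>\<^sup>+g. ennreal (- ln (pmf (step n) g)) \<partial>step n) \<le> (\<integral>\<^sup>+g. ennreal (ent g) \<partial>step n) +
    (ennreal (ln 2 + ln (real (C * Suc R))) +
      (\<integral>\<^sup>+g. ennreal (- ln (pmf (step n) g)) * (ennreal s + indicator (- word_ball S R) g) \<partial>step n))"
proof -
  \<comment> \<open>The base point is arbitrary.\<close>
  define z :: 'm where "z = undefined"
  have s0: "0 \<le> s" using s[of z] measure_nonneg[of \<nu> "ball z d"] by linarith
  define good where "good y g \<longleftrightarrow> g \<in> word_ball S R \<and> d \<le> dist (\<phi> (inv g) z) (\<phi> (inv g) y)" for y g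
  define c where "c = real (C * Suc R)"
  have c: "c \<ge> 1"
  proof -
    have "1 * 1 \<le> C * Suc R" using C(1) by (intro mult_le_mono) auto
    then have "real (1 * 1) \<le> real (C * Suc R)" by (rule of_nat_mono)
    then show ?thesis by (simp only: c_def mult_1 of_nat_1)
  qed
  \<comment> \<open>Half of the mass is spread evenly over the strip, which has at most c elements;
    the other half follows \<open>step n\<close>. The second half makes Q positive off the strip
    too, where the code is only \<open>ln 2\<close> longer than that of
    \<open>step n\<close>.\<close>
  define Q where "Q y g = (if good y g then 1 else 0) / (2 * c) + pmf (step n) g / 2" for y g
  define \<Lambda> where "\<Lambda> g = - ln (pmf (step n) g)" for g
  have Q_ge1: "Q y g \<ge> pmf (step n) g / 2" for y g using c by (simp add: Q_def)
  have Q_ge2: "Q y g \<ge> 1 / (2 * c)" if "good y g" for y g using c that by (simp add: Q_def pmf_nonneg)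
  have "(\<integral>\<^sup>+g. ennreal (- ln (pmf (step n) g)) \<partial>step n)
    \<le> (\<integral>\<^sup>+g. ennreal (ent g) \<partial>step n) + (\<integral>\<^sup>+g. \<integral>\<^sup>+y. ennreal (- ln (Q (\<phi> g y) g)) \<partial>\<nu> \<partial>step n)"
  proof (rule entropy_step_le)
    fix g assume g: "g \<in> carrier G"
    have [measurable]: "\<phi> (inv g) \<in> \<nu> \<rightarrow>\<^sub>M borel"
      using meas[of "inv g"] g by (simp add: measurable_cong_sets[OF refl sets_\<nu>])
    have [measurable]: "(\<lambda>x. dist (\<phi> (inv g) z) x) \<in> borel_measurable borel"
      by (intro borel_measurable_continuous_onI continuous_intros)
    have [measurable]: "(\<lambda>y. dist (\<phi> (inv g) z) (\<phi> (inv g) y)) \<in> borel_measurable \<nu>" by measurable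
    show "(\<lambda>y. Q y g) \<in> borel_measurable \<nu>" unfolding Q_def good_def by measurable
  next
    fix g y assume "g \<in> set_pmf (step n)"
    then have "0 < pmf (step n) g" by (rule pmf_positive)
    then show "0 < Q y g" using Q_ge1[of g y] by linarith
    have "(if good y g then 1 else 0) / (2 * c) \<le> 1 / 2" using c by (simp add: field_simps)
    then show "Q y g \<le> 1" unfolding Q_def using pmf_le_1[of "step n" g] by linarith
  next
    fix y
    let ?D = "set_pmf (step n)"
    have sub: "{g \<in> ?D. good y g} \<subseteq> {g \<in> word_ball S R. d \<le> dist (\<phi> (inv g) z) (\<phi> (inv g) y)}"
      by (auto simp: good_def)
    have fin: "finite {g \<in> word_ball S R. d \<le> dist (\<phi> (inv g) z) (\<phi> (inv g) y)}"
      using finite_word_ball[OF S(1)] by simp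
    have "card {g \<in> ?D. good y g} \<le> C * Suc R"
      using card_mono[OF fin sub] C(2)[of R z y] by linarith
    then have card: "real (card {g \<in> ?D. good y g}) \<le> c" unfolding c_def by (rule of_nat_mono)
    have "(\<integral>\<^sup>+g. ennreal (Q y g) \<partial>count_space ?D) =
        (\<integral>\<^sup>+g. ennreal (1 / (2 * c)) * indicator {g \<in> ?D. good y g} g + ennreal (1/2) * ennreal (pmf (step n) g) \<partial>count_space ?D)"
    proof (rule nn_integral_cong)
      fix g assume "g \<in> space (count_space ?D)"
      then show "ennreal (Q y g) = ennreal (1 / (2 * c)) * indicator {g \<in> ?D. good y g} g + ennreal (1/2) * ennreal (pmf (step n) g)"
      proof -
        assume g: "g \<in> space (count_space ?D)"
        have "ennreal (1/2) * ennreal (pmf (step n) g) = ennreal (pmf (step n) g / 2)"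
          by (subst ennreal_mult[symmetric]) simp_all
        then show ?thesis
          using c g by (cases "good y g") (simp_all add: Q_def indicator_def ennreal_plus[symmetric] del: ennreal_plus)
      qed
    qed
    also have "\<dots> = ennreal (1 / (2 * c)) * (\<integral>\<^sup>+g. indicator {g \<in> ?D. good y g} g \<partial>count_space ?D) +
        ennreal (1/2) * (\<integral>\<^sup>+g. ennreal (pmf (step n) g) \<partial>count_space ?D)"
      by (simp add: nn_integral_add nn_integral_cmult)
    also have "(\<integral>\<^sup>+g. indicator {g \<in> ?D. good y g} g \<partial>count_space ?D) = ennreal (real (card {g \<in> ?D. good y g}))"
      using finite_subset[OF sub fin] by (subst nn_integral_indicator) (auto simp: emeasure_count_space ennreal_of_nat_eq_real_of_nat)
    also have "(\<integral>\<^sup>+g. ennreal (pmf (step n) g) \<partial>count_space ?D) = ennreal 1"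
      using measure_pmf.emeasure_space_1[of "step n"] by (simp add: nn_integral_pmf emeasure_pmf)
    also have "ennreal (1 / (2 * c)) * ennreal (real (card {g \<in> ?D. good y g})) + ennreal (1/2) * ennreal 1 =
        ennreal (1 / (2 * c) * real (card {g \<in> ?D. good y g}) + 1/2)"
      unfolding ennreal_1 mult_1_right
      by (subst ennreal_mult[symmetric], use c in simp, simp, rule ennreal_plus[symmetric]) (use c in auto)
    also have "\<dots> \<le> ennreal 1"
      using c card by (intro ennreal_leI) (simp add: field_simps)
    finally show "(\<integral>\<^sup>+g. ennreal (Q y g) \<partial>count_space ?D) \<le> 1" by simp
  qed
  also have "\<dots> \<le> (\<integral>\<^sup>+g. ennreal (ent g) \<partial>step n) + (\<integral>\<^sup>+g. ennreal (ln 2 + ln c) + ennreal (\<Lambda> g) * (ennreal s + indicator (- word_ball S R) g) \<partial>step n)"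
  proof (intro add_left_mono nn_integral_mono_AE AE_pmfI)
    fix g assume g: "g \<in> set_pmf (step n)"
    then have gc: "g \<in> carrier G" using set_step by auto
    have p: "0 < pmf (step n) g" "pmf (step n) g \<le> 1" using g by (auto simp: pmf_positive_iff pmf_le_1)
    have \<Lambda>: "0 \<le> \<Lambda> g" using p by (simp add: \<Lambda>_def)
    let ?B = "ball (\<phi> (inv g) z) d"
    have B: "?B \<in> sets \<nu>" by (simp add: sets_\<nu>)
    have pt: "ennreal (- ln (Q (\<phi> g y) g)) \<le> ennreal (ln 2 + ln c) +
        (ennreal (\<Lambda> g) * indicator (- word_ball S R) g + ennreal (\<Lambda> g) * indicator ?B y)" for y
    proof (cases "good (\<phi> g y) g")
      case True
      have "ln (1 / (2 * c)) \<le> ln (Q (\<phi> g y) g)" using Q_ge2[OF True] c by (intro ln_mono) auto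
      then have "- ln (Q (\<phi> g y) g) \<le> ln 2 + ln c" using c by (simp add: ln_div ln_mult)
      then have "ennreal (- ln (Q (\<phi> g y) g)) \<le> ennreal (ln 2 + ln c) + 0"
        by (simp add: ennreal_leI)
      also have "\<dots> \<le> ennreal (ln 2 + ln c) +
          (ennreal (\<Lambda> g) * indicator (- word_ball S R) g + ennreal (\<Lambda> g) * indicator ?B y)"
        by (intro add_left_mono zero_le)
      finally show ?thesis .
    next
      case False
      have "ln (pmf (step n) g / 2) \<le> ln (Q (\<phi> g y) g)" using Q_ge1 p by (intro ln_mono) auto
      then have "- ln (Q (\<phi> g y) g) \<le> ln 2 + \<Lambda> g" using p by (simp add: \<Lambda>_def ln_div)
      then have "- ln (Q (\<phi> g y) g) \<le> (ln 2 + ln c) + \<Lambda> g" using c ln_ge_zero[of c] by linarith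
      then have "ennreal (- ln (Q (\<phi> g y) g)) \<le> ennreal ((ln 2 + ln c) + \<Lambda> g)" by (rule ennreal_leI)
      also have "\<dots> = ennreal (ln 2 + ln c) + ennreal (\<Lambda> g)" using c \<Lambda> by (intro ennreal_plus) auto
      also have "ennreal (ln 2 + ln c) + ennreal (\<Lambda> g) \<le> ennreal (ln 2 + ln c) +
          (ennreal (\<Lambda> g) * indicator (- word_ball S R) g + ennreal (\<Lambda> g) * indicator ?B y)"
      proof (rule add_left_mono)
        have "g \<notin> word_ball S R \<or> y \<in> ?B" using False act_inv(1)[OF gc, of y] by (auto simp: good_def not_le)
        then show "ennreal (\<Lambda> g) \<le> ennreal (\<Lambda> g) * indicator (- word_ball S R) g + ennreal (\<Lambda> g) * indicator ?B y"
          by (auto simp: indicator_def)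
      qed
      finally show ?thesis .
    qed
    have "(\<integral>\<^sup>+y. ennreal (- ln (Q (\<phi> g y) g)) \<partial>\<nu>) \<le> (\<integral>\<^sup>+y. ennreal (ln 2 + ln c) +
        (ennreal (\<Lambda> g) * indicator (- word_ball S R) g + ennreal (\<Lambda> g) * indicator ?B y) \<partial>\<nu>)"
      by (intro nn_integral_mono pt)
    also have "\<dots> = ennreal (ln 2 + ln c) + (ennreal (\<Lambda> g) * indicator (- word_ball S R) g + ennreal (\<Lambda> g) * emeasure \<nu> ?B)"
      using B \<eta>.emeasure_space_1 by (simp add: nn_integral_add nn_integral_cmult)
    also have "\<dots> \<le> ennreal (ln 2 + ln c) + (ennreal (\<Lambda> g) * indicator (- word_ball S R) g + ennreal (\<Lambda> g) * ennreal s)"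
      using s by (intro add_left_mono mult_left_mono) (simp_all add: \<eta>.emeasure_eq_measure ennreal_leI)
    also have "\<dots> = ennreal (ln 2 + ln c) + ennreal (\<Lambda> g) * (ennreal s + indicator (- word_ball S R) g)"
      by (simp only: distrib_left add.commute[of "ennreal (\<Lambda> g) * indicator (- word_ball S R) g"])
    finally show "(\<integral>\<^sup>+y. ennreal (- ln (Q (\<phi> g y) g)) \<partial>\<nu>) \<le>
        ennreal (ln 2 + ln c) + ennreal (\<Lambda> g) * (ennreal s + indicator (- word_ball S R) g)" .
  qed
  also have "(\<integral>\<^sup>+g. ennreal (ln 2 + ln c) + ennreal (\<Lambda> g) * (ennreal s + indicator (- word_ball S R) g) \<partial>step n) =
      ennreal (ln 2 + ln c) + (\<integral>\<^sup>+g. ennreal (\<Lambda> g) * (ennreal s + indicator (- word_ball S R) g) \<partial>step n)"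
    by (simp add: nn_integral_add measure_pmf.emeasure_space_1)
  finally show ?thesis unfolding c_def \<Lambda>_def .
qed

end

section \<open>Letting the number of steps grow\<close>

context convergence_walk begin

text \<open>The code length of \<open>w_n\<close> is bounded by the sum over its increments, each
  split into at most T and an excess. The part up to T is bounded, so the escape probabilities can
  be factored out of it; the excess is kept whole. The walk leaves the ball of radius
  \<open>n * r\<close> only if some increment leaves that of radius r, and a union bound gives the
  factor n in front of its probability.\<close>

lemma entropy_tail_le:
  fixes T :: nat
  assumes S: "S \<subseteq> carrier G" and s: "0 \<le> s" "s \<le> 1"
  shows "(\<integral>\<^sup>+g. ennreal (- ln (pmf (step n) g)) * (ennreal s + indicator (- word_ball S (n * r)) g) \<partial>step n)
    \<le> of_nat n * (of_nat T * ennreal s + of_nat T * (of_nat n * emeasure \<mu> (- word_ball S r)) +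
        2 * (\<integral>\<^sup>+x. ennreal (- ln (pmf \<mu> x) - T) \<partial>\<mu>))"
proof -
  define \<tau> where "\<tau> x = ennreal (- ln (pmf \<mu> x) - T)" for x
  define \<beta> :: "'g \<Rightarrow> ennreal" where "\<beta> x = indicator (- word_ball S r) x" for x
  have lists: "(\<integral>\<^sup>+g. f g \<partial>step n) = (\<integral>\<^sup>+xs. f (word_prod G xs) \<partial>replicate_pmf n \<mu>)" for f
    by (simp add: step_def)
  have "(\<integral>\<^sup>+g. ennreal (- ln (pmf (step n) g)) * (ennreal s + indicator (- word_ball S (n * r)) g) \<partial>step n)
    \<le> (\<integral>\<^sup>+xs. of_nat n * (of_nat T * ennreal s) + of_nat n * of_nat T * (\<Sum>x\<leftarrow>xs. \<beta> x) + 2 * (\<Sum>x\<leftarrow>xs. \<tau> x) \<partial>replicate_pmf n \<mu>)"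
    unfolding lists
  proof (intro nn_integral_mono_AE AE_pmfI)
    fix xs assume "xs \<in> set_pmf (replicate_pmf n \<mu>)"
    then have xs: "set xs \<subseteq> set_pmf \<mu>" and len: "length xs = n" by (auto simp: set_replicate_pmf)
    define b :: ennreal where "b = indicator (- word_ball S (n * r)) (word_prod G xs)"
    have b1: "b \<le> 1" by (simp add: b_def indicator_def)
    have b\<beta>: "b \<le> (\<Sum>x\<leftarrow>xs. \<beta> x)"
    proof (cases "set xs \<subseteq> word_ball S r")
      case True
      then have "b = 0" using word_prod_ball[OF S True] len by (simp add: b_def)
      then show ?thesis by simp
    next
      case False
      then obtain x where x: "x \<in> set xs" "x \<notin> word_ball S r" by blast
      have "b \<le> \<beta> x" using b1 x by (simp add: \<beta>_def)
      also have "\<beta> x \<le> (\<Sum>x\<leftarrow>xs. \<beta> x)" using x(1) by (intro member_le_sum_list) auto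
      finally show ?thesis .
    qed
    have one: "ennreal (- ln (pmf \<mu> x)) \<le> of_nat T + \<tau> x" for x
    proof -
      have "ennreal (- ln (pmf \<mu> x)) \<le> ennreal (real T + max 0 (- ln (pmf \<mu> x) - T))"
        by (rule ennreal_leI) simp
      also have "\<dots> = of_nat T + \<tau> x"
        unfolding \<tau>_def by (subst ennreal_plus) (auto simp: ennreal_of_nat_eq_real_of_nat max_def ennreal_neg)
      finally show ?thesis .
    qed
    have "(\<Sum>x\<leftarrow>xs. ennreal (- ln (pmf \<mu> x))) \<le> (\<Sum>x\<leftarrow>xs. of_nat T + \<tau> x)"
      by (rule sum_list_mono) (rule one)
    also have "\<dots> = of_nat n * of_nat T + (\<Sum>x\<leftarrow>xs. \<tau> x)"
      by (simp add: sum_list_addf sum_list_triv len)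
    finally have le: "ennreal (- ln (pmf (step n) (word_prod G xs))) \<le> of_nat n * of_nat T + (\<Sum>x\<leftarrow>xs. \<tau> x)"
      using neg_ln_step_le(1)[OF xs] len by simp
    have sb: "ennreal s + b \<le> 2"
    proof -
      have "ennreal s + b \<le> 1 + 1" using s b1 by (intro add_mono) auto
      then show ?thesis by simp
    qed
    have "ennreal (- ln (pmf (step n) (word_prod G xs))) * (ennreal s + b) \<le>
        (of_nat n * of_nat T + (\<Sum>x\<leftarrow>xs. \<tau> x)) * (ennreal s + b)"
      by (rule mult_right_mono[OF le]) simp
    also have "\<dots> = of_nat n * of_nat T * (ennreal s + b) + (\<Sum>x\<leftarrow>xs. \<tau> x) * (ennreal s + b)"
      by (rule distrib_right)
    \<comment> \<open>Only the bounded part profits from the small factor; on the excess it is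
      estimated by 2.\<close>
    also have "\<dots> \<le> of_nat n * of_nat T * (ennreal s + (\<Sum>x\<leftarrow>xs. \<beta> x)) + (\<Sum>x\<leftarrow>xs. \<tau> x) * 2"
      using b\<beta> sb by (intro add_mono mult_left_mono order_refl) auto
    also have "\<dots> = of_nat n * (of_nat T * ennreal s) + of_nat n * of_nat T * (\<Sum>x\<leftarrow>xs. \<beta> x) + 2 * (\<Sum>x\<leftarrow>xs. \<tau> x)"
      by (simp only: distrib_left mult.assoc mult.commute[of _ 2])
    finally show "ennreal (- ln (pmf (step n) (word_prod G xs))) *
        (ennreal s + indicator (- word_ball S (n * r)) (word_prod G xs)) \<le> \<dots>"
      unfolding b_def .
  qed
  also have "\<dots> = of_nat n * (of_nat T * ennreal s) + of_nat n * of_nat T * (of_nat n * (\<integral>\<^sup>+x. \<beta> x \<partial>\<mu>)) +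
      2 * (of_nat n * (\<integral>\<^sup>+x. \<tau> x \<partial>\<mu>))"
    by (simp add: nn_integral_add nn_integral_cmult nn_integral_replicate_pmf_sum measure_pmf.emeasure_space_1)
  also have "(\<integral>\<^sup>+x. \<beta> x \<partial>\<mu>) = emeasure \<mu> (- word_ball S r)" by (simp add: \<beta>_def)
  also have "of_nat n * (of_nat T * ennreal s) + of_nat n * of_nat T * (of_nat n * emeasure \<mu> (- word_ball S r)) +
      2 * (of_nat n * (\<integral>\<^sup>+x. \<tau> x \<partial>\<mu>)) = of_nat n * (of_nat T * ennreal s +
      of_nat T * (of_nat n * emeasure \<mu> (- word_ball S r)) + 2 * (\<integral>\<^sup>+x. \<tau> x \<partial>\<mu>))"
    by (simp only: distrib_left mult.assoc mult.left_commute[of 2])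
  finally show ?thesis by (simp add: \<tau>_def)
qed

lemma tail_tendsto_0:
  fixes h :: "'g \<Rightarrow> real"
  assumes fin: "(\<integral>\<^sup>+x. ennreal (h x) \<partial>\<mu>) < \<infinity>" and e: "e > 0"
  shows "(\<lambda>n. \<integral>\<^sup>+x. ennreal (h x) * indicator {x. e * real n < h x} x \<partial>\<mu>) \<longlonglongrightarrow> 0"
proof -
  have "(\<lambda>n. \<integral>\<^sup>+x. ennreal (h x) * indicator {x. e * real n < h x} x \<partial>\<mu>) \<longlonglongrightarrow> (\<integral>\<^sup>+x. 0 \<partial>\<mu>)"
  proof (rule nn_integral_dominated_convergence[where w = "\<lambda>x. ennreal (h x)"])
    show "AE x in \<mu>. (\<lambda>n. ennreal (h x) * indicator {x. e * real n < h x} x) \<longlonglongrightarrow> 0"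
    proof (rule AE_I2)
      fix x
      obtain N where "h x < real N * e" using reals_Archimedean3[OF e] by blast
      then have "\<not> e * real n < h x" if "n \<ge> N" for n
      proof -
        have "real N * e \<le> real n * e" using that e by (intro mult_right_mono) auto
        with \<open>h x < real N * e\<close> show ?thesis by (simp add: mult.commute)
      qed
      then have "\<forall>\<^sub>F n in sequentially. ennreal (h x) * indicator {x. e * real n < h x} x = 0"
        by (intro eventually_sequentiallyI[of N]) (simp add: indicator_def)
      then show "(\<lambda>n. ennreal (h x) * indicator {x. e * real n < h x} x) \<longlonglongrightarrow> 0"
        by (rule tendsto_eventually)
    qed
  qed (use fin in \<open>auto simp: indicator_def\<close>)
  then show ?thesis by simp
qed

lemma excess_tendsto_0:
  fixes h :: "'g \<Rightarrow> real"
  assumes fin: "(\<integral>\<^sup>+x. ennreal (h x) \<partial>\<mu>) < \<infinity>"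
  shows "(\<lambda>n. \<integral>\<^sup>+x. ennreal (h x - real n) \<partial>\<mu>) \<longlonglongrightarrow> 0"
proof (rule tendsto_sandwich[OF _ _ tendsto_const])
  show "(\<lambda>n. \<integral>\<^sup>+x. ennreal (h x) * indicator {x. 1 * real n < h x} x \<partial>\<mu>) \<longlonglongrightarrow> 0"
    by (rule tail_tendsto_0[OF fin]) simp
  show "\<forall>\<^sub>F n in sequentially. (\<integral>\<^sup>+x. ennreal (h x - real n) \<partial>\<mu>) \<le>
      (\<integral>\<^sup>+x. ennreal (h x) * indicator {x. 1 * real n < h x} x \<partial>\<mu>)"
    by (intro always_eventually allI nn_integral_mono) (auto simp: indicator_def ennreal_neg intro: ennreal_leI)
qed simp

text \<open>Markov's inequality for the logarithm of the word length, keeping the expectation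
  restricted to the tail. The restricted expectation tends to 0, which beats the factor n of the
  union bound.\<close>

lemma ball_compl_le:
  assumes S: "S \<subseteq> carrier G" "generate G S = carrier G" and e: "e > 0"
    and h: "\<And>x. h x = \<bar>ln (real (word_metric G S \<one> x))\<bar>"
  shows "ennreal (e * real n) * emeasure \<mu> (- word_ball S (nat \<lfloor>exp (e * real n)\<rfloor>)) \<le>
    (\<integral>\<^sup>+x. ennreal (h x) * indicator {x. e * real n < h x} x \<partial>\<mu>)"
proof -
  let ?r = "nat \<lfloor>exp (e * real n)\<rfloor>"
  have "ennreal (e * real n) * emeasure \<mu> (- word_ball S ?r) = (\<integral>\<^sup>+x. ennreal (e * real n) * indicator (- word_ball S ?r) x \<partial>\<mu>)"
    by (subst nn_integral_cmult_indicator) auto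
  also have "\<dots> \<le> (\<integral>\<^sup>+x. ennreal (h x) * indicator {x. e * real n < h x} x \<partial>\<mu>)"
  proof (intro nn_integral_mono_AE AE_pmfI)
    fix x assume "x \<in> set_pmf \<mu>"
    then have x: "x \<in> generate G S" using set_mu S by auto
    show "ennreal (e * real n) * indicator (- word_ball S ?r) x \<le> ennreal (h x) * indicator {x. e * real n < h x} x"
    proof (cases "x \<in> word_ball S ?r")
      case False
      then have "?r < word_metric G S \<one> x" using word_metric_ball[OF S(1) x, of ?r] by linarith
      \<comment> \<open>The word length is an integer above the rounded-down exponential, so it
        exceeds the exponential itself.\<close>
      then have "exp (e * real n) < real (word_metric G S \<one> x)" by linarith
      then have "e * real n < ln (real (word_metric G S \<one> x))"
        using ln_less_cancel_iff[of "exp (e * real n)" "real (word_metric G S \<one> x)"] exp_gt_zero[of "e * real n"]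
        by (smt (verit) ln_exp)
      then have "e * real n < h x" unfolding h by linarith
      then show ?thesis by (auto simp: indicator_def intro: ennreal_leI)
    qed simp
  qed
  finally show ?thesis .
qed

text \<open>For each e the parameters are chosen in the order T, s, d, C, n: the truncation level
  from the entropy tail, the admissible ball mass from T, the strip width and its growth constant
  from s, and a single large n at the end. The bound at this n, divided by n, gives the claim up to
  \<open>6 * e\<close>.\<close>

lemma entropy_rate_le:
  fixes a :: ennreal
  assumes S: "finite S" "S \<subseteq> carrier G" "generate G S = carrier G"
    and fin: "(\<integral>\<^sup>+x. ennreal (- ln (pmf \<mu> x)) \<partial>\<mu>) < \<infinity>"
    and fin_log: "(\<integral>\<^sup>+x. ennreal \<bar>ln (real (word_metric G S \<one> x))\<bar> \<partial>\<mu>) < \<infinity>"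
    and a: "\<And>n. of_nat n * a \<le> (\<integral>\<^sup>+g. ennreal (- ln (pmf (step n) g)) \<partial>step n)"
  shows "a \<le> (\<integral>\<^sup>+g. ennreal (ent g) \<partial>\<mu>)"
proof -
  let ?b = "\<integral>\<^sup>+g. ennreal (ent g) \<partial>\<mu>"
  have main: "a \<le> ?b + ennreal (6 * e)" if e: "e > 0" for e :: real
  proof -
    have e': "0 < ennreal e" using e by simp
    have "\<forall>\<^sub>F T in sequentially. (\<integral>\<^sup>+x. ennreal (- ln (pmf \<mu> x) - real T) \<partial>\<mu>) < ennreal e"
      using excess_tendsto_0[OF fin] e' by (rule order_tendstoD(2))
    then obtain T :: nat where T: "(\<integral>\<^sup>+x. ennreal (- ln (pmf \<mu> x) - real T) \<partial>\<mu>) \<le> ennreal e"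
      by (auto simp: eventually_sequentially intro: less_imp_le)
    \<comment> \<open>The first bound gives \<open>real T * s \<le> e\<close>; the second keeps the
      balls below mass 1/2, as \<open>strip_growth\<close> requires.\<close>
    define s where "s = min (e / (real T + 1)) (1/2)"
    have "s \<le> 1/2" unfolding s_def by (rule min.cobounded2)
    then have s: "0 < s" "s \<le> 1" "s \<le> 1/2" using e by (auto simp: s_def)
    have Ts: "real T * s \<le> e"
    proof -
      have "real T * s \<le> real T * (e / (real T + 1))" by (intro mult_left_mono) (auto simp: s_def)
      also have "\<dots> \<le> e" using e by (simp add: field_simps)
      finally show ?thesis .
    qed
    obtain d where d: "d > 0" "\<And>y. measure \<nu> (ball y d) < s" by (rule small_balls[OF s(1)]) blast
    have half: "measure \<nu> (ball y d) < 1/2" for y using d(2)[of y] s(3) by linarith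
    obtain C0 where C0: "\<And>x y k. card {g \<in> word_ball S k. d \<le> dist (\<phi> (inv g) x) (\<phi> (inv g) y)} \<le> C0 * Suc k"
      by (rule strip_growth[OF S(1,2) d(1) half]) blast
    define C where "C = Suc C0"
    have C1: "1 \<le> C" by (simp add: C_def)
    have C2: "card {g \<in> word_ball S k. d \<le> dist (\<phi> (inv g) x) (\<phi> (inv g) y)} \<le> C * Suc k" for x y k
      using C0[of k x y] mult_le_mono1[of C0 C "Suc k"] unfolding C_def by linarith
    note C = C1 C2
    define h where "h x = \<bar>ln (real (word_metric G S \<one> x))\<bar>" for x
    define \<kappa> where "\<kappa> n = (\<integral>\<^sup>+x. ennreal (h x) * indicator {x. e * real n < h x} x \<partial>\<mu>)" for n
    have "\<kappa> \<longlonglongrightarrow> 0" unfolding \<kappa>_def using fin_log e by (intro tail_tendsto_0) (simp_all add: h_def)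
    \<comment> \<open>By Markov's inequality \<open>e * real n\<close> times the escape probability
      of an increment is at most \<open>\<kappa> n\<close>, so this threshold makes T times n times
      that probability at most e.\<close>
    then have "\<forall>\<^sub>F n in sequentially. \<kappa> n < ennreal (e * e / (real T + 1))"
      using e by (intro order_tendstoD(2)) auto
    moreover have "\<forall>\<^sub>F n in sequentially. ln (2 * real C) + ln (real n + 1) \<le> e * real n"
      using e by real_asymp
    moreover have "\<forall>\<^sub>F n in sequentially. 1 \<le> (n :: nat)" by (rule eventually_ge_at_top)
    ultimately have "\<forall>\<^sub>F n in sequentially. \<kappa> n < ennreal (e * e / (real T + 1)) \<and>
        ln (2 * real C) + ln (real n + 1) \<le> e * real n \<and> 1 \<le> n" by (intro eventually_conj)
    then obtain n where n: "\<kappa> n < ennreal (e * e / (real T + 1))" "ln (2 * real C) + ln (real n + 1) \<le> e * real n" "1 \<le> n"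
      by (auto simp: eventually_sequentially)
    define r where "r = nat \<lfloor>exp (e * real n)\<rfloor>"
    \<comment> \<open>One \<open>e * real n\<close> is the logarithm of the radius of the increment
      balls; the other absorbs the growth constant and the factor n + 1.\<close>
    have c_le: "ln 2 + ln (real (C * Suc (n * r))) \<le> real n * (2 * e)"
    proof -
      have r: "real r \<le> exp (e * real n)" unfolding r_def by simp
      have "real (Suc (n * r)) \<le> real n * exp (e * real n) + exp (e * real n)"
      proof -
        have "1 \<le> exp (e * real n)" using e by simp
        moreover have "real n * real r \<le> real n * exp (e * real n)" using r by (intro mult_left_mono) auto
        moreover have "real (Suc (n * r)) = 1 + real n * real r" by simp
        ultimately show ?thesis by linarith
      qed
      then have "real (Suc (n * r)) \<le> (real n + 1) * exp (e * real n)" by (simp add: algebra_simps)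
      then have "ln (real (Suc (n * r))) \<le> ln ((real n + 1) * exp (e * real n))"
        by (rule ln_mono) (rule of_nat_0_less_iff[THEN iffD2, OF zero_less_Suc])
      also have "\<dots> = ln (real n + 1) + e * real n" by (simp add: ln_mult)
      finally have "ln (real (Suc (n * r))) \<le> ln (real n + 1) + e * real n" .
      moreover have "ln 2 + ln (real (C * Suc (n * r))) = ln (2 * real C) + ln (real (Suc (n * r)))"
      proof -
        have "0 < real C" "0 < real (Suc (n * r))" using C(1) by (simp_all only: of_nat_0_less_iff zero_less_Suc)
        then have "ln (real C * real (Suc (n * r))) = ln (real C) + ln (real (Suc (n * r)))" "ln (2 * real C) = ln 2 + ln (real C)"
          by (simp_all only: ln_mult_pos zero_less_numeral)
        then show ?thesis by (simp only: of_nat_mult)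
      qed
      ultimately show ?thesis using n(2) by (simp add: algebra_simps)
    qed
    have nP: "of_nat T * (of_nat n * emeasure \<mu> (- word_ball S r)) \<le> ennreal e"
    proof -
      define p where "p = measure_pmf.prob \<mu> (- word_ball S r)"
      have p: "emeasure \<mu> (- word_ball S r) = ennreal p" "0 \<le> p" by (auto simp: p_def measure_pmf.emeasure_eq_measure)
      have "ennreal (e * real n * p) = ennreal (e * real n) * emeasure \<mu> (- word_ball S r)"
        using e p by (simp add: ennreal_mult)
      also have "\<dots> \<le> \<kappa> n" unfolding \<kappa>_def r_def by (rule ball_compl_le[OF S(2,3) e]) (simp add: h_def)
      also have "\<dots> \<le> ennreal (e * e / (real T + 1))" using n(1) by simp
      finally have "e * real n * p \<le> e * e / (real T + 1)" using e by (subst (asm) ennreal_le_iff) auto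
      then have "e * (real n * p) \<le> e * (e / (real T + 1))" by (simp add: mult.assoc)
      then have "real n * p \<le> e / (real T + 1)" by (simp only: mult_le_cancel_left_pos[OF e])
      then have "real T * (real n * p) \<le> real T * (e / (real T + 1))" by (intro mult_left_mono) auto
      also have "\<dots> \<le> e" using e by (simp add: field_simps)
      finally have "ennreal (real T * (real n * p)) \<le> ennreal e" by (rule ennreal_leI)
      then show ?thesis using p by (simp add: ennreal_mult ennreal_of_nat_eq_real_of_nat)
    qed
    have Tse: "of_nat T * ennreal s \<le> ennreal e"
      using ennreal_leI[OF Ts] s(1) by (simp add: ennreal_mult ennreal_of_nat_eq_real_of_nat)
    \<comment> \<open>Per step, listing the strip costs \<open>2 * e\<close>, missing it e,
      increments outside the ball e, and the truncation excess \<open>2 * e\<close>.\<close>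
    have "of_nat n * a \<le> (\<integral>\<^sup>+g. ennreal (- ln (pmf (step n) g)) \<partial>step n)" by (rule a)
    also have "\<dots> \<le> (\<integral>\<^sup>+g. ennreal (ent g) \<partial>step n) + (ennreal (ln 2 + ln (real (C * Suc (n * r)))) +
      (\<integral>\<^sup>+g. ennreal (- ln (pmf (step n) g)) * (ennreal s + indicator (- word_ball S (n * r)) g) \<partial>step n))"
      by (rule entropy_step_strip[OF S(1,2) d(1) less_imp_le[OF d(2)] C])
    also have "(\<integral>\<^sup>+g. ennreal (ent g) \<partial>step n) = of_nat n * ?b" by (rule ent_step[OF fin])
    also have "of_nat n * ?b + (ennreal (ln 2 + ln (real (C * Suc (n * r)))) +
      (\<integral>\<^sup>+g. ennreal (- ln (pmf (step n) g)) * (ennreal s + indicator (- word_ball S (n * r)) g) \<partial>step n)) \<le>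
      of_nat n * ?b + (of_nat n * ennreal (2 * e) + of_nat n * (ennreal e + ennreal e + 2 * ennreal e))"
    proof (intro add_left_mono add_mono)
      show "ennreal (ln 2 + ln (real (C * Suc (n * r)))) \<le> of_nat n * ennreal (2 * e)"
        using ennreal_leI[OF c_le] e by (simp add: ennreal_mult ennreal_of_nat_eq_real_of_nat)
      have "(\<integral>\<^sup>+g. ennreal (- ln (pmf (step n) g)) * (ennreal s + indicator (- word_ball S (n * r)) g) \<partial>step n) \<le>
          of_nat n * (of_nat T * ennreal s + of_nat T * (of_nat n * emeasure \<mu> (- word_ball S r)) +
          2 * (\<integral>\<^sup>+x. ennreal (- ln (pmf \<mu> x) - T) \<partial>\<mu>))"
        using s by (intro entropy_tail_le S) auto
      also have "\<dots> \<le> of_nat n * (ennreal e + ennreal e + 2 * ennreal e)"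
        using Tse nP T by (intro mult_left_mono add_mono) auto
      finally show "(\<integral>\<^sup>+g. ennreal (- ln (pmf (step n) g)) * (ennreal s + indicator (- word_ball S (n * r)) g) \<partial>step n) \<le>
          of_nat n * (ennreal e + ennreal e + 2 * ennreal e)" .
    qed
    also have "\<dots> = of_nat n * (?b + ennreal (6 * e))"
    proof -
      have "2 * ennreal e = ennreal (2 * e)" using e by (simp add: ennreal_mult)
      then have "ennreal (2 * e) + (ennreal e + ennreal e + 2 * ennreal e) = ennreal (2 * e + (e + e + 2 * e))"
        using e by (simp only:) (simp only: ennreal_plus[symmetric] add_nonneg_nonneg less_imp_le mult_nonneg_nonneg zero_le_numeral)
      also have "2 * e + (e + e + 2 * e) = 6 * e" by simp
      finally show ?thesis by (simp only: distrib_left[symmetric])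
    qed
    finally have "of_nat n * a \<le> of_nat n * (?b + ennreal (6 * e))" .
    then show ?thesis using n(3) by (subst (asm) ennreal_mult_le_mult_iff) simp_all
  qed
  show ?thesis
  proof (rule ennreal_le_epsilon)
    fix e :: real assume "0 < e"
    then show "a \<le> ?b + ennreal e" using main[of "e / 6"] by simp
  qed
qed

end

section \<open>From the sums and weak limits of the definitions to the integrals of the
  locales\<close>

lemma nn_integral_pmf_infsum:
  fixes h :: "'a \<Rightarrow> real"
  assumes sum: "(\<lambda>g. pmf p g * h g) summable_on A" and nn: "\<And>g. g \<in> A \<Longrightarrow> 0 \<le> h g"
    and zero: "\<And>g. g \<in> set_pmf p \<Longrightarrow> g \<notin> A \<Longrightarrow> h g = 0"
  shows "(\<integral>\<^sup>+g. ennreal (h g) \<partial>p) = ennreal (\<Sum>\<^sub>\<infinity>g\<in>A. pmf p g * h g)"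
proof -
  let ?f = "\<lambda>g. pmf p g * h g"
  have abs: "Infinite_Set_Sum.abs_summable_on ?f A"
    by (rule abs_summable_equivalent[THEN iffD1, OF summable_on_iff_abs_summable_on_real[THEN iffD1, OF sum]])
  then have int: "integrable (count_space A) ?f" by (simp only: Infinite_Set_Sum.abs_summable_on_def)
  have "(\<integral>\<^sup>+g. ennreal (h g) \<partial>p) = (\<integral>\<^sup>+g. ennreal (pmf p g) * ennreal (h g) \<partial>count_space UNIV)"
    by (rule nn_integral_measure_pmf)
  also have "\<dots> = (\<integral>\<^sup>+g. ennreal (?f g) * indicator A g \<partial>count_space UNIV)"
  proof (rule nn_integral_cong)
    fix g
    consider "g \<in> A" | "g \<notin> A" "h g = 0" | "g \<notin> A" "pmf p g = 0"
      using zero by (auto simp: set_pmf_iff)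
    then show "ennreal (pmf p g) * ennreal (h g) = ennreal (?f g) * indicator A g"
      by cases (simp_all add: ennreal_mult')
  qed
  also have "\<dots> = (\<integral>\<^sup>+g. ennreal (?f g) \<partial>count_space A)"
    by (rule nn_integral_count_space_indicator[symmetric]) simp
  also have "\<dots> = ennreal (\<integral>g. ?f g \<partial>count_space A)"
    using nn by (intro nn_integral_eq_integral[OF int]) (simp add: AE_count_space)
  also have "(\<integral>g. ?f g \<partial>count_space A) = (\<Sum>\<^sub>\<infinity>g\<in>A. ?f g)"
    using infsetsum_infsum[OF abs] by (simp only: infsetsum_def)
  finally show ?thesis .
qed

lemma summable_on_pmf_mult:
  fixes h :: "'a \<Rightarrow> real"
  assumes "\<And>g. 0 \<le> h g" "\<And>g. h g \<le> 1"
  shows "(\<lambda>g. pmf p g * h g) summable_on A"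
proof -
  have "Infinite_Set_Sum.abs_summable_on (\<lambda>g. pmf p g * h g) A"
    by (rule abs_summable_on_comparison_test[OF pmf_abs_summable[of p A]])
      (use assms in \<open>auto simp: abs_mult mult_left_le\<close>)
  then show ?thesis
    by (rule summable_on_iff_abs_summable_on_real[THEN iffD2, OF abs_summable_equivalent[THEN iffD2]])
qed

context walk begin

lemma stationary_actionI:
  assumes act: "group_action G UNIV \<alpha>" and meas: "\<And>g. g \<in> carrier G \<Longrightarrow> \<alpha> g \<in> borel \<rightarrow>\<^sub>M borel"
    and stat: "stationary_prob G \<mu> \<alpha> \<eta>"
  shows "stationary_action G \<mu> \<alpha> \<eta>"
proof (intro stationary_action.intro stationary_action_axioms.intro walk_axioms)
  show prob: "prob_space \<eta>" using stat by (simp add: stationary_prob_def)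
  interpret prob_space \<eta> by (rule prob)
  have sets: "sets \<eta> = sets borel" using stat by (simp add: stationary_prob_def)
  show "space \<eta> = UNIV" using sets_eq_imp_space_eq[OF sets] by simp
  show "\<alpha> (g \<otimes> h) y = \<alpha> g (\<alpha> h y)" if "g \<in> carrier G" "h \<in> carrier G" for g h y
    using group_action.composition_rule[OF act] that by simp
  show "\<alpha> \<one> y = y" for y
    using group_action.id_eq_one[OF act] by (metis UNIV_I restrict_apply)
  show "\<alpha> g \<in> \<eta> \<rightarrow>\<^sub>M \<eta>" if "g \<in> carrier G" for g
    using meas[OF that] by (simp add: measurable_cong_sets[OF sets sets])
  fix A assume A: "A \<in> sets \<eta>"
  have tr: "measure (translate \<alpha> g \<eta>) A = measure \<eta> (\<alpha> g -` A)" if "g \<in> carrier G" for g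
  proof -
    have "\<alpha> g \<in> \<eta> \<rightarrow>\<^sub>M borel" using meas[OF that] by (simp add: measurable_cong_sets[OF sets refl])
    then show ?thesis
      using A sets sets_eq_imp_space_eq[OF sets] by (simp add: translate_def measure_distr)
  qed
  have "emeasure \<eta> A = ennreal (\<Sum>\<^sub>\<infinity>g\<in>carrier G. pmf \<mu> g * measure (translate \<alpha> g \<eta>) A)"
    using stat A sets by (simp add: stationary_prob_def emeasure_eq_measure)
  also have "(\<Sum>\<^sub>\<infinity>g\<in>carrier G. pmf \<mu> g * measure (translate \<alpha> g \<eta>) A) =
      (\<Sum>\<^sub>\<infinity>g\<in>carrier G. pmf \<mu> g * measure \<eta> (\<alpha> g -` A))"
    by (intro infsum_cong) (simp add: tr)
  also have "ennreal \<dots> = (\<integral>\<^sup>+g. ennreal (measure \<eta> (\<alpha> g -` A)) \<partial>\<mu>)"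
    using set_mu by (intro nn_integral_pmf_infsum[symmetric] summable_on_pmf_mult) auto
  finally show "emeasure \<eta> A = (\<integral>\<^sup>+g. emeasure \<eta> (\<alpha> g -` A) \<partial>\<mu>)"
    by (simp add: emeasure_eq_measure)
qed

lemma integral_translate:
  fixes f :: "'b::topological_space \<Rightarrow> real"
  assumes "\<alpha> g \<in> borel \<rightarrow>\<^sub>M borel" "sets \<eta> = sets borel" "f \<in> borel_measurable borel"
  shows "integral\<^sup>L (translate \<alpha> g \<eta>) f = (\<integral>y. f (\<alpha> g y) \<partial>\<eta>)"
  unfolding translate_def
  by (rule integral_distr) (use assms in \<open>simp_all add: measurable_cong_sets[OF assms(2) refl]\<close>)

lemma weakly_converges_walk_iff:
  fixes \<alpha> :: "'g \<Rightarrow> 'b::metric_space \<Rightarrow> 'b"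
  assumes meas: "\<And>g. g \<in> carrier G \<Longrightarrow> \<alpha> g \<in> borel \<rightarrow>\<^sub>M borel" and sets: "sets \<eta> = sets borel"
    and \<omega>: "\<forall>n. random_walk G \<omega> n = W n \<omega>"
  shows "weakly_converges (\<lambda>n. translate \<alpha> (random_walk G \<omega> n) \<eta>) (return borel b) \<longleftrightarrow>
    (\<forall>f::'b \<Rightarrow> real. continuous_on UNIV f \<and> bounded (range f) \<longrightarrow>
        (\<lambda>n. \<integral>y. f (\<alpha> (W n \<omega>) y) \<partial>\<eta>) \<longlonglongrightarrow> f b)"
proof -
  have "integral\<^sup>L (translate \<alpha> (random_walk G \<omega> n) \<eta>) f = (\<integral>y. f (\<alpha> (W n \<omega>) y) \<partial>\<eta>)"
    and "integral\<^sup>L (return borel b) f = f b"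
    if "continuous_on UNIV f" for f :: "'b \<Rightarrow> real" and n
    using borel_measurable_continuous_onI[OF that] \<omega> meas sets
    by (simp_all add: integral_translate integral_return)
  then show ?thesis unfolding weakly_converges_def by auto
qed

lemma boundary_actionI:
  fixes \<alpha> :: "'g \<Rightarrow> 'b::metric_space \<Rightarrow> 'b"
  assumes "mu_boundary G \<mu> \<alpha> \<eta>"
  shows "boundary_action G \<mu> \<alpha> \<eta>"
proof -
  have act: "group_action G UNIV \<alpha>" and meas: "\<And>g. g \<in> carrier G \<Longrightarrow> \<alpha> g \<in> borel \<rightarrow>\<^sub>M borel"
    and stat: "stationary_prob G \<mu> \<alpha> \<eta>"
    and conv: "AE \<omega> in P. \<exists>b. weakly_converges (\<lambda>n. translate \<alpha> (random_walk G \<omega> n) \<eta>) (return borel b)"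
    using assms by (simp_all add: mu_boundary_def)
  have sets: "sets \<eta> = sets borel" using stat by (simp add: stationary_prob_def)
  have "AE \<omega> in P. \<exists>b. \<forall>f::'b \<Rightarrow> real. continuous_on UNIV f \<and> bounded (range f) \<longrightarrow>
        (\<lambda>n. \<integral>y. f (\<alpha> (W n \<omega>) y) \<partial>\<eta>) \<longlonglongrightarrow> f b"
    using conv AE_W
  proof eventually_elim
    case (elim \<omega>)
    from weakly_converges_walk_iff[OF meas sets elim(2)] elim(1) show ?case by simp
  qed
  with stationary_actionI[OF act meas stat] sets show ?thesis
    by (intro boundary_action.intro boundary_action_axioms.intro)
qed

end

theorem theorem1p2:
  fixes G :: "('g, 'x) monoid_scheme"
    and \<phi> :: "'g \<Rightarrow> 'm::metric_space \<Rightarrow> 'm"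
    and S :: "'g set"
    and \<mu> :: "'g pmf"
    and \<nu> :: "'m measure"
  assumes "compact (UNIV :: 'm set)"
    and "group G" and "infinite (carrier G)"
    and "finite S" and "S \<subseteq> carrier G" and "generate G S = carrier G"
    and "convergence_group G \<phi>"
    and "non_elementary G \<phi>"
    and "minimal_action G \<phi>"
    and "generating_measure G \<mu>"
    and "finite_entropy G \<mu>"
    and "finite_log_moment G S \<mu>"
    and "stationary_prob G \<mu> \<phi> \<nu>"
  shows "is_Poisson_boundary TYPE('b::polish_space) G \<mu> \<phi> \<nu>"
proof -
  have act: "group_action G UNIV \<phi>" and count: "countable (carrier G)"
    using assms(7) by (simp_all add: convergence_group_def)
  have cont: "continuous_on UNIV (\<phi> g)" if "g \<in> carrier G" for g
  proof -
    have "homeomorphism UNIV UNIV (\<phi> g) (\<phi> (inv\<^bsub>G\<^esub> g))"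
      using assms(7) that by (simp add: convergence_group_def)
    then show ?thesis by (simp add: homeomorphism_def)
  qed
  have meas: "\<phi> g \<in> borel \<rightarrow>\<^sub>M borel" if "g \<in> carrier G" for g
    by (rule borel_measurable_continuous_onI[OF cont[OF that]])
  interpret walk G \<mu>
    using assms(2,10) count by (simp add: walk_def walk_axioms_def)
  have sets: "sets \<nu> = sets borel" using assms(13) by (simp add: stationary_prob_def)
  interpret A: convergence_walk G \<mu> \<phi> \<nu>
    using stationary_actionI[OF act meas assms(13)] assms sets
    by (intro convergence_walk.intro convergence_walk_axioms.intro) auto
  have fin: "(\<integral>\<^sup>+x. ennreal (- ln (pmf \<mu> x)) \<partial>\<mu>) < \<infinity>"
  proof -
    have "(\<lambda>g. pmf \<mu> g * (- ln (pmf \<mu> g))) summable_on carrier G"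
      using assms(11) by (simp add: finite_entropy_def)
    then have "(\<integral>\<^sup>+x. ennreal (- ln (pmf \<mu> x)) \<partial>\<mu>) = ennreal (\<Sum>\<^sub>\<infinity>g\<in>carrier G. pmf \<mu> g * (- ln (pmf \<mu> g)))"
    proof (rule nn_integral_pmf_infsum)
      show "0 \<le> - ln (pmf \<mu> g)" for g
        using pmf_nonneg[of \<mu> g] pmf_le_1[of \<mu> g] by (cases "pmf \<mu> g = 0") (auto simp: less_le)
    qed (use set_mu in auto)
    then show ?thesis by simp
  qed
  have fin_log: "(\<integral>\<^sup>+x. ennreal \<bar>ln (real (word_metric G S \<one>\<^bsub>G\<^esub> x))\<bar> \<partial>\<mu>) < \<infinity>"
  proof -
    \<comment> \<open>The moment sum omits the identity, where the integrand is
      \<open>ln 0 = 0\<close>; integral and sum therefore agree.\<close>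
    have "word_metric G S \<one>\<^bsub>G\<^esub> \<one>\<^bsub>G\<^esub> = 0"
      unfolding word_metric_def by (rule Least_eq_0) auto
    then have "(\<integral>\<^sup>+x. ennreal \<bar>ln (real (word_metric G S \<one>\<^bsub>G\<^esub> x))\<bar> \<partial>\<mu>) =
        ennreal (\<Sum>\<^sub>\<infinity>g\<in>carrier G - {\<one>\<^bsub>G\<^esub>}. pmf \<mu> g * \<bar>ln (real (word_metric G S \<one>\<^bsub>G\<^esub> g))\<bar>)"
      using assms(12) set_mu unfolding finite_log_moment_def by (intro nn_integral_pmf_infsum) auto
    then show ?thesis by simp
  qed
  have "mu_boundary G \<mu> \<phi> \<nu>"
  proof -
    have "AE \<omega> in P. \<exists>b. weakly_converges (\<lambda>n. translate \<phi> (random_walk G \<omega> n) \<nu>) (return borel b)"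
      using A.AE_limit_of_walk AE_W
    proof eventually_elim
      case (elim \<omega>)
      then obtain b where b: "\<forall>f::'m \<Rightarrow> real. continuous_on UNIV f \<longrightarrow> (\<lambda>n. \<integral>x. f (\<phi> (W n \<omega>) x) \<partial>\<nu>) \<longlonglongrightarrow> f b"
        by blast
      have "weakly_converges (\<lambda>n. translate \<phi> (random_walk G \<omega> n) \<nu>) (return borel b)"
        by (subst weakly_converges_walk_iff[OF meas sets elim(2)]) (use b in auto)
      then show ?case by blast
    qed
    then show ?thesis using act meas assms(13) by (simp add: mu_boundary_def)
  qed
  moreover have "boundary_ge G \<phi> \<nu> \<psi> \<eta>" if "mu_boundary G \<mu> \<psi> \<eta>" for \<psi> :: "'g \<Rightarrow> 'b \<Rightarrow> 'b" and \<eta>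
  proof -
    interpret B: boundary_action G \<mu> \<psi> \<eta> by (rule boundary_actionI[OF that])
    interpret AB: boundary_pair G \<mu> \<phi> \<nu> \<psi> \<eta> ..
    define a where "a = (\<integral>\<^sup>+g. ennreal (AB.J.Y.ent g) \<partial>\<mu>)"
    have a_step: "(\<integral>\<^sup>+g. ennreal (AB.J.Y.ent g) \<partial>step n) = of_nat n * a" for n
      unfolding a_def by (rule AB.J.Y.ent_step[OF fin])
    \<comment> \<open>By additivity, \<open>of_nat n * a\<close> is the n-step entropy of the joint
      law, and \<open>ent_le\<close> bounds it by the Shannon entropy of \<open>step n\<close>. The
      strip code then compares that with the entropy of \<nu> alone.\<close>
    have "a \<le> (\<integral>\<^sup>+g. ennreal (A.ent g) \<partial>\<mu>)"
    proof (rule A.entropy_rate_le[OF assms(4-6) fin fin_log])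
      show "of_nat n * a \<le> (\<integral>\<^sup>+g. ennreal (- ln (pmf (step n) g)) \<partial>step n)" for n
        unfolding a_step[symmetric]
        by (intro nn_integral_mono_AE AE_pmfI ennreal_leI AB.J.Y.ent_le)
    qed
    then have le: "(\<integral>\<^sup>+g. ennreal (AB.J.Y.ent g) \<partial>step n) \<le> (\<integral>\<^sup>+g. ennreal (A.ent g) \<partial>step n)" for n
      unfolding a_step A.ent_step[OF fin] by (intro mult_left_mono) auto
    have a_fin: "a < \<infinity>"
    proof -
      have "a \<le> (\<integral>\<^sup>+x. ennreal (- ln (pmf \<mu> x)) \<partial>\<mu>)"
        unfolding a_def using AB.J.Y.ent_le[of _ "Suc 0"]
        by (intro nn_integral_mono_AE AE_pmfI ennreal_leI) (simp add: step_1)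
      with fin show ?thesis by (rule le_less_trans[rotated])
    qed
    \<comment> \<open>The comparison so far concerns means over \<open>step n\<close>, while
      \<open>ent_factor_le\<close> gives the opposite inequality for each element. As the means are
      finite, equality holds throughout the support of \<open>step n\<close>, and every g is in such
      a support.\<close>
    have "AB.J.Y.ent g \<le> A.ent g" if g: "g \<in> carrier G" for g
    proof -
      obtain n where n: "g \<in> set_pmf (step n)" using carrier_step[OF g] by blast
      have mono: "ennreal (A.ent h) \<le> ennreal (AB.J.Y.ent h)" if "h \<in> set_pmf (step n)" for h
        using that set_step by (intro ennreal_leI AB.J.ent_factor_le) auto
      have finA: "(\<integral>\<^sup>+h. ennreal (A.ent h) \<partial>step n) \<noteq> \<infinity>"
      proof -
        have "(\<integral>\<^sup>+h. ennreal (A.ent h) \<partial>step n) \<le> of_nat n * a"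
          unfolding a_step[symmetric] using mono by (intro nn_integral_mono_AE AE_pmfI)
        also have "\<dots> < \<infinity>" using a_fin by (simp add: ennreal_mult_less_top of_nat_less_top)
        finally show ?thesis by simp
      qed
      have "(\<integral>\<^sup>+h. ennreal (AB.J.Y.ent h) - ennreal (A.ent h) \<partial>step n) =
          (\<integral>\<^sup>+h. ennreal (AB.J.Y.ent h) \<partial>step n) - (\<integral>\<^sup>+h. ennreal (A.ent h) \<partial>step n)"
        using finA mono by (intro nn_integral_diff) (auto intro: AE_pmfI)
      also have "\<dots> = 0" using le[of n] by (intro diff_eq_0_ennreal) (use finA in \<open>auto simp: less_top[symmetric] top_unique\<close>)
      finally have "AE h in step n. ennreal (AB.J.Y.ent h) - ennreal (A.ent h) = 0"
        by (subst (asm) nn_integral_0_iff_AE) auto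
      then have "ennreal (AB.J.Y.ent g) - ennreal (A.ent g) = 0"
        using n by (simp add: AE_measure_pmf_iff)
      then have "ennreal (AB.J.Y.ent g) \<le> ennreal (A.ent g)" by (simp add: diff_eq_0_iff_ennreal)
      then show ?thesis using A.ent_nonneg[OF g] by (subst (asm) ennreal_le_iff)
    qed
    then show ?thesis by (rule AB.boundary_ge_of_entropy)
  qed
  ultimately show ?thesis unfolding is_Poisson_boundary_def by blast
qed

end
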